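(* Work in $ZF+DC$. Let $E$ be any countable analytic equivalence relation on $2^{\omega}$ (i.e., $E\subseteq 2^{\omega}\times 2^{\omega}$ is an analytic equivalence relation all of whose classes are countable). If every $E$-invariant set of reals has the perfect set property, then every set of reals has the perfect set property.
   Context: A set $A\subseteq 2^{\omega}$ is $E$-invariant if $x\in A$ and $xEy$ imply $y\in A$. A set of reals has the perfect set property if it is either countable or contains a nonempty perfect subset. *)

theory Defs
  imports Main
begin

text \<open>
  HOL proves the axiom of choice, under which not every set of reals has the perfect set
  property. A claim made in ZF + DC is therefore stated here as the assertion that it holds in
  every model of ZF + DC, i.e. in every structure \<open>('a, mem)\<close> for the language of set theory that
  satisfies the axioms. The models are arbitrary first-order models: they need not be
  well-founded, and their power sets need not be full. All notions below are interpreted inside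
  the structure, so every quantifier ranges over its elements (type \<open>'a\<close>), and each definition is
  the interpretation of a first-order formula in \<open>mem\<close> alone.
\<close>

text \<open>
  First-order formulas in the language of set theory with named variables, needed only for the
  schemes of separation and replacement.
\<close>

datatype fm = Mem nat nat | Eq nat nat | Neg fm | Conj fm fm | Ex nat fm

locale set_structure =
  fixes mem :: "'a \<Rightarrow> 'a \<Rightarrow> bool"  (infix "\<epsilon>" 50)
begin

primrec sat :: "(nat \<Rightarrow> 'a) \<Rightarrow> fm \<Rightarrow> bool" where
  "sat e (Mem i j) \<longleftrightarrow> e i \<epsilon> e j"
| "sat e (Eq i j) \<longleftrightarrow> e i = e j"
| "sat e (Neg p) \<longleftrightarrow> \<not> sat e p"
| "sat e (Conj p q) \<longleftrightarrow> sat e p \<and> sat e q"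
| "sat e (Ex i p) \<longleftrightarrow> (\<exists>x. sat (e(i := x)) p)"

definition is_subset :: "'a \<Rightarrow> 'a \<Rightarrow> bool" where
  "is_subset x y \<longleftrightarrow> (\<forall>z. z \<epsilon> x \<longrightarrow> z \<epsilon> y)"

definition is_empty :: "'a \<Rightarrow> bool" where
  "is_empty x \<longleftrightarrow> (\<forall>y. \<not> y \<epsilon> x)"

definition is_upair :: "'a \<Rightarrow> 'a \<Rightarrow> 'a \<Rightarrow> bool" where
  "is_upair p x y \<longleftrightarrow> (\<forall>z. z \<epsilon> p \<longleftrightarrow> z = x \<or> z = y)"

definition is_pair :: "'a \<Rightarrow> 'a \<Rightarrow> 'a \<Rightarrow> bool" where
  "is_pair p x y \<longleftrightarrow> (\<exists>a b. is_upair a x x \<and> is_upair b x y \<and> is_upair p a b)"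

text \<open>\<open>rel r x y\<close>: the ordered pair of \<open>x\<close> and \<open>y\<close> belongs to \<open>r\<close>.\<close>

definition rel :: "'a \<Rightarrow> 'a \<Rightarrow> 'a \<Rightarrow> bool" where
  "rel r x y \<longleftrightarrow> (\<exists>p. is_pair p x y \<and> p \<epsilon> r)"

definition is_relation :: "'a \<Rightarrow> 'a \<Rightarrow> 'a \<Rightarrow> bool" where
  "is_relation r A B \<longleftrightarrow> (\<forall>p. p \<epsilon> r \<longrightarrow> (\<exists>x y. x \<epsilon> A \<and> y \<epsilon> B \<and> is_pair p x y))"

definition is_function :: "'a \<Rightarrow> 'a \<Rightarrow> 'a \<Rightarrow> bool" where
  "is_function f A B \<longleftrightarrow> is_relation f A B \<and> (\<forall>x. x \<epsilon> A \<longrightarrow> (\<exists>!y. rel f x y))"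

definition is_succ :: "'a \<Rightarrow> 'a \<Rightarrow> bool" where
  "is_succ s x \<longleftrightarrow> (\<forall>z. z \<epsilon> s \<longleftrightarrow> z \<epsilon> x \<or> z = x)"

definition is_inductive :: "'a \<Rightarrow> bool" where
  "is_inductive w \<longleftrightarrow>
     (\<exists>z. is_empty z \<and> z \<epsilon> w) \<and> (\<forall>x. x \<epsilon> w \<longrightarrow> (\<exists>s. is_succ s x \<and> s \<epsilon> w))"

definition is_omega :: "'a \<Rightarrow> bool" where
  "is_omega w \<longleftrightarrow> is_inductive w \<and> (\<forall>v. is_inductive v \<longrightarrow> is_subset w v)"

definition is_two :: "'a \<Rightarrow> bool" where
  "is_two t \<longleftrightarrow> (\<exists>z u. is_empty z \<and> is_succ u z \<and> is_succ t u)"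

text \<open>Elements of \<open>\<omega>\<close>, of the Cantor space \<open>2\<^sup>\<omega>\<close> and of the Baire space \<open>\<omega>\<^sup>\<omega>\<close>.\<close>

definition is_nat :: "'a \<Rightarrow> bool" where
  "is_nat n \<longleftrightarrow> (\<exists>w. is_omega w \<and> n \<epsilon> w)"

definition is_real :: "'a \<Rightarrow> bool" where
  "is_real x \<longleftrightarrow> (\<exists>w t. is_omega w \<and> is_two t \<and> is_function x w t)"

definition is_baire :: "'a \<Rightarrow> bool" where
  "is_baire z \<longleftrightarrow> (\<exists>w. is_omega w \<and> is_function z w w)"

definition set_of_reals :: "'a \<Rightarrow> bool" where
  "set_of_reals A \<longleftrightarrow> (\<forall>x. x \<epsilon> A \<longrightarrow> is_real x)"

definition is_countable :: "'a \<Rightarrow> bool" where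
  "is_countable A \<longleftrightarrow>
     (\<exists>w f. is_omega w \<and> is_function f A w \<and>
        (\<forall>x y n. rel f x n \<and> rel f y n \<longrightarrow> x = y))"

text \<open>
  \<open>agree n x y\<close>: the sequences \<open>x\<close> and \<open>y\<close> have the same restriction to \<open>n = {0, \<dots>, n - 1}\<close>. For a
  fixed \<open>x\<close> the sets of all such \<open>y\<close> form a neighbourhood base at \<open>x\<close> in the product topology, both
  on \<open>2\<^sup>\<omega>\<close> and on \<open>\<omega>\<^sup>\<omega>\<close>.
\<close>

definition agree :: "'a \<Rightarrow> 'a \<Rightarrow> 'a \<Rightarrow> bool" where
  "agree n x y \<longleftrightarrow> (\<forall>k v. k \<epsilon> n \<longrightarrow> (rel x k v \<longleftrightarrow> rel y k v))"

definition limit_point :: "'a \<Rightarrow> 'a \<Rightarrow> bool" where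
  "limit_point x A \<longleftrightarrow> (\<forall>n. is_nat n \<longrightarrow> (\<exists>y. y \<epsilon> A \<and> y \<noteq> x \<and> agree n x y))"

text \<open>Closed and without isolated points: the set is equal to the set of its limit points.\<close>

definition is_perfect :: "'a \<Rightarrow> bool" where
  "is_perfect P \<longleftrightarrow> set_of_reals P \<and> (\<forall>x. is_real x \<longrightarrow> (x \<epsilon> P \<longleftrightarrow> limit_point x P))"

definition perfect_set_property :: "'a \<Rightarrow> bool" where
  "perfect_set_property A \<longleftrightarrow>
     is_countable A \<or> (\<exists>P. is_perfect P \<and> \<not> is_empty P \<and> is_subset P A)"

text \<open>\<open>rel3 C x y z\<close>: the triple \<open>((x, y), z)\<close> belongs to \<open>C\<close>.\<close>

definition rel3 :: "'a \<Rightarrow> 'a \<Rightarrow> 'a \<Rightarrow> 'a \<Rightarrow> bool" where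
  "rel3 C x y z \<longleftrightarrow> (\<exists>p. is_pair p x y \<and> rel C p z)"

text \<open>Closed subsets of \<open>(2\<^sup>\<omega> \<times> 2\<^sup>\<omega>) \<times> \<omega>\<^sup>\<omega>\<close>, i.e. those containing all points of their closure.\<close>

definition closed3 :: "'a \<Rightarrow> bool" where
  "closed3 C \<longleftrightarrow>
     (\<forall>q. q \<epsilon> C \<longrightarrow>
        (\<exists>x y z p. is_real x \<and> is_real y \<and> is_baire z \<and> is_pair p x y \<and> is_pair q p z)) \<and>
     (\<forall>x y z. is_real x \<and> is_real y \<and> is_baire z \<and>
        (\<forall>n. is_nat n \<longrightarrow>
           (\<exists>x' y' z'. rel3 C x' y' z' \<and> agree n x x' \<and> agree n y y' \<and> agree n z z')) \<longrightarrow>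
        rel3 C x y z)"

text \<open>Analytic subsets of \<open>2\<^sup>\<omega> \<times> 2\<^sup>\<omega>\<close>: the projections of closed subsets of \<open>(2\<^sup>\<omega> \<times> 2\<^sup>\<omega>) \<times> \<omega>\<^sup>\<omega>\<close>.\<close>

definition is_analytic :: "'a \<Rightarrow> bool" where
  "is_analytic E \<longleftrightarrow>
     (\<exists>C. closed3 C \<and> (\<forall>p. p \<epsilon> E \<longleftrightarrow> (\<exists>x y z. is_pair p x y \<and> rel3 C x y z)))"

definition is_equivalence :: "'a \<Rightarrow> bool" where
  "is_equivalence E \<longleftrightarrow>
     (\<forall>p. p \<epsilon> E \<longrightarrow> (\<exists>x y. is_real x \<and> is_real y \<and> is_pair p x y)) \<and>
     (\<forall>x. is_real x \<longrightarrow> rel E x x) \<and>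
     (\<forall>x y. rel E x y \<longrightarrow> rel E y x) \<and>
     (\<forall>x y z. rel E x y \<and> rel E y z \<longrightarrow> rel E x z)"

definition countable_classes :: "'a \<Rightarrow> bool" where
  "countable_classes E \<longleftrightarrow>
     (\<forall>x. is_real x \<longrightarrow> (\<exists>c. (\<forall>y. y \<epsilon> c \<longleftrightarrow> rel E x y) \<and> is_countable c))"

definition invariant :: "'a \<Rightarrow> 'a \<Rightarrow> bool" where
  "invariant E A \<longleftrightarrow> (\<forall>x y. x \<epsilon> A \<and> rel E x y \<longrightarrow> y \<epsilon> A)"

end

text \<open>
  The environment \<open>e\<close> supplies the parameters in the two schemes. It is chosen before the set \<open>b\<close>,
  so \<open>b\<close> cannot occur in the formula.
\<close>

locale ZF_DC = set_structure mem
  for mem :: "'a \<Rightarrow> 'a \<Rightarrow> bool"  (infix "\<epsilon>" 50) +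
  assumes extensionality: "\<forall>x y. (\<forall>z. z \<epsilon> x \<longleftrightarrow> z \<epsilon> y) \<longrightarrow> x = y"
    and foundation: "\<forall>x. (\<exists>y. y \<epsilon> x) \<longrightarrow> (\<exists>y. y \<epsilon> x \<and> \<not> (\<exists>z. z \<epsilon> x \<and> z \<epsilon> y))"
    and pairing: "\<forall>x y. \<exists>p. is_upair p x y"
    and union: "\<forall>x. \<exists>u. \<forall>z. z \<epsilon> u \<longleftrightarrow> (\<exists>y. y \<epsilon> x \<and> z \<epsilon> y)"
    and power_set: "\<forall>x. \<exists>p. \<forall>z. z \<epsilon> p \<longleftrightarrow> is_subset z x"
    and infinity: "\<exists>w. is_inductive w"
    and separation:
      "\<forall>\<phi> e a. \<exists>b. \<forall>x. x \<epsilon> b \<longleftrightarrow> x \<epsilon> a \<and> sat (e(0 := x)) \<phi>"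
    and replacement:
      "\<forall>\<phi> e a. (\<forall>x. x \<epsilon> a \<longrightarrow> (\<exists>!y. sat (e(0 := x, 1 := y)) \<phi>)) \<longrightarrow>
         (\<exists>b. \<forall>y. y \<epsilon> b \<longleftrightarrow> (\<exists>x. x \<epsilon> a \<and> sat (e(0 := x, 1 := y)) \<phi>))"
    and dependent_choice:
      "\<forall>w X R. is_omega w \<and> (\<exists>x. x \<epsilon> X) \<and> (\<forall>x. x \<epsilon> X \<longrightarrow> (\<exists>y. y \<epsilon> X \<and> rel R x y)) \<longrightarrow>
         (\<exists>f. is_function f w X \<and>
           (\<forall>n m x y. n \<epsilon> w \<and> is_succ m n \<and> rel f n x \<and> rel f m y \<longrightarrow> rel R x y))"

end

theory Submission
  imports Defs
begin

text \<open>
  An analytic set with countable sections is meager, so by a fusion argument there is a continuous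
  \<open>f\<close> on \<open>2\<^sup>\<omega>\<close> with pairwise \<open>E\<close>-inequivalent values. Given a set \<open>A\<close> of reals, the saturation \<open>B\<close> of
  \<open>f[A]\<close> has the perfect set property. If \<open>B\<close> is countable, then so is \<open>A\<close>. If \<open>B\<close> contains a
  nonempty perfect set \<open>P\<close>, consider the analytic set \<open>A' = {a. \<exists>x\<in>P. x E f(a)}\<close>. Since the values of
  \<open>f\<close> are pairwise inequivalent, \<open>A' \<subseteq> A\<close>. It is uncountable, since \<open>P\<close> is covered by the countable
  classes of the \<open>f(a)\<close> with \<open>a \<in> A'\<close>. So \<open>A'\<close>, being analytic, contains a nonempty perfect set.

  All of this takes place inside an arbitrary model. Instances of separation are obtained by
  compiling HOL predicates, with the rules \<open>D_intros\<close>, into first-order formulas with parameters.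
\<close>

section \<open>Definability with parameters\<close>

text \<open>The obstacle is that \<open>W\<close>, the model's \<omega>, may be nonstandard: HOL
  recursion and induction do not reach inside the model, only induction for predicates definable
  with parameters does. Hence the \<open>D\<close> goals throughout, and hence generic chains in
  place of recursions: countably many dense requirements are met along an increasing chain of
  approximations supplied by DC (\<open>rasiowa_sikorski\<close>).

  Countable sections force meagerness because otherwise the set is nonmeager in every sub-box of
  some box; over a generic x a point of the section can then be built digit by digit while dodging
  the countably many members of the section. Meagerness in turn drives the fusion: any two
  neighbourhoods can be shrunk into each of countably many dense open sets of pairs.

  The perfect set in B lies in the saturation, not in the range of f, so it cannot be pulled back
  directly. Passing to the analytic set A' repairs this, since ZF + DC proves the perfect set
  theorem for analytic sets.\<close>

named_theorems D_intros

context set_structure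
begin

section \<open>Renaming of variables in formulas\<close>

primrec vars :: "fm \<Rightarrow> nat set" where
  "vars (Mem i j) = {i, j}"
| "vars (Eq i j) = {i, j}"
| "vars (Neg p) = vars p"
| "vars (Conj p q) = vars p \<union> vars q"
| "vars (Ex i p) = insert i (vars p)"

lemma finite_vars: "finite (vars p)"
  by (induction p) auto

lemma sat_cong: "(\<And>i. i \<in> vars p \<Longrightarrow> e i = e' i) \<Longrightarrow> sat e p \<longleftrightarrow> sat e' p"
proof (induction p arbitrary: e e')
  case (Conj p q)
  then show ?case by (metis UnCI sat.simps(4) vars.simps(4))
next
  case (Ex i p)
  have "sat (e(i := x)) p \<longleftrightarrow> sat (e'(i := x)) p" for x
    by (rule Ex.IH) (use Ex.prems in auto)
  then show ?case by simp
next
  case (Neg p)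
  then show ?case by (metis sat.simps(3) vars.simps(3))
qed simp_all

text \<open>The only danger is capture, since \<open>r\<close> need not be injective: the bound
  variable is sent to some \<open>k\<close> outside the finite image of \<open>vars p\<close> under
  \<open>r\<close>.\<close>

lemma sat_rename: "\<exists>q. \<forall>e. sat e q \<longleftrightarrow> sat (\<lambda>i. e (r i)) p"
proof (induction p arbitrary: r)
  case (Mem i j)
  show ?case by (rule exI[of _ "Mem (r i) (r j)"]) simp
next
  case (Eq i j)
  show ?case by (rule exI[of _ "Eq (r i) (r j)"]) simp
next
  case (Neg p)
  then obtain q where "\<forall>e. sat e q \<longleftrightarrow> sat (\<lambda>i. e (r i)) p" by blast
  then show ?case by (intro exI[of _ "Neg q"]) simp
next
  case (Conj p1 p2)
  then obtain q1 q2 where "\<forall>e. sat e q1 \<longleftrightarrow> sat (\<lambda>i. e (r i)) p1"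
    "\<forall>e. sat e q2 \<longleftrightarrow> sat (\<lambda>i. e (r i)) p2" by blast
  then show ?case by (intro exI[of _ "Conj q1 q2"]) simp
next
  case (Ex i p)
  have "finite (r ` vars p)" using finite_vars by simp
  then obtain k where k: "k \<notin> r ` vars p" using ex_new_if_finite infinite_UNIV_nat by blast
  obtain q where q: "\<forall>e. sat e q \<longleftrightarrow> sat (\<lambda>j. e ((r(i := k)) j)) p" using Ex by blast
  have "sat (e(k := x)) q \<longleftrightarrow> sat ((\<lambda>j. e (r j))(i := x)) p" for e x
  proof -
    have "sat (\<lambda>j. (e(k := x)) ((r(i := k)) j)) p \<longleftrightarrow> sat ((\<lambda>j. e (r j))(i := x)) p"
      by (rule sat_cong) (use k in auto)
    then show ?thesis using q by simp
  qed
  then show ?case by (intro exI[of _ "Ex k q"]) simp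
qed

text \<open>Even positions hold the variables, odd positions the parameters.\<close>

definition mix :: "(nat \<Rightarrow> 'a) \<Rightarrow> (nat \<Rightarrow> 'a) \<Rightarrow> nat \<Rightarrow> 'a" where
  "mix c v i = (if even i then v (i div 2) else c (i div 2))"

text \<open>
  \<open>D P\<close>: the predicate \<open>P\<close> of an environment is first-order definable with parameters. \<open>FT t\<close>: the
  graph of \<open>t\<close> is definable. Quantifiers are handled in de Bruijn style: the bound variable is
  \<open>v 0\<close>, and the old variables move up by one.
\<close>

definition D :: "((nat \<Rightarrow> 'a) \<Rightarrow> bool) \<Rightarrow> bool" where
  "D P \<longleftrightarrow> (\<exists>p c. \<forall>v. P v \<longleftrightarrow> sat (mix c v) p)"

definition FT :: "((nat \<Rightarrow> 'a) \<Rightarrow> 'a) \<Rightarrow> bool" where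
  "FT t \<longleftrightarrow> D (\<lambda>v. v 0 = t (\<lambda>i. v (Suc i)))"

text \<open>Only the even positions are moved; the parameters stay in place. This provides weakening
  and exchange for the de Bruijn variables.\<close>

lemma D_rename:
  assumes "D P" shows "D (\<lambda>v. P (\<lambda>i. v (r i)))"
proof -
  obtain p c where p: "\<And>v. P v \<longleftrightarrow> sat (mix c v) p" using assms unfolding D_def by blast
  obtain q where q: "\<And>e. sat e q \<longleftrightarrow> sat (\<lambda>i. e ((\<lambda>i. if even i then 2 * r (i div 2) else i) i)) p"
    using sat_rename[of "\<lambda>i. if even i then 2 * r (i div 2) else i" p] by blast
  have "mix c (\<lambda>i. v (r i)) = (\<lambda>i. mix c v ((\<lambda>i. if even i then 2 * r (i div 2) else i) i))" for v
    by (rule ext) (simp add: mix_def)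
  then have "P (\<lambda>i. v (r i)) \<longleftrightarrow> sat (mix c v) q" for v using p q by simp
  then show ?thesis unfolding D_def by blast
qed

lemma D_not[D_intros]:
  assumes "D P" shows "D (\<lambda>v. \<not> P v)"
proof -
  obtain p c where "\<And>v. P v \<longleftrightarrow> sat (mix c v) p" using assms unfolding D_def by blast
  then have "\<forall>v. \<not> P v \<longleftrightarrow> sat (mix c v) (Neg p)" by simp
  then show ?thesis unfolding D_def by blast
qed

lemma D_conj[D_intros]:
  assumes "D P" "D Q" shows "D (\<lambda>v. P v \<and> Q v)"
proof -
  obtain p c where p: "\<And>v. P v \<longleftrightarrow> sat (mix c v) p" using assms unfolding D_def by blast
  obtain q d where q: "\<And>v. Q v \<longleftrightarrow> sat (mix d v) q" using assms unfolding D_def by blast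
  \<comment> \<open>The two parameter sequences are interleaved: parameter j of \<open>P\<close>
    becomes parameter 2j, parameter j of \<open>Q\<close> becomes parameter 2j+1.\<close>
  let ?r = "\<lambda>i::nat. if even i then i else 2 * (2 * (i div 2)) + 1"
  let ?s = "\<lambda>i::nat. if even i then i else 2 * (2 * (i div 2) + 1) + 1"
  obtain p' where p': "\<And>e. sat e p' \<longleftrightarrow> sat (\<lambda>i. e (?r i)) p" using sat_rename[of ?r p] by blast
  obtain q' where q': "\<And>e. sat e q' \<longleftrightarrow> sat (\<lambda>i. e (?s i)) q" using sat_rename[of ?s q] by blast
  let ?c = "\<lambda>i. if even i then c (i div 2) else d (i div 2)"
  have "(\<lambda>i. mix ?c v (?r i)) = mix c v" for v by (rule ext) (auto simp: mix_def elim!: oddE)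
  moreover have "(\<lambda>i. mix ?c v (?s i)) = mix d v" for v by (rule ext) (auto simp: mix_def elim!: oddE)
  ultimately have "\<forall>v. (P v \<and> Q v) \<longleftrightarrow> sat (mix ?c v) (Conj p' q')" using p q p' q' by simp
  then show ?thesis unfolding D_def by blast
qed

lemma D_ex_case:
  assumes "D P" shows "D (\<lambda>v. \<exists>x. P (case_nat x v))"
proof -
  obtain p c where p: "\<And>v. P v \<longleftrightarrow> sat (mix c v) p" using assms unfolding D_def by blast
  \<comment> \<open>The bound variable goes to position 1, the first parameter slot. The parameters
    move up one slot to free it, and variable j+1 of the body becomes variable j.\<close>
  let ?r = "\<lambda>i::nat. if i = 0 then 1 else if even i then i - 2 else i + 2"
  obtain q where q: "\<And>e. sat e q \<longleftrightarrow> sat (\<lambda>i. e (?r i)) p" using sat_rename[of ?r p] by blast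
  let ?c = "\<lambda>i. c (i - 1)"
  have "(\<lambda>i. ((mix ?c v)(1 := x)) (?r i)) = mix c (case_nat x v)" for v x
  proof
    fix i :: nat
    show "((mix ?c v)(1 := x)) (?r i) = mix c (case_nat x v) i"
    proof (cases "even i")
      case True
      then obtain j where "i = 2 * j" by blast
      then show ?thesis by (cases j) (auto simp: mix_def)
    next
      case False
      then obtain j where "i = 2 * j + 1" by (rule oddE)
      then show ?thesis by (auto simp: mix_def)
    qed
  qed
  then have "\<forall>v. (\<exists>x. P (case_nat x v)) \<longleftrightarrow> sat (mix ?c v) (Ex 1 q)" using p q by simp
  then show ?thesis unfolding D_def by blast
qed

lemma D_ex[D_intros]:
  assumes "D (\<lambda>v. P (\<lambda>i. v (Suc i)) (v 0))" shows "D (\<lambda>v. \<exists>x. P v x)"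
  using D_ex_case[OF assms] by simp

lemma D_disj[D_intros]: "D P \<Longrightarrow> D Q \<Longrightarrow> D (\<lambda>v. P v \<or> Q v)"
  using D_not[OF D_conj[OF D_not[of P] D_not[of Q]]] by simp

lemma D_imp[D_intros]: "D P \<Longrightarrow> D Q \<Longrightarrow> D (\<lambda>v. P v \<longrightarrow> Q v)"
  unfolding imp_conv_disj by (intro D_disj D_not)

lemma D_iff[D_intros]: "D P \<Longrightarrow> D Q \<Longrightarrow> D (\<lambda>v. P v \<longleftrightarrow> Q v)"
  unfolding iff_conv_conj_imp by (intro D_conj D_imp)

lemma D_all[D_intros]:
  assumes "D (\<lambda>v. P (\<lambda>i. v (Suc i)) (v 0))" shows "D (\<lambda>v. \<forall>x. P v x)"
proof -
  have "D (\<lambda>v. \<not> (\<exists>x. \<not> P v x))" by (intro D_not D_ex assms)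
  then show ?thesis by simp
qed

lemma D_mem_var: "D (\<lambda>v. v i \<epsilon> v j)"
  unfolding D_def by (rule exI[of _ "Mem (2*i) (2*j)"]) (simp add: mix_def)

lemma D_eq_var: "D (\<lambda>v. v i = v j)"
  unfolding D_def by (rule exI[of _ "Eq (2*i) (2*j)"]) (simp add: mix_def)

lemma FT_var[D_intros]: "FT (\<lambda>v. v i)"
  unfolding FT_def by (rule D_eq_var)

text \<open>Every element of the model may be a parameter, so all sets fixed in a later proof can
  occur in compiled predicates.\<close>

lemma FT_const[D_intros]: "FT (\<lambda>v. c)"
  unfolding FT_def D_def by (rule exI[of _ "Eq 0 1"], rule exI[of _ "\<lambda>_. c"]) (simp add: mix_def)

text \<open>Unfolding \<open>\<exists>!\<close>, \<open>The0\<close> and \<open>Coll\<close> puts a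
  body under two binders of which it mentions only the inner one; its other variables must then skip
  one more place.\<close>

lemma D_weaken:
  "D (\<lambda>v. P (\<lambda>i. v (Suc i)) (v 0)) \<Longrightarrow> D (\<lambda>v. P (\<lambda>i. v (Suc (Suc i))) (v 0))"
  by (drule D_rename[where r = "\<lambda>i. case i of 0 \<Rightarrow> 0 | Suc i \<Rightarrow> Suc (Suc i)"]) simp

lemma FT_shift: "FT t \<Longrightarrow> FT (\<lambda>v. t (\<lambda>i. v (Suc i)))"
  unfolding FT_def by (drule D_rename[where r = "\<lambda>i. case i of 0 \<Rightarrow> 0 | Suc i \<Rightarrow> Suc (Suc i)"]) simp

lemma D_subst:
  assumes "D P" "FT t" shows "D (\<lambda>v. P (case_nat (t v) v))"
proof -
  have "D (\<lambda>v. \<exists>x. x = t v \<and> P (case_nat x v))"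
  proof (rule D_ex, rule D_conj)
    show "D (\<lambda>v. v 0 = t (\<lambda>i. v (Suc i)))" using assms(2) unfolding FT_def .
    have "case_nat (v 0) (\<lambda>i. v (Suc i)) = v" for v :: "nat \<Rightarrow> 'a"
      by (rule ext) (simp split: nat.split)
    then show "D (\<lambda>v. P (case_nat (v 0) (\<lambda>i. v (Suc i))))" using assms(1) by simp
  qed
  then show ?thesis by simp
qed

lemma D1: "D (\<lambda>v. P (v 0)) \<Longrightarrow> FT s \<Longrightarrow> D (\<lambda>v. P (s v))"
  by (drule (1) D_subst) simp

text \<open>Thanks to this and its analogues, each notion has to be compiled only once, with
  variables as arguments.\<close>

lemma D2:
  assumes "D (\<lambda>v. P (v 0) (v (Suc 0)))" "FT s" "FT t"
  shows "D (\<lambda>v. P (s v) (t v))"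
proof -
  \<comment> \<open>\<open>D_subst\<close> acts on variable 0 only, so the arguments are exchanged
    and substituted in turn; \<open>t\<close> is shifted past the variable that still stands for
    \<open>s\<close>.\<close>
  have "D (\<lambda>v. P (v 1) (v 0))"
    using D_rename[OF assms(1), of "\<lambda>i. if i = 0 then 1 else 0"] by simp
  from D_subst[OF this FT_shift[OF assms(3)]]
  have "D (\<lambda>v. P (v 0) (t (\<lambda>i. v (Suc i))))" by simp
  from D_subst[OF this assms(2)] show ?thesis by simp
qed

lemma D3:
  assumes "D (\<lambda>v. P (v 0) (v (Suc 0)) (v (Suc (Suc 0))))" "FT s" "FT t" "FT u"
  shows "D (\<lambda>v. P (s v) (t v) (u v))"
proof -
  have "D (\<lambda>v. P (v 1) (v 2) (v 0))"
    using D_rename[OF assms(1), of "\<lambda>i. if i = 0 then 1 else if i = 1 then 2 else 0"]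
    by simp
  from D_subst[OF this FT_shift[OF FT_shift[OF assms(4)]]]
  have "D (\<lambda>v. P (v 0) (v 1) (u (\<lambda>i. v (Suc (Suc i)))))" by (simp add: numeral_2_eq_2)
  then have "D (\<lambda>v. P (v 1) (v 0) (u (\<lambda>i. v (Suc (Suc i)))))"
    by (drule_tac D_rename[where r = "\<lambda>i. if i = 0 then 1 else if i = 1 then 0 else i"]) simp
  from D_subst[OF this FT_shift[OF assms(3)]]
  have "D (\<lambda>v. P (v 0) (t (\<lambda>i. v (Suc i))) (u (\<lambda>i. v (Suc i))))" by simp
  from D_subst[OF this assms(2)] show ?thesis by simp
qed

lemma D_mem[D_intros]: "FT s \<Longrightarrow> FT t \<Longrightarrow> D (\<lambda>v. s v \<epsilon> t v)"
  by (rule D2[of "\<lambda>x y. x \<epsilon> y"]) (rule D_mem_var)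

lemma D_eq[D_intros]: "FT s \<Longrightarrow> FT t \<Longrightarrow> D (\<lambda>v. s v = t v)"
  by (rule D2[of "\<lambda>x y. x = y"]) (rule D_eq_var)

lemma D_ex1[D_intros]:
  assumes "D (\<lambda>v. P (\<lambda>i. v (Suc i)) (v 0))" shows "D (\<lambda>v. \<exists>!x. P v x)"
proof -
  note [D_intros] = assms D_weaken[OF assms]
  show ?thesis unfolding Ex1_def by (intro D_intros)
qed

text \<open>
  Unlike \<open>THE\<close>, this has one fixed junk value, which keeps its graph definable.
\<close>

definition The0 :: "('a \<Rightarrow> bool) \<Rightarrow> 'a" where
  "The0 P = (if \<exists>!x. P x then THE x. P x else undefined)"

lemma The0_eq: "P x \<Longrightarrow> (\<And>y. P y \<Longrightarrow> y = x) \<Longrightarrow> The0 P = x"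
  unfolding The0_def by (metis the_equality)

lemma FT_The0[D_intros]:
  assumes "D (\<lambda>v. P (\<lambda>i. v (Suc i)) (v 0))" shows "FT (\<lambda>v. The0 (P v))"
proof -
  note [D_intros] = assms D_weaken[OF assms]
  \<comment> \<open>The graph splits according to whether exactly one element qualifies; the junk
    value \<open>undefined\<close> is then one more parameter.\<close>
  have eq: "y = The0 Q \<longleftrightarrow> ((\<exists>!x. Q x) \<and> Q y \<or> \<not> (\<exists>!x. Q x) \<and> y = undefined)" for y Q
  proof (cases "\<exists>!x. Q x")
    case True
    then have "Q (The Q)" by (rule theI')
    then show ?thesis using True unfolding The0_def by auto
  next
    case False
    then show ?thesis by (simp add: The0_def)
  qed
  show ?thesis unfolding FT_def eq by (intro D_intros)
qed

text \<open>Class abstraction: meaningful only if the class is a set of the model, and the junk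
  value of \<open>The0\<close> otherwise.\<close>

definition Coll :: "('a \<Rightarrow> bool) \<Rightarrow> 'a" where
  "Coll P = The0 (\<lambda>b. \<forall>x. x \<epsilon> b \<longleftrightarrow> P x)"

lemma FT_Coll[D_intros]:
  assumes "D (\<lambda>v. P (\<lambda>i. v (Suc i)) (v 0))" shows "FT (\<lambda>v. Coll (P v))"
proof -
  note [D_intros] = D_weaken[OF assms]
  show ?thesis unfolding Coll_def by (intro D_intros)
qed

lemma FT1:
  assumes "FT (\<lambda>v. F (v 0))" "FT s" shows "FT (\<lambda>v. F (s v))"
proof -
  have "D (\<lambda>v. v 0 = F (v (Suc 0)))" using assms(1) unfolding FT_def .
  from D2[of "\<lambda>x y. x = F y", OF this FT_var[of 0] FT_shift[OF assms(2)]]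
  show ?thesis unfolding FT_def .
qed

lemma FT2:
  assumes "FT (\<lambda>v. F (v 0) (v (Suc 0)))" "FT s" "FT t" shows "FT (\<lambda>v. F (s v) (t v))"
proof -
  have "D (\<lambda>v. v 0 = F (v (Suc 0)) (v (Suc (Suc 0))))" using assms(1) unfolding FT_def .
  from D3[of "\<lambda>x y z. x = F y z", OF this FT_var[of 0] FT_shift[OF assms(2)] FT_shift[OF assms(3)]]
  show ?thesis unfolding FT_def .
qed

definition Sep :: "'a \<Rightarrow> ('a \<Rightarrow> bool) \<Rightarrow> 'a" where
  "Sep a P = Coll (\<lambda>x. x \<epsilon> a \<and> P x)"

lemma FT_Sep[D_intros]:
  assumes "FT a" "D (\<lambda>v. P (\<lambda>i. v (Suc i)) (v 0))" shows "FT (\<lambda>v. Sep (a v) (P v))"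
proof -
  note [D_intros] = assms(2) FT_shift[OF assms(1)]
  show ?thesis unfolding Sep_def by (intro D_intros)
qed

lemma D_is_subset[D_intros]: "FT s \<Longrightarrow> FT t \<Longrightarrow> D (\<lambda>v. is_subset (s v) (t v))"
  by (rule D2[of is_subset]) (unfold is_subset_def, intro D_intros)

lemma D_is_empty[D_intros]: "FT s \<Longrightarrow> D (\<lambda>v. is_empty (s v))"
  by (rule D1[of is_empty]) (unfold is_empty_def, intro D_intros)

lemma D_is_upair[D_intros]: "FT s \<Longrightarrow> FT t \<Longrightarrow> FT u \<Longrightarrow> D (\<lambda>v. is_upair (s v) (t v) (u v))"
  by (rule D3[of is_upair]) (unfold is_upair_def, intro D_intros)

lemma D_is_pair[D_intros]: "FT s \<Longrightarrow> FT t \<Longrightarrow> FT u \<Longrightarrow> D (\<lambda>v. is_pair (s v) (t v) (u v))"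
  by (rule D3[of is_pair]) (unfold is_pair_def, intro D_intros)

lemma D_rel[D_intros]: "FT s \<Longrightarrow> FT t \<Longrightarrow> FT u \<Longrightarrow> D (\<lambda>v. rel (s v) (t v) (u v))"
  by (rule D3[of rel]) (unfold rel_def, intro D_intros)

lemma D_is_function[D_intros]:
  "FT s \<Longrightarrow> FT t \<Longrightarrow> FT u \<Longrightarrow> D (\<lambda>v. is_function (s v) (t v) (u v))"
  by (rule D3[of is_function]) (unfold is_function_def is_relation_def, intro D_intros)

lemma D_is_succ[D_intros]: "FT s \<Longrightarrow> FT t \<Longrightarrow> D (\<lambda>v. is_succ (s v) (t v))"
  by (rule D2[of is_succ]) (unfold is_succ_def, intro D_intros)

lemma D_is_inductive[D_intros]: "FT s \<Longrightarrow> D (\<lambda>v. is_inductive (s v))"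
  by (rule D1[of is_inductive]) (unfold is_inductive_def, intro D_intros)

lemma D_is_omega[D_intros]: "FT s \<Longrightarrow> D (\<lambda>v. is_omega (s v))"
  by (rule D1[of is_omega]) (unfold is_omega_def, intro D_intros)

lemma D_is_two[D_intros]: "FT s \<Longrightarrow> D (\<lambda>v. is_two (s v))"
  by (rule D1[of is_two]) (unfold is_two_def, intro D_intros)

lemma D_is_real[D_intros]: "FT s \<Longrightarrow> D (\<lambda>v. is_real (s v))"
  by (rule D1[of is_real]) (unfold is_real_def, intro D_intros)

lemma D_is_countable[D_intros]: "FT s \<Longrightarrow> D (\<lambda>v. is_countable (s v))"
  by (rule D1[of is_countable]) (unfold is_countable_def, intro D_intros)

lemma D_agree[D_intros]: "FT s \<Longrightarrow> FT t \<Longrightarrow> FT u \<Longrightarrow> D (\<lambda>v. agree (s v) (t v) (u v))"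
  by (rule D3[of agree]) (unfold agree_def, intro D_intros)

end

section \<open>Sets, functions and natural numbers\<close>

context set_structure
begin

definition emp :: 'a where "emp = Coll (\<lambda>_. False)"
definition upr :: "'a \<Rightarrow> 'a \<Rightarrow> 'a" where "upr x y = Coll (\<lambda>z. z = x \<or> z = y)"
definition pr :: "'a \<Rightarrow> 'a \<Rightarrow> 'a" where "pr x y = upr (upr x x) (upr x y)"
definition Pw :: "'a \<Rightarrow> 'a" where "Pw a = Coll (\<lambda>x. is_subset x a)"
definition Uni :: "'a \<Rightarrow> 'a" where "Uni a = Coll (\<lambda>x. \<exists>y. y \<epsilon> a \<and> x \<epsilon> y)"
definition cup :: "'a \<Rightarrow> 'a \<Rightarrow> 'a" where "cup a b = Coll (\<lambda>x. x \<epsilon> a \<or> x \<epsilon> b)"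
definition adj :: "'a \<Rightarrow> 'a \<Rightarrow> 'a" where "adj a x = cup a (upr x x)"
definition suc :: "'a \<Rightarrow> 'a" where "suc x = adj x x"
definition cart :: "'a \<Rightarrow> 'a \<Rightarrow> 'a" where
  "cart a b = Coll (\<lambda>p. \<exists>x y. x \<epsilon> a \<and> y \<epsilon> b \<and> p = pr x y)"
definition W :: 'a where "W = The0 is_omega"
definition Two :: 'a where "Two = suc (suc emp)"
definition app :: "'a \<Rightarrow> 'a \<Rightarrow> 'a" where "app f x = The0 (\<lambda>y. pr x y \<epsilon> f)"
definition dm :: "'a \<Rightarrow> 'a" where "dm f = Coll (\<lambda>x. \<exists>y. pr x y \<epsilon> f)"
definition restr :: "'a \<Rightarrow> 'a \<Rightarrow> 'a" where "restr f n = Sep f (\<lambda>p. \<exists>k v. k \<epsilon> n \<and> p = pr k v)"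
definition fst' :: "'a \<Rightarrow> 'a" where "fst' p = The0 (\<lambda>x. \<exists>y. p = pr x y)"
definition snd' :: "'a \<Rightarrow> 'a" where "snd' p = The0 (\<lambda>y. \<exists>x. p = pr x y)"

abbreviation sub (infix "\<sqsubseteq>" 50) where "x \<sqsubseteq> y \<equiv> is_subset x y"

lemma FT_upr[D_intros]: "FT s \<Longrightarrow> FT t \<Longrightarrow> FT (\<lambda>v. upr (s v) (t v))"
  by (rule FT2[of upr]) (unfold upr_def, intro D_intros)
lemma FT_pr[D_intros]: "FT s \<Longrightarrow> FT t \<Longrightarrow> FT (\<lambda>v. pr (s v) (t v))"
  by (rule FT2[of pr]) (unfold pr_def, intro D_intros)
lemma FT_Pw[D_intros]: "FT s \<Longrightarrow> FT (\<lambda>v. Pw (s v))"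
  by (rule FT1[of Pw]) (unfold Pw_def, intro D_intros)
lemma FT_Uni[D_intros]: "FT s \<Longrightarrow> FT (\<lambda>v. Uni (s v))"
  by (rule FT1[of Uni]) (unfold Uni_def, intro D_intros)
lemma FT_cup[D_intros]: "FT s \<Longrightarrow> FT t \<Longrightarrow> FT (\<lambda>v. cup (s v) (t v))"
  by (rule FT2[of cup]) (unfold cup_def, intro D_intros)
lemma FT_adj[D_intros]: "FT s \<Longrightarrow> FT t \<Longrightarrow> FT (\<lambda>v. adj (s v) (t v))"
  by (rule FT2[of adj]) (unfold adj_def, intro D_intros)
lemma FT_suc[D_intros]: "FT s \<Longrightarrow> FT (\<lambda>v. suc (s v))"
  by (rule FT1[of suc]) (unfold suc_def, intro D_intros)
lemma FT_cart[D_intros]: "FT s \<Longrightarrow> FT t \<Longrightarrow> FT (\<lambda>v. cart (s v) (t v))"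
  by (rule FT2[of cart]) (unfold cart_def, intro D_intros)
lemma FT_app[D_intros]: "FT s \<Longrightarrow> FT t \<Longrightarrow> FT (\<lambda>v. app (s v) (t v))"
  by (rule FT2[of app]) (unfold app_def, intro D_intros)
lemma FT_dm[D_intros]: "FT s \<Longrightarrow> FT (\<lambda>v. dm (s v))"
  by (rule FT1[of dm]) (unfold dm_def, intro D_intros)
lemma FT_restr[D_intros]: "FT s \<Longrightarrow> FT t \<Longrightarrow> FT (\<lambda>v. restr (s v) (t v))"
  by (rule FT2[of restr]) (unfold restr_def, intro D_intros)
lemma FT_fst'[D_intros]: "FT s \<Longrightarrow> FT (\<lambda>v. fst' (s v))"
  by (rule FT1[of fst']) (unfold fst'_def, intro D_intros)
lemma FT_snd'[D_intros]: "FT s \<Longrightarrow> FT (\<lambda>v. snd' (s v))"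
  by (rule FT1[of snd']) (unfold snd'_def, intro D_intros)

end

context ZF_DC
begin

section \<open>Sets of the model obtained from definable classes\<close>

lemma set_ext: "(\<And>z. z \<epsilon> x \<longleftrightarrow> z \<epsilon> y) \<Longrightarrow> x = y"
  using extensionality by blast

lemma mem_Coll':
  assumes "\<forall>x. x \<epsilon> b \<longleftrightarrow> P x" shows "x \<epsilon> Coll P \<longleftrightarrow> P x"
proof -
  have "Coll P = b" unfolding Coll_def
    by (rule The0_eq) (use assms in \<open>auto intro: set_ext\<close>)
  then show ?thesis using assms by simp
qed

lemma mem_Coll:
  assumes "D (\<lambda>v. P (v 0))" "\<And>x. P x \<Longrightarrow> x \<epsilon> a" shows "x \<epsilon> Coll P \<longleftrightarrow> P x"
proof -
  obtain p c where p: "\<And>v. P (v 0) \<longleftrightarrow> sat (mix c v) p" using assms(1) unfolding D_def by blast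
  \<comment> \<open>The separation scheme varies position 0, which \<open>mix\<close> reads as
    variable 0; the other variables are frozen at a dummy value.\<close>
  have "(mix c (\<lambda>_. undefined))(0 := x) = mix c (\<lambda>i. if i = 0 then x else undefined)" for x
    by (rule HOL.ext) (auto simp: mix_def elim!: evenE)
  then have sat: "sat ((mix c (\<lambda>_. undefined))(0 := x)) p \<longleftrightarrow> P x" for x
    using p[of "\<lambda>i. if i = 0 then x else undefined"] by simp
  obtain b where "\<forall>x. x \<epsilon> b \<longleftrightarrow> x \<epsilon> a \<and> sat ((mix c (\<lambda>_. undefined))(0 := x)) p"
    using separation by blast
  then have "\<forall>x. x \<epsilon> b \<longleftrightarrow> P x" using sat assms(2) by blast
  then show ?thesis by (rule mem_Coll')
qed

lemma mem_Sep: "D (\<lambda>v. P (v 0)) \<Longrightarrow> x \<epsilon> Sep a P \<longleftrightarrow> x \<epsilon> a \<and> P x"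
  unfolding Sep_def by (rule mem_Coll[where a = a]) (intro D_intros, auto)

lemma mem_emp[simp]: "\<not> x \<epsilon> emp"
  using mem_Sep[of "\<lambda>_. False" _ undefined] unfolding emp_def
  \<comment> \<open>\<open>Neg (Eq 0 0)\<close> compiles the constantly false predicate; any set
    bounds the empty class.\<close>
  by (subst mem_Coll[where a = undefined]) (auto intro: D_intros simp: D_def intro!: exI[of _ "Neg (Eq 0 0)"])

lemma mem_upr[simp]: "z \<epsilon> upr x y \<longleftrightarrow> z = x \<or> z = y"
proof -
  obtain p where "is_upair p x y" using pairing by blast
  then show ?thesis unfolding upr_def is_upair_def by (rule mem_Coll')
qed

lemma mem_Pw[simp]: "x \<epsilon> Pw a \<longleftrightarrow> x \<sqsubseteq> a"
proof -
  obtain p where "\<forall>z. z \<epsilon> p \<longleftrightarrow> is_subset z a" using power_set by blast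
  then show ?thesis unfolding Pw_def by (rule mem_Coll')
qed

lemma mem_Uni[simp]: "x \<epsilon> Uni a \<longleftrightarrow> (\<exists>y. y \<epsilon> a \<and> x \<epsilon> y)"
proof -
  obtain p where "\<forall>z. z \<epsilon> p \<longleftrightarrow> (\<exists>y. y \<epsilon> a \<and> z \<epsilon> y)" using union by blast
  then show ?thesis unfolding Uni_def by (rule mem_Coll')
qed

lemma mem_cup[simp]: "x \<epsilon> cup a b \<longleftrightarrow> x \<epsilon> a \<or> x \<epsilon> b"
  unfolding cup_def by (rule mem_Coll[where a = "Uni (upr a b)"]) (intro D_intros, auto)

lemma mem_adj[simp]: "y \<epsilon> adj a x \<longleftrightarrow> y \<epsilon> a \<or> y = x"
  by (simp add: adj_def)

lemma mem_suc[simp]: "y \<epsilon> suc x \<longleftrightarrow> y \<epsilon> x \<or> y = x"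
  by (simp add: suc_def)

lemma is_empty_iff[simp]: "is_empty x \<longleftrightarrow> x = emp"
  unfolding is_empty_def using set_ext mem_emp by blast

lemma is_upair_iff[simp]: "is_upair p x y \<longleftrightarrow> p = upr x y"
  unfolding is_upair_def using set_ext mem_upr by auto

lemma is_pair_iff[simp]: "is_pair p x y \<longleftrightarrow> p = pr x y"
  unfolding is_pair_def pr_def by simp

lemma is_succ_iff[simp]: "is_succ s x \<longleftrightarrow> s = suc x"
  unfolding is_succ_def using set_ext mem_suc by auto

lemma upr_eq_iff: "upr x y = upr x' y' \<longleftrightarrow> x = x' \<and> y = y' \<or> x = y' \<and> y = x'"
proof
  assume "upr x y = upr x' y'"
  then have "z = x \<or> z = y \<longleftrightarrow> z = x' \<or> z = y'" for z using mem_upr by metis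
  then show "x = x' \<and> y = y' \<or> x = y' \<and> y = x'" by metis
qed (auto intro: set_ext)

lemma pr_inj[simp]: "pr x y = pr x' y' \<longleftrightarrow> x = x' \<and> y = y'"
  unfolding pr_def by (auto simp: upr_eq_iff)

lemma rel_iff[simp]: "rel r x y \<longleftrightarrow> pr x y \<epsilon> r"
  unfolding rel_def by simp

lemma rel3_iff[simp]: "rel3 C x y z \<longleftrightarrow> pr (pr x y) z \<epsilon> C"
  unfolding rel3_def by simp

lemma fst'_pr[simp]: "fst' (pr x y) = x"
  unfolding fst'_def by (rule The0_eq) auto

lemma snd'_pr[simp]: "snd' (pr x y) = y"
  unfolding snd'_def by (rule The0_eq) auto

lemma subI: "(\<And>z. z \<epsilon> x \<Longrightarrow> z \<epsilon> y) \<Longrightarrow> x \<sqsubseteq> y"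
  unfolding is_subset_def by blast

lemma subD: "x \<sqsubseteq> y \<Longrightarrow> z \<epsilon> x \<Longrightarrow> z \<epsilon> y"
  unfolding is_subset_def by blast

lemma sub_refl[simp]: "x \<sqsubseteq> x"
  unfolding is_subset_def by blast

lemma sub_trans: "x \<sqsubseteq> y \<Longrightarrow> y \<sqsubseteq> z \<Longrightarrow> x \<sqsubseteq> z"
  unfolding is_subset_def by blast

lemma sub_antisym: "x \<sqsubseteq> y \<Longrightarrow> y \<sqsubseteq> x \<Longrightarrow> x = y"
  unfolding is_subset_def by (blast intro: set_ext)

lemma mem_cart: "p \<epsilon> cart a b \<longleftrightarrow> (\<exists>x y. x \<epsilon> a \<and> y \<epsilon> b \<and> p = pr x y)"
  unfolding cart_def
  \<comment> \<open>A Kuratowski pair is a set of subsets of \<open>cup a b\<close>, hence an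
    element of its double power set.\<close>
  by (rule mem_Coll[where a = "Pw (Pw (cup a b))"]) (intro D_intros, auto simp: is_subset_def pr_def)

lemma pr_mem_cart[simp]: "pr x y \<epsilon> cart a b \<longleftrightarrow> x \<epsilon> a \<and> y \<epsilon> b"
  by (auto simp: mem_cart)

lemma mem_dm: "x \<epsilon> dm f \<longleftrightarrow> (\<exists>y. pr x y \<epsilon> f)"
  unfolding dm_def
  \<comment> \<open>The first coordinate is an element of an element of the pair, hence two unions
    below \<open>f\<close>.\<close>
  by (rule mem_Coll[where a = "Uni (Uni f)"]) (intro D_intros, auto simp: pr_def intro: mem_upr[THEN iffD2])

lemma mem_restr: "p \<epsilon> restr f n \<longleftrightarrow> p \<epsilon> f \<and> (\<exists>k v. k \<epsilon> n \<and> p = pr k v)"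
  unfolding restr_def by (rule mem_Sep) (intro D_intros)

lemma pr_mem_restr[simp]: "pr k v \<epsilon> restr f n \<longleftrightarrow> pr k v \<epsilon> f \<and> k \<epsilon> n"
  by (auto simp: mem_restr)

lemma restr_sub: "restr f n \<sqsubseteq> f"
  unfolding is_subset_def by (simp add: mem_restr)

section \<open>Functions inside the model\<close>

abbreviation Fun :: "'a \<Rightarrow> 'a \<Rightarrow> 'a \<Rightarrow> bool" where "Fun \<equiv> is_function"

lemma Fun_iff: "Fun f A B \<longleftrightarrow> f \<sqsubseteq> cart A B \<and> (\<forall>x. x \<epsilon> A \<longrightarrow> (\<exists>!y. pr x y \<epsilon> f))"
  unfolding is_function_def is_relation_def is_subset_def mem_cart
  by (simp add: rel_iff[abs_def])

lemma Fun_app: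
  assumes "Fun f A B" shows "pr x y \<epsilon> f \<longleftrightarrow> x \<epsilon> A \<and> app f x = y"
proof
  assume xy: "pr x y \<epsilon> f"
  then have "x \<epsilon> A" using assms unfolding Fun_iff by (metis pr_mem_cart subD)
  moreover have "app f x = y" unfolding app_def
    by (rule The0_eq) (use xy \<open>x \<epsilon> A\<close> assms Fun_iff in auto)
  ultimately show "x \<epsilon> A \<and> app f x = y" by blast
next
  assume x: "x \<epsilon> A \<and> app f x = y"
  then obtain z where z: "pr x z \<epsilon> f" using assms unfolding Fun_iff by blast
  have "app f x = z" unfolding app_def
    by (rule The0_eq) (use z x assms Fun_iff in auto)
  then show "pr x y \<epsilon> f" using z x by simp
qed

lemma app_mem: "Fun f A B \<Longrightarrow> x \<epsilon> A \<Longrightarrow> app f x \<epsilon> B"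
  using Fun_app[of f A B x "app f x"] unfolding Fun_iff by (metis pr_mem_cart subD)

lemma Fun_pr_D:
  assumes "Fun f A B" "pr x y \<epsilon> f" shows "x \<epsilon> A" "y \<epsilon> B" "app f x = y"
  using assms app_mem[OF assms(1)] by (auto simp: Fun_app[OF assms(1)])

lemma Fun_mem: "Fun f A B \<Longrightarrow> p \<epsilon> f \<longleftrightarrow> (\<exists>x. x \<epsilon> A \<and> p = pr x (app f x))"
proof -
  assume f: "Fun f A B"
  have "\<exists>x y. p = pr x y" if "p \<epsilon> f" using f that unfolding Fun_iff is_subset_def mem_cart by blast
  then show ?thesis by (auto simp: Fun_app[OF f])
qed

lemma dm_Fun: "Fun f A B \<Longrightarrow> dm f = A"
  by (rule set_ext) (auto simp: mem_dm Fun_app)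

lemma Fun_sub_app:
  "Fun f A B \<Longrightarrow> Fun g A' B' \<Longrightarrow> f \<sqsubseteq> g \<longleftrightarrow> (\<forall>x. x \<epsilon> A \<longrightarrow> x \<epsilon> A' \<and> app f x = app g x)"
  unfolding is_subset_def by (auto simp: Fun_mem[of f A B] Fun_app)

lemma Fun_eqI: "Fun f A B \<Longrightarrow> Fun g A B' \<Longrightarrow> (\<And>x. x \<epsilon> A \<Longrightarrow> app f x = app g x) \<Longrightarrow> f = g"
  by (rule set_ext) (auto simp: Fun_mem)

lemma FunI:
  assumes "\<And>p. p \<epsilon> f \<Longrightarrow> \<exists>x y. x \<epsilon> A \<and> y \<epsilon> B \<and> p = pr x y"
    and "\<And>x. x \<epsilon> A \<Longrightarrow> \<exists>y. pr x y \<epsilon> f"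
    and "\<And>x y z. pr x y \<epsilon> f \<Longrightarrow> pr x z \<epsilon> f \<Longrightarrow> y = z"
  shows "Fun f A B"
  unfolding Fun_iff
proof (intro conjI allI impI)
  show "f \<sqsubseteq> cart A B" using assms(1) by (intro subI) (simp add: mem_cart)
  show "\<exists>!y. pr x y \<epsilon> f" if "x \<epsilon> A" for x using assms(2)[OF that] assms(3) by blast
qed

lemma Fun_emp[simp]: "Fun emp emp B"
  by (rule FunI) auto

lemma Fun_adj:
  assumes "Fun f A B" "\<not> x \<epsilon> A" "y \<epsilon> B" shows "Fun (adj f (pr x y)) (adj A x) B"
  by (rule FunI) (use assms in \<open>auto simp: Fun_app Fun_mem dest: app_mem\<close>)

lemma Fun_restr:
  assumes "Fun f A B" "n \<sqsubseteq> A" shows "Fun (restr f n) n B" "\<And>x. x \<epsilon> n \<Longrightarrow> app (restr f n) x = app f x"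
proof -
  show F: "Fun (restr f n) n B"
    by (rule FunI) (use assms in \<open>auto simp: Fun_app Fun_mem mem_restr dest: app_mem subD\<close>)
  show "app (restr f n) x = app f x" if "x \<epsilon> n" for x
    using that Fun_app[OF F, of x "app f x"] Fun_app[OF assms(1), of x "app f x"]
      subD[OF assms(2)] by simp
qed

text \<open>The graph is separated from \<open>cart A B\<close>. This is the internal substitute for
  lambda abstraction.\<close>

lemma lam_ex:
  assumes "FT (\<lambda>v. F (v 0))" "\<And>x. x \<epsilon> A \<Longrightarrow> F x \<epsilon> B"
  obtains f where "Fun f A B" "\<And>x. x \<epsilon> A \<Longrightarrow> app f x = F x"
proof -
  note [D_intros] = FT1[of F, OF assms(1)]
  let ?f = "Sep (cart A B) (\<lambda>p. \<exists>x. p = pr x (F x))"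
  have m: "p \<epsilon> ?f \<longleftrightarrow> p \<epsilon> cart A B \<and> (\<exists>x. p = pr x (F x))" for p
    by (rule mem_Sep) (intro D_intros)
  have F: "Fun ?f A B" by (rule FunI) (use assms in \<open>auto simp: m mem_cart\<close>)
  moreover have "app ?f x = F x" if "x \<epsilon> A" for x
    using Fun_app[OF F, of x "F x"] assms(2) that m by simp
  ultimately show ?thesis using that by blast
qed

section \<open>The natural numbers of the model\<close>

lemma is_inductive_iff: "is_inductive w \<longleftrightarrow> emp \<epsilon> w \<and> (\<forall>x. x \<epsilon> w \<longrightarrow> suc x \<epsilon> w)"
  unfolding is_inductive_def by simp

lemma omega_W: "is_omega W" and is_omega_iff[simp]: "is_omega w \<longleftrightarrow> w = W"
proof -
  obtain w0 where w0: "is_inductive w0" using infinity by blast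
  define u where "u = Sep w0 (\<lambda>x. \<forall>v. is_inductive v \<longrightarrow> x \<epsilon> v)"
  have m: "x \<epsilon> u \<longleftrightarrow> x \<epsilon> w0 \<and> (\<forall>v. is_inductive v \<longrightarrow> x \<epsilon> v)" for x
    unfolding u_def by (rule mem_Sep) (intro D_intros)
  have om: "is_omega u"
    unfolding is_omega_def using w0 by (auto simp: is_inductive_iff m is_subset_def)
  have uniq: "w = u" if "is_omega w" for w
    using that om unfolding is_omega_def by (meson sub_antisym)
  then have "W = u" unfolding W_def using om by (intro The0_eq)
  then show "is_omega W" "is_omega w \<longleftrightarrow> w = W" using om uniq by metis+
qed

lemma is_two_iff[simp]: "is_two t \<longleftrightarrow> t = Two"
  unfolding is_two_def Two_def by simp

lemma is_nat_iff[simp]: "is_nat n \<longleftrightarrow> n \<epsilon> W"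
  unfolding is_nat_def by simp

lemma is_real_iff: "is_real x \<longleftrightarrow> Fun x W Two"
  unfolding is_real_def by simp

lemma is_baire_iff: "is_baire x \<longleftrightarrow> Fun x W W"
  unfolding is_baire_def by simp

lemma zero_W[simp]: "emp \<epsilon> W" and suc_W[simp]: "n \<epsilon> W \<Longrightarrow> suc n \<epsilon> W"
  using omega_W unfolding is_omega_def is_inductive_iff by auto

text \<open>\<open>Sep W P\<close> is an inductive set of the model and \<open>W\<close> is the
  least one. Definability cannot be dropped: in a nonstandard \<open>W\<close>, being standard is
  closed under successor.\<close>

lemma W_induct[consumes 1, case_names dfn zero suc]:
  assumes "n \<epsilon> W" "D (\<lambda>v. P (v 0))" "P emp" "\<And>n. n \<epsilon> W \<Longrightarrow> P n \<Longrightarrow> P (suc n)"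
  shows "P n"
proof -
  have m: "x \<epsilon> Sep W P \<longleftrightarrow> x \<epsilon> W \<and> P x" for x by (rule mem_Sep) fact
  have "is_inductive (Sep W P)" unfolding is_inductive_iff m using assms by simp
  then have "W \<sqsubseteq> Sep W P" using omega_W unfolding is_omega_def by blast
  then show ?thesis using assms(1) m subD by blast
qed

lemma W_cases: "n \<epsilon> W \<Longrightarrow> n = emp \<or> (\<exists>m. m \<epsilon> W \<and> n = suc m)"
proof (induction n rule: W_induct)
  case dfn
  show ?case by (intro D_intros)
qed auto

lemma W_trans: "n \<epsilon> W \<Longrightarrow> \<forall>m k. m \<epsilon> n \<longrightarrow> k \<epsilon> m \<longrightarrow> k \<epsilon> n"
proof (induction n rule: W_induct)
  case dfn
  show ?case by (intro D_intros)
qed auto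

lemma W_memW: "n \<epsilon> W \<Longrightarrow> \<forall>m. m \<epsilon> n \<longrightarrow> m \<epsilon> W"
proof (induction n rule: W_induct)
  case dfn
  show ?case by (intro D_intros)
qed auto

lemma less_W: "m \<epsilon> n \<Longrightarrow> n \<epsilon> W \<Longrightarrow> m \<epsilon> W" using W_memW by blast

lemma less_trans: "k \<epsilon> m \<Longrightarrow> m \<epsilon> n \<Longrightarrow> n \<epsilon> W \<Longrightarrow> k \<epsilon> n" using W_trans by blast

lemma sub_W: "n \<epsilon> W \<Longrightarrow> n \<sqsubseteq> W" by (rule subI) (rule less_W)

lemma less_irrefl: "n \<epsilon> W \<Longrightarrow> \<not> n \<epsilon> n"
proof (induction n rule: W_induct)
  case dfn
  show ?case by (intro D_intros)
next
  case (suc n)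
  then show ?case by (metis less_trans mem_suc)
qed auto

lemma less_suc_iff: "n \<epsilon> W \<Longrightarrow> m \<epsilon> n \<Longrightarrow> suc m \<epsilon> suc n"
proof -
  assume "m \<epsilon> n" "n \<epsilon> W"
  from \<open>n \<epsilon> W\<close> have "\<forall>m. m \<epsilon> n \<longrightarrow> suc m \<epsilon> suc n"
  proof (induction n rule: W_induct)
    case dfn
    show ?case by (intro D_intros)
  qed auto
  then show ?thesis using \<open>m \<epsilon> n\<close> by blast
qed

lemma zero_less_suc: "n \<epsilon> W \<Longrightarrow> emp \<epsilon> suc n"
proof (induction n rule: W_induct)
  case dfn
  show ?case by (intro D_intros)
qed auto

lemma less_linear: "m \<epsilon> W \<Longrightarrow> n \<epsilon> W \<Longrightarrow> m \<epsilon> n \<or> m = n \<or> n \<epsilon> m"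
proof -
  assume m: "m \<epsilon> W" and n: "n \<epsilon> W"
  from m have "\<forall>n. n \<epsilon> W \<longrightarrow> m \<epsilon> n \<or> m = n \<or> n \<epsilon> m"
  proof (induction m rule: W_induct)
    case dfn
    show ?case by (intro D_intros)
  next
    case zero
    then show ?case by (metis W_cases zero_less_suc)
  next
    case (suc m)
    show ?case
    proof (intro allI impI)
      fix n assume n: "n \<epsilon> W"
      then consider "m \<epsilon> n" | "n \<epsilon> suc m" using suc by auto
      then show "suc m \<epsilon> n \<or> suc m = n \<or> n \<epsilon> suc m"
      proof cases
        case 1
        then obtain k where "k \<epsilon> W" "n = suc k" using W_cases[OF n] by auto
        then show ?thesis using less_suc_iff 1 by auto
      qed simp
    qed
  qed
  then show ?thesis using n by blast
qed

lemma W_upper: "m \<epsilon> W \<Longrightarrow> n \<epsilon> W \<Longrightarrow> \<exists>k. k \<epsilon> W \<and> m \<epsilon> k \<and> n \<epsilon> k"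
  using less_linear[of m n] by (metis mem_suc suc_W)

lemma less_sub: "m \<epsilon> n \<Longrightarrow> n \<epsilon> W \<Longrightarrow> m \<sqsubseteq> n"
  by (rule subI) (rule less_trans)

lemma sub_linear: "m \<epsilon> W \<Longrightarrow> n \<epsilon> W \<Longrightarrow> m \<sqsubseteq> n \<or> n \<sqsubseteq> m"
  using less_linear[of m n] less_sub by auto

lemma suc_inj: "n \<epsilon> W \<Longrightarrow> suc m = suc n \<Longrightarrow> m = n"
  by (metis less_irrefl less_trans mem_suc)

lemma less_imp: "m \<epsilon> n \<Longrightarrow> n \<epsilon> W \<Longrightarrow> suc m \<epsilon> n \<or> suc m = n"
  using less_linear[of "suc m" n] by (metis less_W less_irrefl less_trans mem_suc suc_W)

lemma strong_W_induct:
  assumes "n \<epsilon> W" "D (\<lambda>v. P (v 0))" "\<And>n. n \<epsilon> W \<Longrightarrow> (\<And>m. m \<epsilon> n \<Longrightarrow> P m) \<Longrightarrow> P n"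
  shows "P n"
proof -
  note [D_intros] = D1[of P, OF assms(2)]
  have "\<forall>m. m \<epsilon> n \<longrightarrow> P m"
    using assms(1)
  proof (induction n rule: W_induct)
    case dfn
    show ?case by (intro D_intros)
  qed (use assms(3) in auto)
  then show ?thesis using assms(1,3) by blast
qed

lemma W_least:
  assumes "n \<epsilon> W" "P n" "D (\<lambda>v. P (v 0))"
  obtains m where "m \<epsilon> W" "P m" "\<And>k. k \<epsilon> m \<Longrightarrow> \<not> P k"
proof (rule ccontr)
  note [D_intros] = D1[of P, OF assms(3)]
  assume "\<not> thesis"
  then have "\<not> P n" using assms(1) that
    by (intro strong_W_induct[of n "\<lambda>n. \<not> P n"]) (assumption, intro D_intros, blast)
  then show False using assms by blast
qed

lemma mem_Two: "x \<epsilon> Two \<longleftrightarrow> x = emp \<or> x = suc emp"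
  by (auto simp: Two_def)

lemma zero_ne_one: "emp \<noteq> suc emp" by (metis mem_emp mem_suc)

lemma Two_sub_W: "Two \<sqsubseteq> W" by (auto simp: is_subset_def mem_Two)

end

section \<open>Countable sets\<close>

context ZF_DC
begin

section \<open>Sequences from dependent choice\<close>

lemma Fun_adj_app:
  assumes "Fun f A B" "\<not> x \<epsilon> A" "y \<epsilon> B"
  shows "app (adj f (pr x y)) x = y" "z \<epsilon> A \<Longrightarrow> app (adj f (pr x y)) z = app f z"
proof -
  note F = Fun_app[OF Fun_adj[OF assms]]
  show "app (adj f (pr x y)) x = y" using F[of x y] by simp
  show "app (adj f (pr x y)) z = app f z" if "z \<epsilon> A"
    using F[of z "app f z"] Fun_app[OF assms(1), of z "app f z"] that by simp
qed

text \<open>The axiom leaves the first term open and wants a relation that is a set. Both are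
  arranged by applying it to the set of finite runs from \<open>x0\<close>, related by adding one
  term; the union of the chosen runs is the sequence.\<close>

lemma dependent_choice_from:
  assumes "x0 \<epsilon> X" "D (\<lambda>v. R (v 0) (v (Suc 0)))" "\<And>x. x \<epsilon> X \<Longrightarrow> \<exists>y. y \<epsilon> X \<and> R x y"
  obtains f where "Fun f W X" "app f emp = x0" "\<And>n. n \<epsilon> W \<Longrightarrow> R (app f n) (app f (suc n))"
proof -
  note [D_intros] = D2[of R, OF assms(2)]
  \<comment> \<open>A run of index \<open>n\<close> has the domain \<open>suc n\<close>, so even the
    shortest one already records \<open>x0\<close>.\<close>
  define ok where "ok n g \<longleftrightarrow> Fun g (suc n) X \<and> app g emp = x0 \<and>
    (\<forall>k. k \<epsilon> n \<longrightarrow> R (app g k) (app g (suc k)))" for n g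
  have [D_intros]: "D (\<lambda>v. ok (s v) (t v))" if "FT s" "FT t" for s t
    by (rule D2[of ok, OF _ that]) (unfold ok_def, intro D_intros)
  define S where "S = Sep (Pw (cart W X)) (\<lambda>g. \<exists>n. n \<epsilon> W \<and> ok n g)"
  have S: "g \<epsilon> S \<longleftrightarrow> (\<exists>n. n \<epsilon> W \<and> ok n g)" for g
  proof -
    have "g \<sqsubseteq> cart W X" if "n \<epsilon> W" "ok n g" for n
    proof (rule subI)
      fix z assume "z \<epsilon> g"
      then have "z \<epsilon> cart (suc n) X" using that unfolding ok_def Fun_iff by (metis subD)
      then show "z \<epsilon> cart W X" using that less_W[of _ "suc n"] by (auto simp: mem_cart simp del: mem_suc)
    qed
    moreover have "g \<epsilon> S \<longleftrightarrow> g \<epsilon> Pw (cart W X) \<and> (\<exists>n. n \<epsilon> W \<and> ok n g)"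
      unfolding S_def by (rule mem_Sep) (intro D_intros)
    ultimately show ?thesis by auto
  qed
  define T where "T = Sep (cart S S)
    (\<lambda>p. \<exists>g g' n y. p = pr g g' \<and> n \<epsilon> W \<and> ok n g \<and> g' = adj g (pr (suc n) y))"
  have T: "p \<epsilon> T \<longleftrightarrow> p \<epsilon> cart S S \<and>
    (\<exists>g g' n y. p = pr g g' \<and> n \<epsilon> W \<and> ok n g \<and> g' = adj g (pr (suc n) y))" for p
    unfolding T_def by (rule mem_Sep) (intro D_intros)
  have start: "\<exists>g. g \<epsilon> S"
  proof -
    have "Fun (adj emp (pr emp x0)) (suc emp) X"
      unfolding suc_def by (rule Fun_adj) (use assms(1) in auto)
    moreover have "app (adj emp (pr emp x0)) emp = x0"
      by (rule Fun_adj_app[of _ emp X]) (use assms(1) in auto)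
    ultimately have "ok emp (adj emp (pr emp x0))" unfolding ok_def by simp
    then show ?thesis using S zero_W by blast
  qed
  have step: "\<exists>g'. g' \<epsilon> S \<and> pr g g' \<epsilon> T" if g: "g \<epsilon> S" for g
  proof -
    obtain n where n: "n \<epsilon> W" "ok n g" using S g by blast
    then have F: "Fun g (suc n) X" unfolding ok_def by blast
    then have "app g n \<epsilon> X" by (rule app_mem) simp
    then obtain y where y: "y \<epsilon> X" "R (app g n) y" using assms(3) by blast
    have ns: "\<not> suc n \<epsilon> suc n" using less_irrefl[OF suc_W] n by blast
    let ?g = "adj g (pr (suc n) y)"
    have G: "Fun ?g (suc (suc n)) X"
      unfolding suc_def[of "suc n"] by (rule Fun_adj[OF F ns y(1)])
    have "R (app ?g k) (app ?g (suc k))" if "k \<epsilon> suc n" for k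
    proof (cases "k = n")
      case True
      then show ?thesis using Fun_adj_app[OF F ns y(1)] y by simp
    next
      case False
      then have "k \<epsilon> n" using that by simp
      moreover then have "suc k \<epsilon> suc n" using less_suc_iff n by blast
      ultimately show ?thesis using n(2) Fun_adj_app(2)[OF F ns y(1)] unfolding ok_def by auto
    qed
    then have "ok (suc n) ?g" using G Fun_adj_app(2)[OF F ns y(1)] n zero_less_suc unfolding ok_def by auto
    then have gS: "?g \<epsilon> S" using S n suc_W by blast
    then have "pr g ?g \<epsilon> T" unfolding T pr_mem_cart using n g by blast
    then show ?thesis using gS by blast
  qed
  obtain F where F: "Fun F W S" and
    FT: "\<forall>n m x y. n \<epsilon> W \<and> is_succ m n \<and> rel F n x \<and> rel F m y \<longrightarrow> rel T x y"
    using dependent_choice[rule_format, of W S T] start step by auto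
  have FT: "pr (app F n) (app F (suc n)) \<epsilon> T" if "n \<epsilon> W" for n
    using FT that Fun_app[OF F] by simp
  have FS: "app F n \<epsilon> S" if "n \<epsilon> W" for n using app_mem[OF F] that by blast
  have sub1: "app F n \<sqsubseteq> app F (suc n)" if "n \<epsilon> W" for n
    using FT[OF that] unfolding T by (auto simp: is_subset_def)
  have sub: "\<forall>m. m \<epsilon> n \<longrightarrow> app F m \<sqsubseteq> app F n" if "n \<epsilon> W" for n
    using that
  proof (induction n rule: W_induct)
    case dfn
    show ?case by (intro D_intros)
  next
    case (suc n)
    then show ?case using sub1 sub_trans by auto
  qed auto
  have sub': "app F m \<sqsubseteq> app F n \<or> app F n \<sqsubseteq> app F m" if "m \<epsilon> W" "n \<epsilon> W" for m n
    using less_linear[OF that] sub that by auto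
  \<comment> \<open>The chosen sequence of runs may begin with a run of any length, but each step
    adds a term, so its n-th run is defined at least at n.\<close>
  have len: "\<exists>m. m \<epsilon> W \<and> ok m (app F n) \<and> n \<epsilon> suc m" if "n \<epsilon> W" for n
    using that
  proof (induction n rule: W_induct)
    case dfn
    show ?case by (intro D_intros)
  next
    case zero
    then show ?case using FS[of emp] S zero_less_suc by auto
  next
    case (suc n)
    obtain m where m: "m \<epsilon> W" "ok m (app F n)" "n \<epsilon> suc m" using suc by blast
    obtain k y where k: "k \<epsilon> W" "ok k (app F n)" "app F (suc n) = adj (app F n) (pr (suc k) y)"
      using FT[OF suc(1)] unfolding T by auto
    obtain l where l: "l \<epsilon> W" "ok l (app F (suc n))" using FS[of "suc n"] S suc(1) by auto
    have "pr (suc k) y \<epsilon> app F (suc n)" using k by simp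
    then have kl: "suc k \<epsilon> suc l" using l Fun_pr_D(1) unfolding ok_def by blast
    have "suc m = suc k" using m k dm_Fun unfolding ok_def by metis
    then have "n \<epsilon> suc k" using m by simp
    then have "suc n \<epsilon> suc k \<or> suc n = suc k" using less_imp k by auto
    then have "suc n \<epsilon> suc l" using kl less_trans l by (metis suc_W)
    then show ?case using l by blast
  qed
  define U where "U = Sep (cart W X) (\<lambda>p. \<exists>n. n \<epsilon> W \<and> p \<epsilon> app F n)"
  have U: "p \<epsilon> U \<longleftrightarrow> (\<exists>n. n \<epsilon> W \<and> p \<epsilon> app F n)" for p
  proof -
    have "p \<epsilon> U \<longleftrightarrow> p \<epsilon> cart W X \<and> (\<exists>n. n \<epsilon> W \<and> p \<epsilon> app F n)"
      unfolding U_def by (rule mem_Sep) (intro D_intros)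
    moreover have "p \<epsilon> cart W X" if "n \<epsilon> W" "p \<epsilon> app F n" for n
    proof -
      obtain m where m: "m \<epsilon> W" "ok m (app F n)" using len \<open>n \<epsilon> W\<close> by blast
      then have "p \<epsilon> cart (suc m) X" using that unfolding ok_def Fun_iff by (metis subD)
      then show ?thesis using m less_W[of _ "suc m"] by (auto simp: mem_cart simp del: mem_suc)
    qed
    ultimately show ?thesis by blast
  qed
  have appF: "pr k z \<epsilon> app F n \<longleftrightarrow> k \<epsilon> suc m \<and> app (app F n) k = z" if "ok m (app F n)" for k z n m
    using that Fun_app unfolding ok_def by blast
  have Ufun: "Fun U W X"
  proof (rule FunI)
    fix p assume "p \<epsilon> U"
    then show "\<exists>x y. x \<epsilon> W \<and> y \<epsilon> X \<and> p = pr x y"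
    proof -
      have "p \<epsilon> cart W X" using \<open>p \<epsilon> U\<close> unfolding U_def
        by (subst (asm) mem_Sep) (intro D_intros, blast)
      then show ?thesis by (simp add: mem_cart)
    qed
  next
    fix n assume n: "n \<epsilon> W"
    then obtain m where "ok m (app F n)" "n \<epsilon> suc m" using len by blast
    then have "pr n (app (app F n) n) \<epsilon> U" using U appF n by blast
    then show "\<exists>y. pr n y \<epsilon> U" by blast
  next
    fix x y z assume "pr x y \<epsilon> U" "pr x z \<epsilon> U"
    then obtain n m where nm: "n \<epsilon> W" "m \<epsilon> W" "pr x y \<epsilon> app F n" "pr x z \<epsilon> app F m" using U by blast
    then have "(pr x y \<epsilon> app F n \<and> pr x z \<epsilon> app F n) \<or> (pr x y \<epsilon> app F m \<and> pr x z \<epsilon> app F m)"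
      using sub' subD by meson
    then show "y = z" using len[OF nm(1)] len[OF nm(2)] appF by metis
  qed
  have Uapp: "app U k = app (app F n) k" if "n \<epsilon> W" "ok m (app F n)" "k \<epsilon> suc m" for k n m
    using U appF[OF that(2), of k] that(1,3) Fun_pr_D(3)[OF Ufun] by blast
  have "app U emp = x0"
  proof -
    obtain m where m: "m \<epsilon> W" "ok m (app F emp)" "emp \<epsilon> suc m" using len zero_W by blast
    then show ?thesis using Uapp[OF zero_W m(2,3)] unfolding ok_def by simp
  qed
  moreover have "R (app U n) (app U (suc n))" if n: "n \<epsilon> W" for n
  proof -
    obtain m where m: "m \<epsilon> W" "ok m (app F (suc n))" "suc n \<epsilon> suc m" using len[of "suc n"] n by auto
    then have nm: "n \<epsilon> m" by (metis less_trans mem_suc)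
    have "R (app (app F (suc n)) n) (app (app F (suc n)) (suc n))" using m(2) nm unfolding ok_def by blast
    then show ?thesis using Uapp[OF suc_W[OF n] m(2)] m(3) nm by auto
  qed
  ultimately show ?thesis using Ufun that by blast
qed

text \<open>Dependent choice runs on pairs of an index and a valid value. The relation only advances
  the index, so the n-th pair carries a value valid for n.\<close>

lemma countable_choice:
  assumes "D (\<lambda>v. \<phi> (v 0) (v (Suc 0)))" "\<And>n. n \<epsilon> W \<Longrightarrow> \<exists>y. y \<epsilon> B \<and> \<phi> n y"
  obtains f where "Fun f W B" "\<And>n. n \<epsilon> W \<Longrightarrow> \<phi> n (app f n)"
proof -
  note [D_intros] = D2[of \<phi>, OF assms(1)]
  define X where "X = Sep (cart W B) (\<lambda>p. \<phi> (fst' p) (snd' p))"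
  have X: "p \<epsilon> X \<longleftrightarrow> p \<epsilon> cart W B \<and> \<phi> (fst' p) (snd' p)" for p
    unfolding X_def by (rule mem_Sep) (intro D_intros)
  obtain y0 where y0: "y0 \<epsilon> B" "\<phi> emp y0" using assms(2) zero_W by blast
  obtain f where f: "Fun f W X" "app f emp = pr emp y0"
    "\<And>n. n \<epsilon> W \<Longrightarrow> fst' (app f (suc n)) = suc (fst' (app f n))"
  proof (rule dependent_choice_from[of "pr emp y0" X "\<lambda>p q. fst' q = suc (fst' p)"])
    show "pr emp y0 \<epsilon> X" using y0 X by simp
    show "D (\<lambda>v. fst' (v (Suc 0)) = suc (fst' (v 0)))" by (intro D_intros)
    fix p assume "p \<epsilon> X"
    then obtain n where n: "n \<epsilon> W" "fst' p = n" using X by (auto simp: mem_cart)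
    then obtain y where "y \<epsilon> B" "\<phi> (suc n) y" using assms(2) suc_W by blast
    then show "\<exists>q. q \<epsilon> X \<and> fst' q = suc (fst' p)" using n X by (intro exI[of _ "pr (suc n) y"]) auto
  qed blast
  have fst: "fst' (app f n) = n" if "n \<epsilon> W" for n
    using that
  proof (induction n rule: W_induct)
    case dfn
    show ?case by (intro D_intros)
  qed (use f in auto)
  have fX: "snd' (app f n) \<epsilon> B" "\<phi> n (snd' (app f n))" if "n \<epsilon> W" for n
    using app_mem[OF f(1) that] fst[OF that] X by (auto simp: mem_cart)
  have "FT (\<lambda>v. snd' (app f (v 0)))" by (intro D_intros)
  then obtain g where "Fun g W B" "\<And>n. n \<epsilon> W \<Longrightarrow> app g n = snd' (app f n)"
    using lam_ex[of "\<lambda>n. snd' (app f n)" W B] fX(1) by blast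
  then show ?thesis using that fX(2) by auto
qed

section \<open>Countable sets and countable unions\<close>

definition inj_fun :: "'a \<Rightarrow> 'a \<Rightarrow> bool" where
  "inj_fun h A \<longleftrightarrow> (\<forall>x y. x \<epsilon> A \<and> y \<epsilon> A \<and> app h x = app h y \<longrightarrow> x = y)"

lemma D_inj_fun[D_intros]: "FT s \<Longrightarrow> FT t \<Longrightarrow> D (\<lambda>v. inj_fun (s v) (t v))"
  by (rule D2[of inj_fun]) (unfold inj_fun_def, intro D_intros)

lemma is_countable_iff: "is_countable A \<longleftrightarrow> (\<exists>h. Fun h A W \<and> inj_fun h A)"
  unfolding is_countable_def inj_fun_def by (auto simp: Fun_app)

text \<open>The converse of \<open>\<rho>\<close> is a partial surjection from \<open>B\<close>.
  Sending \<open>a\<close> to the least code of a related \<open>b\<close> is injective because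
  \<open>b\<close> determines \<open>a\<close>.\<close>

lemma countable_surj:
  assumes "is_countable B" "D (\<lambda>v. \<rho> (v 0) (v (Suc 0)))"
    and "\<And>a. a \<epsilon> A \<Longrightarrow> \<exists>b. b \<epsilon> B \<and> \<rho> a b"
    and "\<And>a a' b. a \<epsilon> A \<Longrightarrow> a' \<epsilon> A \<Longrightarrow> b \<epsilon> B \<Longrightarrow> \<rho> a b \<Longrightarrow> \<rho> a' b \<Longrightarrow> a = a'"
  shows "is_countable A"
proof -
  note [D_intros] = D2[of \<rho>, OF assms(2)]
  obtain h where h: "Fun h B W" "inj_fun h B" using assms(1) is_countable_iff by blast
  define Q where "Q a n \<longleftrightarrow> (\<exists>b. b \<epsilon> B \<and> \<rho> a b \<and> app h b = n)" for a n
  have DQ[D_intros]: "D (\<lambda>v. Q (s v) (t v))" if "FT s" "FT t" for s t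
    by (rule D2[of Q, OF _ that]) (unfold Q_def, intro D_intros)
  define F where "F a = The0 (\<lambda>n. n \<epsilon> W \<and> Q a n \<and> (\<forall>k. k \<epsilon> n \<longrightarrow> \<not> Q a k))" for a
  have FTF: "FT (\<lambda>v. F (v 0))" unfolding F_def by (intro D_intros)
  have F: "F a \<epsilon> W \<and> Q a (F a)" if a: "a \<epsilon> A" for a
  proof -
    obtain b where "b \<epsilon> B" "\<rho> a b" using assms(3) a by blast
    then have "app h b \<epsilon> W" "Q a (app h b)" using app_mem h Q_def by blast+
    moreover have "D (\<lambda>v. Q a (v 0))" by (intro D_intros)
    ultimately obtain m where m: "m \<epsilon> W" "Q a m" "\<And>k. k \<epsilon> m \<Longrightarrow> \<not> Q a k"
      using W_least[of "app h b" "Q a"] by blast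
    have "F a = m" unfolding F_def
      by (rule The0_eq) (use m less_linear in blast)+
    then show ?thesis using m by simp
  qed
  obtain f where f: "Fun f A W" "\<And>a. a \<epsilon> A \<Longrightarrow> app f a = F a"
    using lam_ex[OF FTF, of A W] F by blast
  have "inj_fun f A" unfolding inj_fun_def
  proof (intro allI impI, elim conjE)
    fix x y assume xy: "x \<epsilon> A" "y \<epsilon> A" "app f x = app f y"
    then have "F x = F y" using f by simp
    then obtain b b' where "b \<epsilon> B" "b' \<epsilon> B" "\<rho> x b" "\<rho> y b'" "app h b = app h b'"
      using F xy unfolding Q_def by metis
    moreover then have "b = b'" using h unfolding inj_fun_def by blast
    ultimately show "x = y" using assms(4) xy by blast
  qed
  then show ?thesis using f is_countable_iff by blast
qed

lemma countable_sub: "is_countable B \<Longrightarrow> A \<sqsubseteq> B \<Longrightarrow> is_countable A"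
  by (rule countable_surj[of B "\<lambda>a b. a = b"]) (assumption, intro D_intros, auto dest: subD)

lemma countable_W: "is_countable W"
proof -
  have "FT (\<lambda>v. v 0)" by (intro D_intros)
  then obtain f where "Fun f W W" "\<And>x. x \<epsilon> W \<Longrightarrow> app f x = x"
    using lam_ex[of "\<lambda>x. x" W W] by blast
  then show ?thesis unfolding is_countable_iff inj_fun_def by metis
qed

lemma suc_less: "suc m \<epsilon> suc n \<Longrightarrow> n \<epsilon> W \<Longrightarrow> m \<epsilon> n"
  by (metis less_trans mem_suc)

lemma emp_ne_suc[simp]: "emp \<noteq> suc n"
  by (metis mem_emp mem_suc)

text \<open>
  The enumeration of pairs runs through the squares \<open>max m n = N\<close> one after the other, from
  \<open>(0, N)\<close> over \<open>(N, N)\<close> to \<open>(N, 0)\<close>; this avoids arithmetic.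
\<close>

lemma countable_WW: "is_countable (cart W W)"
proof -
  define S where "S p q \<longleftrightarrow> (\<exists>m n. p = pr m n \<and> (m \<epsilon> n \<and> q = pr (suc m) n \<or>
    \<not> m \<epsilon> n \<and> (\<exists>j. j \<epsilon> W \<and> n = suc j \<and> q = pr m j) \<or> n = emp \<and> q = pr emp (suc m)))" for p q
  have DS: "D (\<lambda>v. S (v 0) (v (Suc 0)))" unfolding S_def by (intro D_intros)
  obtain f where f: "Fun f W (cart W W)" "app f emp = pr emp emp"
    "\<And>n. n \<epsilon> W \<Longrightarrow> S (app f n) (app f (suc n))"
  proof (rule dependent_choice_from[of "pr emp emp" "cart W W" S])
    fix p assume "p \<epsilon> cart W W"
    then obtain m n where mn: "p = pr m n" "m \<epsilon> W" "n \<epsilon> W" by (auto simp: mem_cart)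
    have "n = emp \<or> (\<exists>k. k \<epsilon> W \<and> n = suc k)" using W_cases mn by blast
    then have "\<exists>q. q \<epsilon> cart W W \<and> (m \<epsilon> n \<and> q = pr (suc m) n \<or>
      \<not> m \<epsilon> n \<and> (\<exists>j. j \<epsilon> W \<and> n = suc j \<and> q = pr m j) \<or> n = emp \<and> q = pr emp (suc m))"
      using mn by (metis pr_mem_cart suc_W zero_W)
    then show "\<exists>q. q \<epsilon> cart W W \<and> S p q" unfolding S_def using mn by blast
  qed (use DS in auto)
  define Rg where "Rg p \<longleftrightarrow> (\<exists>i. i \<epsilon> W \<and> app f i = p)" for p
  have [D_intros]: "D (\<lambda>v. Rg (s v))" if "FT s" for s
    by (rule D1[of Rg, OF _ that]) (unfold Rg_def, intro D_intros)
  \<comment> \<open>The sequence is only known to pass to some \<open>S\<close>-successor, so the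
    successor of \<open>p\<close> must be unique.\<close>
  have Rg_step: "Rg q" if "Rg p" "S p q" "\<And>q'. S p q' \<Longrightarrow> q' = q" for p q
    using that f(3) suc_W unfolding Rg_def by metis
  have Rg_up: "Rg (pr (suc m) n)" if "Rg (pr m n)" "m \<epsilon> n" for m n
    by (rule Rg_step[OF that(1)]) (use that(2) in \<open>auto simp: S_def\<close>)
  have Rg_down: "Rg (pr m n)" if "Rg (pr m (suc n))" "\<not> m \<epsilon> suc n" "n \<epsilon> W" for m n
  proof -
    have "S (pr m (suc n)) q \<longleftrightarrow> q = pr m n" for q
    proof -
      have "S (pr m (suc n)) q \<longleftrightarrow> (\<exists>j. j \<epsilon> W \<and> suc n = suc j \<and> q = pr m j)"
        using that(2) emp_ne_suc[of n, symmetric] by (simp add: S_def del: mem_suc)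
      also have "\<dots> \<longleftrightarrow> q = pr m n" using suc_inj that(3) by blast
      finally show ?thesis .
    qed
    then show ?thesis using Rg_step[OF that(1)] by blast
  qed
  have Rg_next: "Rg (pr emp (suc m))" if "Rg (pr m emp)" for m
  proof -
    have "S (pr m emp) q \<longleftrightarrow> q = pr emp (suc m)" for q by (simp add: S_def)
    then show ?thesis using Rg_step[OF that] by blast
  qed
  have up: "m \<epsilon> suc n \<longrightarrow> Rg (pr m n)" if "n \<epsilon> W" "Rg (pr emp n)" "m \<epsilon> W" for m n
    using that(3)
  proof (induction m rule: W_induct)
    case dfn
    show ?case by (intro D_intros)
  next
    case (suc m)
    then show ?case using Rg_up suc_less that by (metis less_trans mem_suc suc_W)
  qed (use that in auto)
  have down: "\<not> m \<epsilon> k \<and> Rg (pr m k) \<longrightarrow> (\<forall>j. j \<epsilon> suc k \<longrightarrow> Rg (pr m j))"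
    if "k \<epsilon> W" for m k
    using that
  proof (induction k rule: W_induct)
    case dfn
    show ?case by (intro D_intros)
  next
    case (suc k)
    then show ?case using Rg_down by (metis mem_suc)
  qed auto
  have down': "Rg (pr n j)" if "Rg (pr emp n)" "n \<epsilon> W" "j \<epsilon> suc n" for n j
    using up[OF that(2,1,2)] down[OF that(2), of n] less_irrefl that by auto
  have all: "Rg (pr emp n)" if "n \<epsilon> W" for n
    using that
  proof (induction n rule: W_induct)
    case dfn
    show ?case by (intro D_intros)
  next
    case zero
    then show ?case unfolding Rg_def using f(2) zero_W by blast
  next
    case (suc n)
    then show ?case using down'[OF suc(2,1)] zero_less_suc Rg_next by blast
  qed
  have "Rg (pr m n)" if "m \<epsilon> W" "n \<epsilon> W" for m n
    using less_linear[OF that] up[OF that(2) all[OF that(2)] that(1)] down'[OF all[OF that(1)] that(1)]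
    by auto
  then show ?thesis
    by (intro countable_surj[OF countable_W, of "\<lambda>p i. app f i = p"]) (intro D_intros, auto simp: mem_cart Rg_def)
qed

lemma countable_cart:
  assumes "is_countable A" "is_countable B" shows "is_countable (cart A B)"
proof -
  obtain h where h: "Fun h A W" "inj_fun h A" using assms(1) is_countable_iff by blast
  obtain k where k: "Fun k B W" "inj_fun k B" using assms(2) is_countable_iff by blast
  show ?thesis
  proof (rule countable_surj[OF countable_WW, of "\<lambda>p q. q = pr (app h (fst' p)) (app k (snd' p))"])
    show "D (\<lambda>v. v (Suc 0) = pr (app h (fst' (v 0))) (app k (snd' (v 0))))"
      by (intro D_intros)
    show "\<exists>q. q \<epsilon> cart W W \<and> q = pr (app h (fst' p)) (app k (snd' p))" if "p \<epsilon> cart A B" for p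
      using that app_mem[OF h(1)] app_mem[OF k(1)] by (auto simp: mem_cart)
    fix p p' q
    assume "p \<epsilon> cart A B" "p' \<epsilon> cart A B" "q = pr (app h (fst' p)) (app k (snd' p))"
      "q = pr (app h (fst' p')) (app k (snd' p'))"
    then obtain a b a' b' where "a \<epsilon> A" "b \<epsilon> B" "p = pr a b" "a' \<epsilon> A" "b' \<epsilon> B" "p' = pr a' b'"
      "app h a = app h a'" "app k b = app k b'" unfolding mem_cart by force
    then show "p = p'" using h(2) k(2) unfolding inj_fun_def by blast
  qed
qed

text \<open>Countably many countable witnesses are merged into one countable set. It serves both for
  countable unions and for combining the families of dense sets that witness meagerness.\<close>

lemma countable_collect:
  assumes "is_countable X" "D (\<lambda>v. \<phi> (v 0) (v (Suc 0)))"
    and "\<And>x. x \<epsilon> X \<Longrightarrow> \<exists>Y. Y \<sqsubseteq> B \<and> is_countable Y \<and> \<phi> x Y"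
  obtains Z where "Z \<sqsubseteq> B" "is_countable Z" "\<And>x. x \<epsilon> X \<Longrightarrow> \<exists>Y. Y \<sqsubseteq> Z \<and> \<phi> x Y"
proof -
  note [D_intros] = D2[of \<phi>, OF assms(2)]
  obtain h where h: "Fun h X W" "inj_fun h X" using assms(1) is_countable_iff by blast
  \<comment> \<open>Each set is chosen together with an injection into \<open>W\<close>, so one
    application of choice suffices. Indices outside the range of \<open>h\<close> impose nothing,
    and \<open>pr emp emp\<close> serves there.\<close>
  define \<psi> where "\<psi> n p \<longleftrightarrow> (\<forall>x. x \<epsilon> X \<and> app h x = n \<longrightarrow>
    (\<exists>Y g. p = pr Y g \<and> Y \<sqsubseteq> B \<and> Fun g Y W \<and> inj_fun g Y \<and> \<phi> x Y))" for n p
  have D\<psi>: "D (\<lambda>v. \<psi> (v 0) (v (Suc 0)))" unfolding \<psi>_def by (intro D_intros)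
  have ex: "\<exists>p. p \<epsilon> cart (Pw B) (Pw (cart B W)) \<and> \<psi> n p" for n
  proof (cases "\<exists>x. x \<epsilon> X \<and> app h x = n")
    case True
    then obtain x where x: "x \<epsilon> X" "app h x = n" by blast
    obtain Y g where Y: "Y \<sqsubseteq> B" "Fun g Y W" "inj_fun g Y" "\<phi> x Y"
      using assms(3)[OF x(1)] is_countable_iff by blast
    have "\<psi> n (pr Y g)" unfolding \<psi>_def using x Y h(2) unfolding inj_fun_def by metis
    moreover have "g \<sqsubseteq> cart B W" using Y(1,2) unfolding Fun_iff is_subset_def mem_cart by blast
    ultimately show ?thesis using Y by (intro exI[of _ "pr Y g"]) simp
  next
    case False
    then have "\<psi> n (pr emp emp)" unfolding \<psi>_def by blast
    then show ?thesis by (intro exI[of _ "pr emp emp"]) (simp add: is_subset_def)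
  qed
  obtain F where F: "Fun F W (cart (Pw B) (Pw (cart B W)))" "\<And>n. n \<epsilon> W \<Longrightarrow> \<psi> n (app F n)"
    by (rule countable_choice[OF D\<psi> ex]) blast
  have Fx: "fst' (app F (app h x)) \<sqsubseteq> B \<and> inj_fun (snd' (app F (app h x))) (fst' (app F (app h x)))
    \<and> Fun (snd' (app F (app h x))) (fst' (app F (app h x))) W \<and> \<phi> x (fst' (app F (app h x)))"
    if x: "x \<epsilon> X" for x
    using F(2)[OF app_mem[OF h(1) x]] x unfolding \<psi>_def by fastforce
  define Z where "Z = Sep B (\<lambda>b. \<exists>x. x \<epsilon> X \<and> b \<epsilon> fst' (app F (app h x)))"
  have Z: "b \<epsilon> Z \<longleftrightarrow> b \<epsilon> B \<and> (\<exists>x. x \<epsilon> X \<and> b \<epsilon> fst' (app F (app h x)))" for b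
    unfolding Z_def by (rule mem_Sep) (intro D_intros)
  \<comment> \<open>An element is coded by the code of some \<open>x\<close> whose set contains it,
    together with its own code inside that set.\<close>
  define \<rho> where "\<rho> b c \<longleftrightarrow> (\<exists>x. x \<epsilon> X \<and> b \<epsilon> fst' (app F (app h x)) \<and>
      c = pr (app h x) (app (snd' (app F (app h x))) b))" for b c
  have "is_countable Z"
  proof (rule countable_surj[OF countable_WW, of \<rho>])
    show "D (\<lambda>v. \<rho> (v 0) (v (Suc 0)))" unfolding \<rho>_def by (intro D_intros)
  next
    fix b assume "b \<epsilon> Z"
    then obtain x where x: "x \<epsilon> X" "b \<epsilon> fst' (app F (app h x))" using Z by blast
    then have "app (snd' (app F (app h x))) b \<epsilon> W" using Fx app_mem by blast
    then have "pr (app h x) (app (snd' (app F (app h x))) b) \<epsilon> cart W W"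
      using app_mem[OF h(1) x(1)] by simp
    then show "\<exists>c. c \<epsilon> cart W W \<and> \<rho> b c" using x unfolding \<rho>_def by blast
  next
    fix b b' c assume "\<rho> b c" "\<rho> b' c"
    then obtain x x' where xx: "x \<epsilon> X" "x' \<epsilon> X" "b \<epsilon> fst' (app F (app h x))"
      "b' \<epsilon> fst' (app F (app h x'))" "app h x = app h x'"
      "app (snd' (app F (app h x))) b = app (snd' (app F (app h x'))) b'" unfolding \<rho>_def by auto
    then have "x = x'" using h(2) unfolding inj_fun_def by blast
    then show "b = b'" using xx Fx[of x] unfolding inj_fun_def by blast
  qed
  moreover have "Z \<sqsubseteq> B" using Z subI by blast
  moreover have "\<exists>Y. Y \<sqsubseteq> Z \<and> \<phi> x Y" if "x \<epsilon> X" for x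
    using Fx[OF that] that Z unfolding is_subset_def by blast
  ultimately show ?thesis using that by blast
qed

lemma countable_UN:
  assumes "is_countable X" "D (\<lambda>v. \<psi> (v 0) (v (Suc 0)))"
    and "\<And>z. z \<epsilon> Z \<Longrightarrow> \<exists>x. x \<epsilon> X \<and> \<psi> x z"
    and "\<And>x. x \<epsilon> X \<Longrightarrow> \<exists>Y. is_countable Y \<and> (\<forall>z. z \<epsilon> Z \<and> \<psi> x z \<longrightarrow> z \<epsilon> Y)"
  shows "is_countable Z"
proof -
  note [D_intros] = D2[of \<psi>, OF assms(2)]
  have "D (\<lambda>v. \<forall>z. z \<epsilon> Z \<and> \<psi> (v 0) z \<longrightarrow> z \<epsilon> v (Suc 0))" by (intro D_intros)
  then obtain Y where Y: "is_countable Y" "\<And>x. x \<epsilon> X \<Longrightarrow> \<exists>U. U \<sqsubseteq> Y \<and> (\<forall>z. z \<epsilon> Z \<and> \<psi> x z \<longrightarrow> z \<epsilon> U)"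
  proof (rule countable_collect[OF assms(1), of "\<lambda>x U. \<forall>z. z \<epsilon> Z \<and> \<psi> x z \<longrightarrow> z \<epsilon> U" Z])
    fix x assume x: "x \<epsilon> X"
    obtain Y where Y: "is_countable Y" "\<forall>z. z \<epsilon> Z \<and> \<psi> x z \<longrightarrow> z \<epsilon> Y" using assms(4) x by blast
    \<comment> \<open>The covering sets are cut down to \<open>Z\<close>, so that all of them are
      subsets of one set and can be collected.\<close>
    have m: "z \<epsilon> Sep Y (\<lambda>z. z \<epsilon> Z) \<longleftrightarrow> z \<epsilon> Y \<and> z \<epsilon> Z" for z
      by (rule mem_Sep) (intro D_intros)
    show "\<exists>U. U \<sqsubseteq> Z \<and> is_countable U \<and> (\<forall>z. z \<epsilon> Z \<and> \<psi> x z \<longrightarrow> z \<epsilon> U)"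
      using Y m countable_sub[OF Y(1)] by (intro exI[of _ "Sep Y (\<lambda>z. z \<epsilon> Z)"]) (auto simp: is_subset_def)
  qed blast
  show ?thesis using Y assms(3) by (intro countable_sub[OF Y(1)] subI) (meson subD)
qed

lemma countable_upr: "is_countable (upr x x)"
proof (rule countable_surj[OF countable_W, of "\<lambda>a n. n = emp"])
  show "D (\<lambda>v. v (Suc 0) = emp)" by (intro D_intros)
qed (use zero_W in auto)

lemma countable_cup:
  assumes "is_countable A" "is_countable B" shows "is_countable (cup A B)"
proof (rule countable_UN[OF countable_W, of "\<lambda>n z. n = emp \<and> z \<epsilon> A \<or> n \<noteq> emp \<and> z \<epsilon> B"])
  show "D (\<lambda>v. v 0 = emp \<and> v (Suc 0) \<epsilon> A \<or> v 0 \<noteq> emp \<and> v (Suc 0) \<epsilon> B)" by (intro D_intros)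
  show "\<exists>n. n \<epsilon> W \<and> (n = emp \<and> z \<epsilon> A \<or> n \<noteq> emp \<and> z \<epsilon> B)" if "z \<epsilon> cup A B" for z
    using that zero_W suc_W zero_ne_one by (metis mem_cup)
qed (use assms in auto)

end

section \<open>Generic chains, strings and perfect sets\<close>

context ZF_DC
begin

text \<open>Larger means stronger here. Stage n meets the requirement with code n, or waits if there
  is none. A chain is produced instead of a filter, since only limits along it are wanted.\<close>

lemma rasiowa_sikorski:
  assumes "is_countable I" "D (\<lambda>v. le (v 0) (v (Suc 0)))" "D (\<lambda>v. \<delta> (v 0) (v (Suc 0)))"
    and refl: "\<And>p. p \<epsilon> Q \<Longrightarrow> le p p"
    and trans: "\<And>p q r. p \<epsilon> Q \<Longrightarrow> q \<epsilon> Q \<Longrightarrow> r \<epsilon> Q \<Longrightarrow> le p q \<Longrightarrow> le q r \<Longrightarrow> le p r"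
    and "p0 \<epsilon> Q" and dense: "\<And>i p. i \<epsilon> I \<Longrightarrow> p \<epsilon> Q \<Longrightarrow> \<exists>q. q \<epsilon> Q \<and> le p q \<and> \<delta> i q"
  obtains G where "p0 \<epsilon> G" "\<And>p. p \<epsilon> G \<Longrightarrow> p \<epsilon> Q" "\<And>p. p \<epsilon> G \<Longrightarrow> le p0 p"
    "\<And>p q. p \<epsilon> G \<Longrightarrow> q \<epsilon> G \<Longrightarrow> le p q \<or> le q p" "\<And>i. i \<epsilon> I \<Longrightarrow> \<exists>p. p \<epsilon> G \<and> \<delta> i p"
proof -
  note [D_intros] = D2[of le, OF assms(2)] D2[of \<delta>, OF assms(3)]
  obtain h where h: "Fun h I W" "inj_fun h I" using assms(1) is_countable_iff by blast
  define R where "R x y \<longleftrightarrow> fst' y = suc (fst' x) \<and> le (snd' x) (snd' y) \<and>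
    (\<forall>i. i \<epsilon> I \<and> app h i = fst' x \<longrightarrow> \<delta> i (snd' y))" for x y
  have DR: "D (\<lambda>v. R (v 0) (v (Suc 0)))" unfolding R_def by (intro D_intros)
  obtain f where f: "Fun f W (cart W Q)" "app f emp = pr emp p0"
    and fR: "\<And>n. n \<epsilon> W \<Longrightarrow> R (app f n) (app f (suc n))"
  proof (rule dependent_choice_from[of "pr emp p0" "cart W Q" R])
    show "pr emp p0 \<epsilon> cart W Q" using \<open>p0 \<epsilon> Q\<close> by simp
    show "D (\<lambda>v. R (v 0) (v (Suc 0)))" by fact
    fix x assume "x \<epsilon> cart W Q"
    then obtain n p where np: "n \<epsilon> W" "p \<epsilon> Q" "x = pr n p" by (auto simp: mem_cart)
    have "\<exists>q. q \<epsilon> Q \<and> le p q \<and> (\<forall>i. i \<epsilon> I \<and> app h i = n \<longrightarrow> \<delta> i q)"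
    proof (cases "\<exists>i. i \<epsilon> I \<and> app h i = n")
      case True
      then obtain i where i: "i \<epsilon> I" "app h i = n" by blast
      obtain q where q: "q \<epsilon> Q" "le p q" "\<delta> i q" using dense i np by blast
      have "\<forall>j. j \<epsilon> I \<and> app h j = n \<longrightarrow> j = i" using h(2) i unfolding inj_fun_def by blast
      then show ?thesis using q by blast
    next
      case False
      then show ?thesis using refl np by blast
    qed
    then obtain q where "q \<epsilon> Q" "le p q" "\<forall>i. i \<epsilon> I \<and> app h i = n \<longrightarrow> \<delta> i q" by blast
    then show "\<exists>y. y \<epsilon> cart W Q \<and> R x y"
      using np unfolding R_def by (intro exI[of _ "pr (suc n) q"]) simp
  qed blast
  have fst: "fst' (app f n) = n" if "n \<epsilon> W" for n
    using that
  proof (induction n rule: W_induct)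
    case dfn
    show ?case by (intro D_intros)
  next
    case (suc n)
    then show ?case using fR unfolding R_def by simp
  qed (use f in auto)
  have Q: "snd' (app f n) \<epsilon> Q" if "n \<epsilon> W" for n
    using app_mem[OF f(1) that] by (auto simp: mem_cart)
  have mono: "\<forall>m. m \<epsilon> suc n \<longrightarrow> le (snd' (app f m)) (snd' (app f n))" if "n \<epsilon> W" for n
    using that
  proof (induction n rule: W_induct)
    case dfn
    show ?case by (intro D_intros)
  next
    case zero
    then show ?case using f refl[OF Q[OF zero_W]] by auto
  next
    case (suc n)
    have s: "le (snd' (app f n)) (snd' (app f (suc n)))" using fR[OF suc(1)] unfolding R_def by simp
    show ?case
    proof (intro allI impI)
      fix m assume m: "m \<epsilon> suc (suc n)"
      show "le (snd' (app f m)) (snd' (app f (suc n)))"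
      proof (cases "m = suc n")
        case True
        then show ?thesis using refl Q suc by simp
      next
        case False
        then have "m \<epsilon> suc n" using m by (metis mem_suc)
        moreover then have "m \<epsilon> W" using less_W suc_W suc by blast
        ultimately show ?thesis using trans[OF Q Q Q _ s] suc suc_W by blast
      qed
    qed
  qed
  define G where "G = Sep Q (\<lambda>p. \<exists>n. n \<epsilon> W \<and> p = snd' (app f n))"
  have G: "p \<epsilon> G \<longleftrightarrow> (\<exists>n. n \<epsilon> W \<and> p = snd' (app f n))" for p
  proof -
    have "p \<epsilon> G \<longleftrightarrow> p \<epsilon> Q \<and> (\<exists>n. n \<epsilon> W \<and> p = snd' (app f n))"
      unfolding G_def by (rule mem_Sep) (intro D_intros)
    then show ?thesis using Q by blast
  qed
  show ?thesis
  proof (rule that[of G])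
    show "p0 \<epsilon> G" unfolding G by (intro exI[of _ emp]) (simp add: f)
    show "p \<epsilon> Q" if "p \<epsilon> G" for p using that Q unfolding G by auto
    show "le p0 p" if p: "p \<epsilon> G" for p
    proof -
      obtain n where "n \<epsilon> W" "p = snd' (app f n)" using p G by blast
      then show ?thesis using mono[of n] zero_less_suc[of n] f(2) by auto
    qed
    show "le p q \<or> le q p" if "p \<epsilon> G" "q \<epsilon> G" for p q
    proof -
      obtain m where m: "m \<epsilon> W" "p = snd' (app f m)" using \<open>p \<epsilon> G\<close> unfolding G by blast
      obtain n where n: "n \<epsilon> W" "q = snd' (app f n)" using \<open>q \<epsilon> G\<close> unfolding G by blast
      have "m \<epsilon> suc n \<or> n \<epsilon> suc m" using less_linear[OF m(1) n(1)] by auto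
      then show ?thesis unfolding m(2) n(2) using mono[OF m(1)] mono[OF n(1)] by blast
    qed
    show "\<exists>p. p \<epsilon> G \<and> \<delta> i p" if i: "i \<epsilon> I" for i
    proof -
      have n: "app h i \<epsilon> W" using app_mem h i by blast
      then have "\<delta> i (snd' (app f (suc (app h i))))" using fR[OF n] fst[OF n] i unfolding R_def by auto
      then show ?thesis unfolding G using suc_W[OF n] by blast
    qed
  qed
qed

text \<open>Finite strings over \<open>B\<close>. The length of \<open>s\<close> is the number
  \<open>dm s\<close>, so \<open>n \<epsilon> dm s\<close> says that \<open>s\<close> is longer than
  \<open>n\<close>, and \<open>\<sqsubseteq>\<close> is extension.\<close>

definition Str :: "'a \<Rightarrow> 'a" where
  "Str B = Sep (Pw (cart W B)) (\<lambda>s. \<exists>n. n \<epsilon> W \<and> Fun s n B)"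

lemma Fun_sub_cart: "Fun s n B \<Longrightarrow> n \<sqsubseteq> A \<Longrightarrow> s \<sqsubseteq> cart A B"
  unfolding Fun_iff is_subset_def mem_cart by blast

lemma mem_Str: "s \<epsilon> Str B \<longleftrightarrow> (\<exists>n. n \<epsilon> W \<and> Fun s n B)"
proof -
  have "s \<epsilon> Str B \<longleftrightarrow> s \<epsilon> Pw (cart W B) \<and> (\<exists>n. n \<epsilon> W \<and> Fun s n B)"
    unfolding Str_def by (rule mem_Sep) (intro D_intros)
  then show ?thesis using Fun_sub_cart sub_W by auto
qed

lemma Str_dm: "s \<epsilon> Str B \<Longrightarrow> dm s \<epsilon> W" "s \<epsilon> Str B \<Longrightarrow> Fun s (dm s) B"
  unfolding mem_Str using dm_Fun by auto

lemma dm_emp[simp]: "dm emp = emp"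
  by (rule set_ext) (simp add: mem_dm)

lemma emp_Str[simp]: "emp \<epsilon> Str B"
  unfolding mem_Str using zero_W Fun_emp by blast

lemma sub_dm: "s \<sqsubseteq> t \<Longrightarrow> dm s \<sqsubseteq> dm t"
  by (auto simp: is_subset_def mem_dm)

lemma emp_sub[simp]: "emp \<sqsubseteq> x"
  by (auto simp: is_subset_def)

lemma agree_iff: "agree n x y \<longleftrightarrow> restr x n = restr y n"
proof
  assume "agree n x y"
  then show "restr x n = restr y n" by (intro set_ext) (auto simp: mem_restr agree_def)
next
  assume "restr x n = restr y n"
  then have "pr k v \<epsilon> restr x n \<longleftrightarrow> pr k v \<epsilon> restr y n" for k v by simp
  then show "agree n x y" by (auto simp: agree_def)
qed

lemma agree_refl[simp]: "agree n x x" by (simp add: agree_iff)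
lemma agree_sym: "agree n x y \<Longrightarrow> agree n y x" by (simp add: agree_iff)
lemma agree_trans: "agree n x y \<Longrightarrow> agree n y z \<Longrightarrow> agree n x z" by (simp add: agree_iff)
lemma agree_mono: "agree n x y \<Longrightarrow> m \<sqsubseteq> n \<Longrightarrow> agree m x y"
  by (auto simp: agree_def is_subset_def)

lemma sub_agree: "s \<epsilon> Str B \<Longrightarrow> dm s \<sqsubseteq> n \<Longrightarrow> agree n x y \<Longrightarrow> s \<sqsubseteq> x \<Longrightarrow> s \<sqsubseteq> y"
  by (auto simp: agree_def is_subset_def Fun_mem[OF Str_dm(2)])

lemma agree_sub:
  assumes "Fun x W B" "Fun y W B'" "s \<sqsubseteq> x" "s \<sqsubseteq> y" "n \<sqsubseteq> dm s"
  shows "agree n x y"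
  unfolding agree_def rel_iff
proof (intro allI impI)
  fix k v assume "k \<epsilon> n"
  then obtain u where "pr k u \<epsilon> s" using assms(5) unfolding is_subset_def mem_dm by blast
  then have "pr k u \<epsilon> x" "pr k u \<epsilon> y" using assms subD by blast+
  then show "pr k v \<epsilon> x \<longleftrightarrow> pr k v \<epsilon> y" using Fun_app[OF assms(1)] Fun_app[OF assms(2)] by auto
qed

lemma not_agree:
  assumes "Fun x W B" "Fun y W B" "x \<noteq> y"
  obtains n where "n \<epsilon> W" "\<not> agree n x y"
proof -
  obtain k where k: "k \<epsilon> W" "app x k \<noteq> app y k" using assms Fun_eqI by blast
  have "\<not> agree (suc k) x y"
    unfolding agree_def rel_iff Fun_app[OF assms(1)] Fun_app[OF assms(2)] using k by auto
  then show ?thesis using that k suc_W by blast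
qed

lemma restr_Str:
  assumes "Fun x W B" "n \<epsilon> W"
  shows "restr x n \<epsilon> Str B" "dm (restr x n) = n" "Fun (restr x n) n B"
  using Fun_restr(1)[OF assms(1) sub_W[OF assms(2)]] assms(2) dm_Fun mem_Str by blast+

lemma Str_sub_restr: "s \<epsilon> Str B \<Longrightarrow> s \<sqsubseteq> x \<Longrightarrow> dm s \<sqsubseteq> n \<Longrightarrow> s \<sqsubseteq> restr x n"
  by (auto simp: is_subset_def Fun_mem[OF Str_dm(2)])

lemma restr_mono: "m \<sqsubseteq> n \<Longrightarrow> restr x m \<sqsubseteq> restr x n"
  by (auto simp: is_subset_def mem_restr)

lemma Str_restr_eq:
  assumes "s \<epsilon> Str B" "Fun x A B'" "s \<sqsubseteq> x" shows "restr x (dm s) = s"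
proof (rule sub_antisym)
  show "s \<sqsubseteq> restr x (dm s)" using assms Str_sub_restr by simp
  show "restr x (dm s) \<sqsubseteq> s"
  proof (rule subI)
    fix p assume "p \<epsilon> restr x (dm s)"
    then obtain k v u where "p = pr k v" "pr k v \<epsilon> x" "pr k u \<epsilon> s" by (auto simp: mem_restr mem_dm)
    then show "p \<epsilon> s" using assms subD[OF assms(3)] Fun_app[OF assms(2)] by metis
  qed
qed

lemma Str_comparable:
  assumes "s \<epsilon> Str B" "t \<epsilon> Str B" "Fun x A B'" "s \<sqsubseteq> x" "t \<sqsubseteq> x"
  shows "s \<sqsubseteq> t \<or> t \<sqsubseteq> s"
  using sub_linear[OF Str_dm(1)[OF assms(1)] Str_dm(1)[OF assms(2)]]
    restr_mono[of _ _ x] Str_restr_eq[of _ B, OF _ assms(3)] assms by metis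

lemma sub_Uni: "s \<epsilon> G \<Longrightarrow> s \<sqsubseteq> Uni G"
  by (auto simp: is_subset_def)

text \<open>This turns a generic chain into a point of \<open>2\<^sup>\<omega>\<close> or
  \<open>\<omega>\<^sup>\<omega>\<close>: comparability makes the union single-valued, unbounded
  length makes it total.\<close>

lemma chain_Fun:
  assumes "\<And>s. s \<epsilon> G \<Longrightarrow> s \<epsilon> Str B" "\<And>s t. s \<epsilon> G \<Longrightarrow> t \<epsilon> G \<Longrightarrow> s \<sqsubseteq> t \<or> t \<sqsubseteq> s"
    and "\<And>n. n \<epsilon> W \<Longrightarrow> \<exists>s. s \<epsilon> G \<and> n \<epsilon> dm s"
  shows "Fun (Uni G) W B"
proof (rule FunI)
  fix p assume "p \<epsilon> Uni G"
  then obtain s where s: "s \<epsilon> Str B" "p \<epsilon> s" using assms(1) by auto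
  then have "s \<sqsubseteq> cart W B" using Fun_sub_cart sub_W mem_Str by blast
  then show "\<exists>x y. x \<epsilon> W \<and> y \<epsilon> B \<and> p = pr x y" using s subD mem_cart by blast
next
  fix n assume "n \<epsilon> W"
  then show "\<exists>y. pr n y \<epsilon> Uni G" using assms(3)[of n] by (auto simp: mem_dm)
next
  fix x y z assume "pr x y \<epsilon> Uni G" "pr x z \<epsilon> Uni G"
  then obtain s t where st: "s \<epsilon> G" "t \<epsilon> G" "pr x y \<epsilon> s" "pr x z \<epsilon> t" by auto
  then have "(pr x y \<epsilon> s \<and> pr x z \<epsilon> s) \<or> (pr x y \<epsilon> t \<and> pr x z \<epsilon> t)" using assms(2) subD by meson
  then show "y = z" using st(1,2) assms(1) Fun_app[OF Str_dm(2)] by metis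
qed

lemma Str_extend:
  assumes "s \<epsilon> Str B" "b \<epsilon> B"
  shows "adj s (pr (dm s) b) \<epsilon> Str B" "dm (adj s (pr (dm s) b)) = suc (dm s)"
    "s \<sqsubseteq> adj s (pr (dm s) b)"
proof -
  have "Fun (adj s (pr (dm s) b)) (suc (dm s)) B" unfolding suc_def
    by (rule Fun_adj) (use assms Str_dm less_irrefl in auto)
  then show "adj s (pr (dm s) b) \<epsilon> Str B" "dm (adj s (pr (dm s) b)) = suc (dm s)"
    using mem_Str dm_Fun Str_dm assms suc_W by blast+
qed (auto simp: is_subset_def)

lemma Str_suc_cases:
  assumes "Fun s (suc n) B" "n \<epsilon> W"
  shows "Fun (restr s n) n B" "s = adj (restr s n) (pr n (app s n))" "app s n \<epsilon> B"
proof -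
  have n: "n \<sqsubseteq> suc n" by (rule subI) simp
  show F: "Fun (restr s n) n B" by (rule Fun_restr(1)[OF assms(1) n])
  show a: "app s n \<epsilon> B" by (rule app_mem[OF assms(1)]) simp
  have G: "Fun (adj (restr s n) (pr n (app s n))) (suc n) B"
    unfolding suc_def by (rule Fun_adj[OF F _ a]) (rule less_irrefl[OF assms(2)])
  show "s = adj (restr s n) (pr n (app s n))"
    by (rule Fun_eqI[OF assms(1) G])
      (use Fun_adj_app[OF F less_irrefl[OF assms(2)] a] Fun_restr(2)[OF assms(1) n] in auto)
qed

lemma countable_Str:
  assumes "is_countable B" shows "is_countable (Str B)"
proof -
  have m: "s \<epsilon> Sep (Str B) (\<lambda>s. Fun s n B) \<longleftrightarrow> s \<epsilon> Str B \<and> Fun s n B" for s n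
    by (rule mem_Sep) (intro D_intros)
  have c: "is_countable (Sep (Str B) (\<lambda>s. Fun s n B))" if "n \<epsilon> W" for n
    using that
  proof (induction n rule: W_induct)
    case dfn
    show ?case by (intro D_intros)
  next
    case zero
    show ?case
    proof (rule countable_surj[OF countable_W, of "\<lambda>s n. n = emp"])
      show "D (\<lambda>v. v (Suc 0) = emp)" by (intro D_intros)
      have e: "s = emp" if "s \<epsilon> Sep (Str B) (\<lambda>s. Fun s emp B)" for s
        using that m Fun_eqI[of s emp B emp B] by simp
      show "a = a'" if "a \<epsilon> Sep (Str B) (\<lambda>s. Fun s emp B)" "a' \<epsilon> Sep (Str B) (\<lambda>s. Fun s emp B)"
        for a a' using that e by blast
    qed (use zero_W in auto)
  next
    case (suc n)
    show ?case
    proof (rule countable_surj[OF countable_cart[OF suc(2) assms],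
          of "\<lambda>s p. s = adj (fst' p) (pr n (snd' p))"])
      show "D (\<lambda>v. v 0 = adj (fst' (v (Suc 0))) (pr n (snd' (v (Suc 0)))))" by (intro D_intros)
      fix s assume "s \<epsilon> Sep (Str B) (\<lambda>s. Fun s (suc n) B)"
      then have s: "Fun s (suc n) B" using m by blast
      note st = Str_suc_cases[OF s suc(1)]
      have "restr s n \<epsilon> Str B" using st(1) suc(1) mem_Str by blast
      then show "\<exists>p. p \<epsilon> cart (Sep (Str B) (\<lambda>s. Fun s n B)) B \<and> s = adj (fst' p) (pr n (snd' p))"
        using st m by (intro exI[of _ "pr (restr s n) (app s n)"]) auto
    qed auto
  qed
  show ?thesis
  proof (rule countable_UN[OF countable_W, of "\<lambda>n s. Fun s n B"])
    show "D (\<lambda>v. Fun (v (Suc 0)) (v 0) B)" by (intro D_intros)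
    show "\<exists>n. n \<epsilon> W \<and> Fun s n B" if "s \<epsilon> Str B" for s using that mem_Str by blast
    show "\<exists>Y. is_countable Y \<and> (\<forall>s. s \<epsilon> Str B \<and> Fun s n B \<longrightarrow> s \<epsilon> Y)" if "n \<epsilon> W" for n
      using c[OF that] m by blast
  qed
qed

lemma countable_Str2: "is_countable (Str Two)"
  by (rule countable_Str[OF countable_sub[OF countable_W Two_sub_W]])

lemma countable_StrW: "is_countable (Str W)"
  by (rule countable_Str[OF countable_W])

section \<open>Perfect sets\<close>

lemma perfect_closed:
  assumes "is_perfect P" "Fun y W Two" "\<And>n. n \<epsilon> W \<Longrightarrow> \<exists>x. x \<epsilon> P \<and> agree n y x"
  shows "y \<epsilon> P"
proof (rule ccontr)
  assume "\<not> y \<epsilon> P"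
  then have "limit_point y P" unfolding limit_point_def is_nat_iff using assms(3) by metis
  then show False using assms \<open>\<not> y \<epsilon> P\<close> unfolding is_perfect_def is_real_iff by blast
qed

text \<open>A generic branch through the tree of initial segments of members of \<open>P\<close>
  leaves every member of a countable \<open>P\<close>, yet its limit lies in \<open>P\<close>
  because \<open>P\<close> is closed.\<close>

lemma perfect_uncountable:
  assumes P: "is_perfect P" and ne: "e0 \<epsilon> P" shows "\<not> is_countable P"
proof
  assume cnt: "is_countable P"
  have real: "Fun x W Two" if "x \<epsilon> P" for x
    using P that unfolding is_perfect_def set_of_reals_def is_real_iff by blast
  define Q where "Q = Sep (Str Two) (\<lambda>s. \<exists>x. x \<epsilon> P \<and> s \<sqsubseteq> x)"
  have Q: "s \<epsilon> Q \<longleftrightarrow> s \<epsilon> Str Two \<and> (\<exists>x. x \<epsilon> P \<and> s \<sqsubseteq> x)" for s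
    unfolding Q_def by (rule mem_Sep) (intro D_intros)
  \<comment> \<open>The requirement for a pair of \<open>e\<close> and \<open>n\<close> asks for a
    string off \<open>e\<close> that is longer than \<open>n\<close>; the length makes the limit
    total.\<close>
  obtain G where G: "\<And>s. s \<epsilon> G \<Longrightarrow> s \<epsilon> Q" "\<And>s t. s \<epsilon> G \<Longrightarrow> t \<epsilon> G \<Longrightarrow> s \<sqsubseteq> t \<or> t \<sqsubseteq> s"
    "\<And>i. i \<epsilon> cart P W \<Longrightarrow> \<exists>t. t \<epsilon> G \<and> \<not> t \<sqsubseteq> fst' i \<and> snd' i \<epsilon> dm t"
  proof (rule rasiowa_sikorski[OF countable_cart[OF cnt countable_W], of is_subset "\<lambda>i t. \<not> t \<sqsubseteq> fst' i \<and> snd' i \<epsilon> dm t" Q emp])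
    show "D (\<lambda>v. v 0 \<sqsubseteq> v (Suc 0))" by (intro D_intros)
    show "D (\<lambda>v. \<not> v (Suc 0) \<sqsubseteq> fst' (v 0) \<and> snd' (v 0) \<epsilon> dm (v (Suc 0)))" by (intro D_intros)
    show "emp \<epsilon> Q" using Q ne by auto
    fix i s assume i: "i \<epsilon> cart P W" and s: "s \<epsilon> Q"
    then obtain e n where en: "i = pr e n" "e \<epsilon> P" "n \<epsilon> W" by (auto simp: mem_cart)
    obtain x where x: "x \<epsilon> P" "s \<sqsubseteq> x" and s2: "s \<epsilon> Str Two" using s Q by blast
    \<comment> \<open>If the member of \<open>P\<close> above \<open>s\<close> happens to be
      \<open>e\<close> itself, it is replaced by another one close to it, as \<open>e\<close> is not
      isolated.\<close>
    obtain y where y: "y \<epsilon> P" "s \<sqsubseteq> y" "y \<noteq> e"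
    proof (cases "x = e")
      case True
      have "limit_point e P" using P en real unfolding is_perfect_def is_real_iff by blast
      then obtain y where "y \<epsilon> P" "y \<noteq> e" "agree (dm s) e y"
        unfolding limit_point_def is_nat_iff using Str_dm(1)[OF s2] by blast
      then show ?thesis using that sub_agree[OF s2 sub_refl] x True by blast
    next
      case False
      then show ?thesis using that x by blast
    qed
    obtain k where k: "k \<epsilon> W" "\<not> agree k y e" using not_agree real y en by blast
    obtain m0 where m0: "m0 \<epsilon> W" "k \<epsilon> m0" "n \<epsilon> m0" using W_upper k en by blast
    obtain m where m: "m \<epsilon> W" "m0 \<epsilon> m" "dm s \<epsilon> m" using W_upper m0 Str_dm(1)[OF s2] by blast
    note r = restr_Str[OF real[OF y(1)] m(1)]
    have "\<not> restr y m \<sqsubseteq> e"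
    proof
      assume "restr y m \<sqsubseteq> e"
      moreover have "k \<sqsubseteq> dm (restr y m)" using r m m0 less_sub less_trans by metis
      ultimately have "agree k y e" using agree_sub[OF real real restr_sub] y en by blast
      then show False using k by blast
    qed
    moreover have "s \<sqsubseteq> restr y m" using Str_sub_restr[OF s2 y(2)] less_sub m by blast
    moreover have "restr y m \<epsilon> Q" using Q r y restr_sub by blast
    moreover have "n \<epsilon> dm (restr y m)" using r m m0 less_trans by metis
    ultimately show "\<exists>t. t \<epsilon> Q \<and> s \<sqsubseteq> t \<and> \<not> t \<sqsubseteq> fst' i \<and> snd' i \<epsilon> dm t" using en by auto
  qed (auto intro: sub_trans)
  have F: "Fun (Uni G) W Two"
  proof (rule chain_Fun)
    show "\<exists>s. s \<epsilon> G \<and> n \<epsilon> dm s" if "n \<epsilon> W" for n using G(3)[of "pr e0 n"] that ne by auto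
  qed (use G Q in auto)
  have "Uni G \<epsilon> P"
  proof (rule perfect_closed[OF P F])
    fix n assume n: "n \<epsilon> W"
    then obtain s where s: "s \<epsilon> G" "n \<epsilon> dm s" using G(3)[of "pr e0 n"] ne by auto
    then obtain x where x: "x \<epsilon> P" "s \<sqsubseteq> x" "s \<epsilon> Str Two" using G Q by blast
    have "agree n (Uni G) x"
      using agree_sub[OF F real[OF x(1)] sub_Uni[OF s(1)] x(2)] less_sub[OF s(2)] Str_dm(1)[OF x(3)] by blast
    then show "\<exists>x. x \<epsilon> P \<and> agree n (Uni G) x" using x by blast
  qed
  then obtain t where "t \<epsilon> G" "\<not> t \<sqsubseteq> Uni G" using G(3)[of "pr (Uni G) emp"] by auto
  then show False using sub_Uni by blast
qed

end

section \<open>A relation with countable sections is meager\<close>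

context set_structure
begin

definition snoc :: "'a \<Rightarrow> 'a \<Rightarrow> 'a" where "snoc u k = adj u (pr (dm u) k)"

lemma FT_snoc[D_intros]: "FT s \<Longrightarrow> FT t \<Longrightarrow> FT (\<lambda>v. snoc (s v) (t v))"
  by (rule FT2[of snoc]) (unfold snoc_def, intro D_intros)

end

context ZF_DC
begin

lemma closed3_D:
  assumes "closed3 C" "pr (pr x y) z \<epsilon> C"
  shows "Fun x W Two" "Fun y W Two" "Fun z W W"
  using assms unfolding closed3_def is_real_iff is_baire_iff is_pair_iff by (metis pr_inj)+

lemma closed3_closed:
  assumes "closed3 C" "Fun x W Two" "Fun y W Two" "Fun z W W"
    and "\<And>n. n \<epsilon> W \<Longrightarrow> \<exists>x' y' z'. pr (pr x' y') z' \<epsilon> C \<and> agree n x x' \<and> agree n y y' \<and> agree n z z'"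
  shows "pr (pr x y) z \<epsilon> C"
  using assms(1) unfolding closed3_def is_real_iff is_baire_iff is_nat_iff rel3_iff
  using assms(2-) by blast

lemma snoc_Str:
  assumes "s \<epsilon> Str B" "b \<epsilon> B"
  shows "snoc s b \<epsilon> Str B" "dm (snoc s b) = suc (dm s)" "s \<sqsubseteq> snoc s b"
  unfolding snoc_def using Str_extend[OF assms] by auto

lemma Str_lengthen:
  assumes "s \<epsilon> Str B" "b \<epsilon> B" "n \<epsilon> W"
  shows "\<exists>t. t \<epsilon> Str B \<and> s \<sqsubseteq> t \<and> n \<epsilon> dm t"
  using assms(3)
proof (induction n rule: W_induct)
  case dfn
  show ?case by (intro D_intros)
next
  case zero
  then show ?case using snoc_Str[OF assms(1,2)] zero_less_suc Str_dm(1)[OF assms(1)] by metis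
next
  case (suc n)
  then obtain t where t: "t \<epsilon> Str B" "s \<sqsubseteq> t" "n \<epsilon> dm t" by blast
  have "suc n \<epsilon> suc (dm t)" using less_suc_iff Str_dm t by blast
  then show ?case using snoc_Str[OF t(1) assms(2)] sub_trans t by metis
qed

lemma snoc_sub:
  assumes "u \<epsilon> Str B" "Fun z W B" "u \<sqsubseteq> z" shows "snoc u (app z (dm u)) \<sqsubseteq> z"
  using assms Str_dm(1)[OF assms(1)] by (auto simp: snoc_def is_subset_def Fun_app)

lemma countable_emp: "is_countable emp"
  by (rule countable_sub[OF countable_W]) simp

text \<open>
  For \<open>C \<subseteq> (2\<^sup>\<omega> \<times> 2\<^sup>\<omega>) \<times> \<omega>\<^sup>\<omega>\<close>, \<open>small C u s t\<close> says that the set of all \<open>(x, y)\<close> in the box of \<open>(s, t)\<close>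
  with a witness \<open>z \<supseteq> u\<close> is meager; open dense sets are given by dense sets of boxes.
\<close>

definition densep :: "'a \<Rightarrow> bool" where
  "densep d \<longleftrightarrow> (\<forall>s t. s \<epsilon> Str Two \<and> t \<epsilon> Str Two \<longrightarrow>
     (\<exists>s' t'. s' \<epsilon> Str Two \<and> t' \<epsilon> Str Two \<and> s \<sqsubseteq> s' \<and> t \<sqsubseteq> t' \<and> pr s' t' \<epsilon> d))"

definition avoids :: "'a \<Rightarrow> 'a \<Rightarrow> 'a \<Rightarrow> bool" where
  "avoids d x y \<longleftrightarrow> (\<forall>s t. pr s t \<epsilon> d \<longrightarrow> \<not> (s \<sqsubseteq> x \<and> t \<sqsubseteq> y))"

definition covers :: "'a \<Rightarrow> 'a \<Rightarrow> 'a \<Rightarrow> 'a \<Rightarrow> 'a \<Rightarrow> bool" where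
  "covers C F u s t \<longleftrightarrow> (\<forall>x y z. pr (pr x y) z \<epsilon> C \<and> s \<sqsubseteq> x \<and> t \<sqsubseteq> y \<and> u \<sqsubseteq> z \<longrightarrow>
     (\<exists>d. d \<epsilon> F \<and> densep d \<and> avoids d x y))"

definition small :: "'a \<Rightarrow> 'a \<Rightarrow> 'a \<Rightarrow> 'a \<Rightarrow> bool" where
  "small C u s t \<longleftrightarrow>
     (\<exists>F. is_countable F \<and> F \<sqsubseteq> Pw (cart (Str Two) (Str Two)) \<and> covers C F u s t)"

text \<open>Nonmeager in every sub-box. Unlike the mere failure of \<open>small\<close>, this passes
  to sub-boxes.\<close>

definition good :: "'a \<Rightarrow> 'a \<Rightarrow> 'a \<Rightarrow> 'a \<Rightarrow> bool" where
  "good C u s t \<longleftrightarrow> (\<forall>s' t'. s' \<epsilon> Str Two \<and> t' \<epsilon> Str Two \<and> s \<sqsubseteq> s' \<and> t \<sqsubseteq> t' \<longrightarrow> \<not> small C u s' t')"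

lemma D_densep[D_intros]: "FT s \<Longrightarrow> D (\<lambda>v. densep (s v))"
  by (rule D1[of densep]) (unfold densep_def, intro D_intros)

lemma D_avoids[D_intros]: "FT s \<Longrightarrow> FT t \<Longrightarrow> FT u \<Longrightarrow> D (\<lambda>v. avoids (s v) (t v) (u v))"
  by (rule D3[of avoids]) (unfold avoids_def, intro D_intros)

lemma D_small[D_intros]: "FT s \<Longrightarrow> FT t \<Longrightarrow> FT u \<Longrightarrow> D (\<lambda>v. small C (s v) (t v) (u v))"
  by (rule D3[of "small C"]) (unfold small_def covers_def, intro D_intros)

lemma D_good[D_intros]: "FT s \<Longrightarrow> FT t \<Longrightarrow> FT u \<Longrightarrow> D (\<lambda>v. good C (s v) (t v) (u v))"
  by (rule D3[of "good C"]) (unfold good_def, intro D_intros)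

lemma good_ext:
  "good C u s t \<Longrightarrow> s \<sqsubseteq> s' \<Longrightarrow> t \<sqsubseteq> t' \<Longrightarrow> good C u s' t'"
  unfolding good_def using sub_trans by blast

lemma good_not_small: "good C u s t \<Longrightarrow> s \<epsilon> Str Two \<Longrightarrow> t \<epsilon> Str Two \<Longrightarrow> \<not> small C u s t"
  unfolding good_def by simp

text \<open>Otherwise, for every digit \<open>k\<close>, the boxes that are small for
  \<open>snoc u k\<close> are dense below \<open>(s, t)\<close>. So, off a meager set, every point
  with a witness lies in one of countably many small pieces, and \<open>(u, s, t)\<close> itself is
  small.\<close>

lemma exists_good:
  assumes C: "closed3 C" and u: "u \<epsilon> Str W" and s: "s \<epsilon> Str Two" and t: "t \<epsilon> Str Two"
    and ns: "\<not> small C u s t"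
  shows "\<exists>k s' t'. k \<epsilon> W \<and> s' \<epsilon> Str Two \<and> t' \<epsilon> Str Two \<and> s \<sqsubseteq> s' \<and> t \<sqsubseteq> t' \<and> good C (snoc u k) s' t'"
proof (rule ccontr)
  assume neg: "\<not> ?thesis"
  let ?P = "cart (Str Two) (Str Two)"
  have cP: "is_countable ?P" by (rule countable_cart[OF countable_Str2 countable_Str2])
  define X where "X = Sep (cart W ?P) (\<lambda>i. small C (snoc u (fst' i)) (fst' (snd' i)) (snd' (snd' i)))"
  have X: "i \<epsilon> X \<longleftrightarrow> i \<epsilon> cart W ?P \<and> small C (snoc u (fst' i)) (fst' (snd' i)) (snd' (snd' i))" for i
    unfolding X_def by (rule mem_Sep) (intro D_intros)
  have cX: "is_countable X"
    by (rule countable_sub[OF countable_cart[OF countable_W cP]]) (auto simp: is_subset_def X)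
  obtain Z where Z: "Z \<sqsubseteq> Pw ?P" "is_countable Z"
    "\<And>i. i \<epsilon> X \<Longrightarrow> \<exists>Y. Y \<sqsubseteq> Z \<and> covers C Y (snoc u (fst' i)) (fst' (snd' i)) (snd' (snd' i))"
  proof (rule countable_collect[OF cX, of "\<lambda>i Y. covers C Y (snoc u (fst' i)) (fst' (snd' i)) (snd' (snd' i))"
        "Pw ?P"])
    show "D (\<lambda>v. covers C (v (Suc 0)) (snoc u (fst' (v 0))) (fst' (snd' (v 0))) (snd' (snd' (v 0))))"
      unfolding covers_def by (intro D_intros)
    show "\<exists>Y. Y \<sqsubseteq> Pw ?P \<and> is_countable Y \<and> covers C Y (snoc u (fst' i)) (fst' (snd' i)) (snd' (snd' i))"
      if "i \<epsilon> X" for i using that unfolding X small_def by blast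
  qed blast
  \<comment> \<open>Boxes incompatible with \<open>(s, t)\<close> are included to make
    \<open>DD k\<close> dense everywhere and not only below \<open>(s, t)\<close>.\<close>
  define R where "R k p \<longleftrightarrow> small C (snoc u k) (fst' p) (snd' p) \<or>
    \<not> (\<exists>s' t'. s' \<epsilon> Str Two \<and> t' \<epsilon> Str Two \<and> s \<sqsubseteq> s' \<and> t \<sqsubseteq> t' \<and> fst' p \<sqsubseteq> s' \<and> snd' p \<sqsubseteq> t')" for k p
  have [D_intros]: "D (\<lambda>v. R (a v) (b v))" if "FT a" "FT b" for a b
    by (rule D2[of R, OF _ that]) (unfold R_def, intro D_intros)
  define DD where "DD k = Sep ?P (R k)" for k
  have DD: "p \<epsilon> DD k \<longleftrightarrow> p \<epsilon> ?P \<and> R k p" for p k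
    unfolding DD_def by (rule mem_Sep) (intro D_intros)
  have [D_intros]: "FT (\<lambda>v. DD (a v))" if "FT a" for a
    by (rule FT1[of DD, OF _ that]) (unfold DD_def, intro D_intros)
  have dense: "densep (DD k)" if k: "k \<epsilon> W" for k
    unfolding densep_def
  proof (intro allI impI, elim conjE)
    fix a b assume ab: "a \<epsilon> Str Two" "b \<epsilon> Str Two"
    show "\<exists>s' t'. s' \<epsilon> Str Two \<and> t' \<epsilon> Str Two \<and> a \<sqsubseteq> s' \<and> b \<sqsubseteq> t' \<and> pr s' t' \<epsilon> DD k"
    proof (cases "R k (pr a b)")
      case True
      then show ?thesis using DD ab by (intro exI[of _ a] exI[of _ b]) simp
    next
      case False
      then obtain s' t' where st: "s' \<epsilon> Str Two" "t' \<epsilon> Str Two" "s \<sqsubseteq> s'" "t \<sqsubseteq> t'" "a \<sqsubseteq> s'" "b \<sqsubseteq> t'"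
        unfolding R_def by auto
      then have "\<not> good C (snoc u k) s' t'" using neg k by blast
      then obtain s1 t1 where 1: "s1 \<epsilon> Str Two" "t1 \<epsilon> Str Two" "s' \<sqsubseteq> s1" "t' \<sqsubseteq> t1"
        "small C (snoc u k) s1 t1" unfolding good_def by blast
      then have "pr s1 t1 \<epsilon> DD k" unfolding DD R_def by simp
      then show ?thesis using 1 st sub_trans by blast
    qed
  qed
  define E1 where "E1 = Sep (Pw ?P) (\<lambda>d. \<exists>k. k \<epsilon> W \<and> d = DD k)"
  have E1: "d \<epsilon> E1 \<longleftrightarrow> d \<epsilon> Pw ?P \<and> (\<exists>k. k \<epsilon> W \<and> d = DD k)" for d
    unfolding E1_def by (rule mem_Sep) (intro D_intros)
  have DD_E1: "DD k \<epsilon> E1" if "k \<epsilon> W" for k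
    unfolding E1 using that DD by (auto simp: is_subset_def)
  have cE1: "is_countable E1"
  proof (rule countable_surj[OF countable_W, of "\<lambda>d k. d = DD k"])
    show "D (\<lambda>v. v 0 = DD (v (Suc 0)))" by (intro D_intros)
  qed (use E1 in auto)
  have "covers C (cup Z E1) u s t"
    unfolding covers_def
  proof (intro allI impI, elim conjE)
    fix x y z assume c: "pr (pr x y) z \<epsilon> C" and sub: "s \<sqsubseteq> x" "t \<sqsubseteq> y" "u \<sqsubseteq> z"
    note F = closed3_D[OF C c]
    \<comment> \<open>The next digit of the witness decides which dense set is relevant to this
      point.\<close>
    define k where "k = app z (dm u)"
    have k: "k \<epsilon> W" unfolding k_def using app_mem[OF F(3)] Str_dm(1)[OF u] .
    have uz: "snoc u k \<sqsubseteq> z" unfolding k_def by (rule snoc_sub[OF u F(3) sub(3)])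
    show "\<exists>d. d \<epsilon> cup Z E1 \<and> densep d \<and> avoids d x y"
    proof (cases "avoids (DD k) x y")
      case True
      then show ?thesis using DD_E1[OF k] dense[OF k] by auto
    next
      case False
      then obtain s' t' where st: "pr s' t' \<epsilon> DD k" "s' \<sqsubseteq> x" "t' \<sqsubseteq> y" unfolding avoids_def by blast
      then have st': "s' \<epsilon> Str Two" "t' \<epsilon> Str Two" "R k (pr s' t')" using DD by auto
      \<comment> \<open>Strings below the same point are comparable, so this box is compatible with
        \<open>(s, t)\<close> and only the \<open>small\<close> alternative of \<open>R\<close>
        remains.\<close>
      have "\<exists>s''. s'' \<epsilon> Str Two \<and> s \<sqsubseteq> s'' \<and> s' \<sqsubseteq> s''"
        using Str_comparable[OF s st'(1) F(1) sub(1) st(2)] s st' sub_refl by blast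
      moreover have "\<exists>t''. t'' \<epsilon> Str Two \<and> t \<sqsubseteq> t'' \<and> t' \<sqsubseteq> t''"
        using Str_comparable[OF t st'(2) F(2) sub(2) st(3)] t st' sub_refl by blast
      ultimately have "small C (snoc u k) s' t'" using st'(3) unfolding R_def by auto
      then have "pr k (pr s' t') \<epsilon> X" unfolding X using k st' by simp
      then obtain Y where Y: "Y \<sqsubseteq> Z" "covers C Y (snoc u k) s' t'" using Z(3) by fastforce
      then obtain d where "d \<epsilon> Y" "densep d" "avoids d x y"
        unfolding covers_def using c st uz by blast
      then show ?thesis using Y subD by auto
    qed
  qed
  moreover have "is_countable (cup Z E1)" using countable_cup Z cE1 by blast
  moreover have "cup Z E1 \<sqsubseteq> Pw ?P" using Z(1) E1 unfolding is_subset_def by auto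
  ultimately have "small C u s t" unfolding small_def by blast
  then show False using ns by blast
qed

text \<open>The two one-digit extensions differ at position \<open>dm t\<close>, so \<open>e\<close>
  can extend at most one of them.\<close>

lemma two_extensions:
  assumes "t \<epsilon> Str Two" "Fun e W Two"
  shows "\<exists>t'. t' \<epsilon> Str Two \<and> t \<sqsubseteq> t' \<and> \<not> t' \<sqsubseteq> e"
proof -
  have b: "emp \<epsilon> Two" "suc emp \<epsilon> Two" by (auto simp: mem_Two)
  have "\<not> (snoc t emp \<sqsubseteq> e \<and> snoc t (suc emp) \<sqsubseteq> e)"
  proof
    assume "snoc t emp \<sqsubseteq> e \<and> snoc t (suc emp) \<sqsubseteq> e"
    then have "pr (dm t) emp \<epsilon> e" "pr (dm t) (suc emp) \<epsilon> e" by (auto simp: snoc_def is_subset_def)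
    then have "emp = suc emp" using Fun_app[OF assms(2)] by metis
    then show False by simp
  qed
  then show ?thesis using snoc_Str[OF assms(1)] b by blast
qed

text \<open>It takes the place of the Kuratowski-Ulam theorem. Failing meagerness, a generic
  \<open>x\<close> is built along which good nodes never die; over this \<open>x\<close> a point
  \<open>y\<close> and its witness are built off every element of \<open>c\<close>, although
  \<open>c\<close> contains the section at \<open>x\<close>.\<close>

lemma meager_of_countable_sections:
  assumes C: "closed3 C"
    and sect: "\<And>x. Fun x W Two \<Longrightarrow> \<exists>c. is_countable c \<and> x \<epsilon> c \<and>
      (\<forall>y z. pr (pr x y) z \<epsilon> C \<longrightarrow> y \<epsilon> c) \<and> (\<forall>y. y \<epsilon> c \<longrightarrow> Fun y W Two)"
  shows "small C emp emp emp"
proof (rule ccontr)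
  assume "\<not> small C emp emp emp"
  \<comment> \<open>From mere nonsmallness to goodness, which survives the later shrinking of
    boxes.\<close>
  from exists_good[OF C _ _ _ this]
  obtain k0 s0 t0 where 0: "k0 \<epsilon> W" "s0 \<epsilon> Str Two" "t0 \<epsilon> Str Two" "good C (snoc emp k0) s0 t0" by auto
  define u0 where "u0 = snoc emp k0"
  have u0: "u0 \<epsilon> Str W" "good C u0 s0 t0" unfolding u0_def using snoc_Str 0 by auto
  have e2: "emp \<epsilon> Two" by (simp add: mem_Two)
  \<comment> \<open>For the index \<open>(u, (t, n))\<close>: \<open>s\<close> is longer than
    \<open>n\<close> and decides \<open>(u, t)\<close>. Either a good next digit is available at
    \<open>s\<close>, or no extension of \<open>s\<close> is good for \<open>(u, t)\<close>.\<close>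
  define \<delta> where "\<delta> i s \<longleftrightarrow> snd' (snd' i) \<epsilon> dm s \<and>
    ((\<exists>t k. t \<epsilon> Str Two \<and> k \<epsilon> W \<and> fst' (snd' i) \<sqsubseteq> t \<and> good C (snoc (fst' i) k) s t) \<or>
     \<not> (\<exists>s'. s' \<epsilon> Str Two \<and> s \<sqsubseteq> s' \<and> good C (fst' i) s' (fst' (snd' i))))" for i s
  obtain G where G: "s0 \<epsilon> G" "\<And>s. s \<epsilon> G \<Longrightarrow> s \<epsilon> Str Two" "\<And>s t. s \<epsilon> G \<Longrightarrow> t \<epsilon> G \<Longrightarrow> s \<sqsubseteq> t \<or> t \<sqsubseteq> s"
    "\<And>i. i \<epsilon> cart (Str W) (cart (Str Two) W) \<Longrightarrow> \<exists>s. s \<epsilon> G \<and> \<delta> i s"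
  proof (rule rasiowa_sikorski[OF countable_cart[OF countable_StrW countable_cart[OF countable_Str2 countable_W]], of is_subset \<delta> "Str Two" s0])
    show "D (\<lambda>v. v 0 \<sqsubseteq> v (Suc 0))" by (intro D_intros)
    show "D (\<lambda>v. \<delta> (v 0) (v (Suc 0)))" unfolding \<delta>_def by (intro D_intros)
    fix i s assume i: "i \<epsilon> cart (Str W) (cart (Str Two) W)" and s: "s \<epsilon> Str Two"
    then obtain u t n where utn: "i = pr u (pr t n)" "u \<epsilon> Str W" "t \<epsilon> Str Two" "n \<epsilon> W"
      by (auto simp: mem_cart)
    show "\<exists>s'. s' \<epsilon> Str Two \<and> s \<sqsubseteq> s' \<and> \<delta> i s'"
    proof (cases "\<exists>s'. s' \<epsilon> Str Two \<and> s \<sqsubseteq> s' \<and> good C u s' t")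
      case True
      then obtain s' where s': "s' \<epsilon> Str Two" "s \<sqsubseteq> s'" "good C u s' t" by blast
      obtain k s1 t1 where 1: "k \<epsilon> W" "s1 \<epsilon> Str Two" "t1 \<epsilon> Str Two" "s' \<sqsubseteq> s1" "t \<sqsubseteq> t1" "good C (snoc u k) s1 t1"
        using exists_good[OF C utn(2) s'(1) utn(3)] good_not_small s' utn by blast
      obtain s2 where 2: "s2 \<epsilon> Str Two" "s1 \<sqsubseteq> s2" "n \<epsilon> dm s2" using Str_lengthen[OF 1(2) e2 utn(4)] by blast
      have "good C (snoc u k) s2 t1" using good_ext 1 2 sub_refl by blast
      then have "\<delta> i s2" unfolding \<delta>_def utn(1) using 1 2 by auto
      then show ?thesis using 2 1 s' sub_trans by blast
    next
      case False
      obtain s2 where 2: "s2 \<epsilon> Str Two" "s \<sqsubseteq> s2" "n \<epsilon> dm s2" using Str_lengthen[OF s e2 utn(4)] by blast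
      then have "\<not> (\<exists>s'. s' \<epsilon> Str Two \<and> s2 \<sqsubseteq> s' \<and> good C u s' t)" using False sub_trans by blast
      then have "\<delta> i s2" unfolding \<delta>_def utn(1) using 2 by auto
      then show ?thesis using 2 by blast
    qed
  qed (use 0 in \<open>auto intro: sub_trans\<close>)
  define x where "x = Uni G"
  have x: "Fun x W Two" unfolding x_def
  proof (rule chain_Fun)
    show "\<exists>s. s \<epsilon> G \<and> n \<epsilon> dm s" if "n \<epsilon> W" for n
      using G(4)[of "pr emp (pr emp n)"] that unfolding \<delta>_def by auto
  qed (use G in auto)
  \<comment> \<open>The negative alternative is impossible: the deciding \<open>p\<close> and the
    given \<open>s\<close> both lie below \<open>x\<close>, and the longer of them is a good
    extension of \<open>p\<close>.\<close>
  have nxt: "\<exists>s' t' k. s' \<epsilon> Str Two \<and> s' \<sqsubseteq> x \<and> t' \<epsilon> Str Two \<and> t \<sqsubseteq> t' \<and> k \<epsilon> W \<and> good C (snoc u k) s' t'"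
    if st: "s \<epsilon> Str Two" "s \<sqsubseteq> x" "good C u s t" "u \<epsilon> Str W" "t \<epsilon> Str Two" for s t u
  proof -
    obtain p where p: "p \<epsilon> G" "\<delta> (pr u (pr t emp)) p" using G(4)[of "pr u (pr t emp)"] st by auto
    have p': "p \<epsilon> Str Two" "p \<sqsubseteq> x" using G p sub_Uni x_def by auto
    have "s \<sqsubseteq> p \<or> p \<sqsubseteq> s" using Str_comparable[OF that(1) p'(1) x that(2) p'(2)] .
    then have "\<exists>s'. s' \<epsilon> Str Two \<and> p \<sqsubseteq> s' \<and> good C u s' t"
      using good_ext[OF that(3) _ sub_refl] that(1,3) p'(1) sub_refl by blast
    then show ?thesis using p(2) p' unfolding \<delta>_def by auto
  qed
  obtain c where c: "is_countable c" "x \<epsilon> c" "\<And>y z. pr (pr x y) z \<epsilon> C \<Longrightarrow> y \<epsilon> c"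
    "\<And>y. y \<epsilon> c \<Longrightarrow> Fun y W Two" using sect[OF x] by blast
  \<comment> \<open>The pairs \<open>(t, u)\<close> of approximations to \<open>y\<close> and to its
    witness that are still alive over \<open>x\<close>.\<close>
  define Q where "Q = Sep (cart (Str Two) (Str W))
    (\<lambda>q. \<exists>s. s \<epsilon> Str Two \<and> s \<sqsubseteq> x \<and> good C (snd' q) s (fst' q))"
  have "q \<epsilon> Q \<longleftrightarrow> q \<epsilon> cart (Str Two) (Str W) \<and>
    (\<exists>s. s \<epsilon> Str Two \<and> s \<sqsubseteq> x \<and> good C (snd' q) s (fst' q))" for q
    unfolding Q_def by (rule mem_Sep) (intro D_intros)
  then have Q: "q \<epsilon> Q \<longleftrightarrow> (\<exists>t u s. q = pr t u \<and> t \<epsilon> Str Two \<and> u \<epsilon> Str W \<and> s \<epsilon> Str Two \<and> s \<sqsubseteq> x \<and> good C u s t)" for q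
    by (auto simp: mem_cart)
  \<comment> \<open>The condition \<open>n \<epsilon> suc (dm u')\<close> means length at least
    \<open>n\<close>. Digits of the witness are gained one at a time through \<open>nxt\<close>,
    whereas \<open>t\<close> may be lengthened at will.\<close>
  have u_long: "\<exists>t' u'. pr t' u' \<epsilon> Q \<and> t \<sqsubseteq> t' \<and> u \<sqsubseteq> u' \<and> n \<epsilon> suc (dm u')"
    if "n \<epsilon> W" "pr t u \<epsilon> Q" for n t u
    using that(1)
  proof (induction n rule: W_induct)
    case dfn
    show ?case by (intro D_intros)
  next
    case zero
    then show ?case using that(2) zero_less_suc Str_dm Q sub_refl by (metis pr_inj)
  next
    case (suc n)
    then obtain t' u' where 1: "pr t' u' \<epsilon> Q" "t \<sqsubseteq> t'" "u \<sqsubseteq> u'" "n \<epsilon> suc (dm u')" by blast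
    then obtain s where s: "t' \<epsilon> Str Two" "u' \<epsilon> Str W" "s \<epsilon> Str Two" "s \<sqsubseteq> x" "good C u' s t'" using Q by auto
    obtain s2 t2 k where 2: "s2 \<epsilon> Str Two" "s2 \<sqsubseteq> x" "t2 \<epsilon> Str Two" "t' \<sqsubseteq> t2" "k \<epsilon> W" "good C (snoc u' k) s2 t2"
      using nxt[OF s(3,4,5,2,1)] by blast
    note sn = snoc_Str[OF s(2) 2(5)]
    have "pr t2 (snoc u' k) \<epsilon> Q" using Q 2 sn by auto
    moreover have "suc n \<epsilon> suc (dm (snoc u' k))" unfolding sn(2)
      using less_suc_iff[OF _ 1(4)] Str_dm(1)[OF s(2)] suc_W by blast
    ultimately show ?case using 1 2 sn sub_trans by blast
  qed
  \<comment> \<open>The first conjunct keeps \<open>y\<close> different from the element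
    \<open>e\<close> of \<open>c\<close>; the other two make \<open>y\<close> and \<open>z\<close>
    total.\<close>
  define \<gamma> where "\<gamma> i q \<longleftrightarrow> \<not> fst' q \<sqsubseteq> fst' i \<and> snd' i \<epsilon> dm (fst' q) \<and> snd' i \<epsilon> dm (snd' q)" for i q
  obtain H where H: "\<And>q. q \<epsilon> H \<Longrightarrow> q \<epsilon> Q"
    "\<And>p q. p \<epsilon> H \<Longrightarrow> q \<epsilon> H \<Longrightarrow> (fst' p \<sqsubseteq> fst' q \<and> snd' p \<sqsubseteq> snd' q) \<or> (fst' q \<sqsubseteq> fst' p \<and> snd' q \<sqsubseteq> snd' p)"
    "\<And>i. i \<epsilon> cart c W \<Longrightarrow> \<exists>q. q \<epsilon> H \<and> \<gamma> i q"
  proof (rule rasiowa_sikorski[OF countable_cart[OF c(1) countable_W], of "\<lambda>p q. fst' p \<sqsubseteq> fst' q \<and> snd' p \<sqsubseteq> snd' q" \<gamma> Q "pr t0 u0"])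
    show "D (\<lambda>v. fst' (v 0) \<sqsubseteq> fst' (v (Suc 0)) \<and> snd' (v 0) \<sqsubseteq> snd' (v (Suc 0)))" by (intro D_intros)
    show "D (\<lambda>v. \<gamma> (v 0) (v (Suc 0)))" unfolding \<gamma>_def by (intro D_intros)
    have "s0 \<sqsubseteq> x" unfolding x_def using G sub_Uni by blast
    then show "pr t0 u0 \<epsilon> Q" using Q 0 u0 by auto
    fix i q assume i: "i \<epsilon> cart c W" and q: "q \<epsilon> Q"
    obtain e n where en: "i = pr e n" "e \<epsilon> c" "n \<epsilon> W" using i by (auto simp: mem_cart)
    obtain t u s where tus: "q = pr t u" "t \<epsilon> Str Two" "u \<epsilon> Str W" "s \<epsilon> Str Two" "s \<sqsubseteq> x" "good C u s t"
      using q Q by blast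
    obtain t1 where 1: "t1 \<epsilon> Str Two" "t \<sqsubseteq> t1" "n \<epsilon> dm t1" using Str_lengthen[OF tus(2) e2 en(3)] by blast
    obtain t2 where 2: "t2 \<epsilon> Str Two" "t1 \<sqsubseteq> t2" "\<not> t2 \<sqsubseteq> e" using two_extensions[OF 1(1) c(4)[OF en(2)]] by blast
    have tt2: "t \<sqsubseteq> t2" using 1 2 sub_trans by blast
    then have "good C u s t2" using good_ext tus sub_refl by blast
    then have "pr t2 u \<epsilon> Q" using Q 2 tus by auto
    from u_long[OF suc_W[OF en(3)] this]
    obtain t3 u3 where 3: "pr t3 u3 \<epsilon> Q" "t2 \<sqsubseteq> t3" "u \<sqsubseteq> u3" "suc n \<epsilon> suc (dm u3)" by blast
    then have "dm u3 \<epsilon> W" using Q Str_dm by auto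
    then have "n \<epsilon> dm u3" using 3 suc_less by blast
    moreover have "n \<epsilon> dm t3" using 1 2 3 sub_dm sub_trans subD by blast
    moreover have "\<not> t3 \<sqsubseteq> e" using 2 3 sub_trans by blast
    ultimately have "\<gamma> i (pr t3 u3)" unfolding \<gamma>_def en(1) by simp
    moreover have "t \<sqsubseteq> t3" using tt2 3 sub_trans by blast
    ultimately show "\<exists>q'. q' \<epsilon> Q \<and> (fst' q \<sqsubseteq> fst' q' \<and> snd' q \<sqsubseteq> snd' q') \<and> \<gamma> i q'"
      using 3 tus by (intro exI[of _ "pr t3 u3"]) auto
  qed (auto intro: sub_trans)
  have HQ: "\<exists>t u s. q = pr t u \<and> t \<epsilon> Str Two \<and> u \<epsilon> Str W \<and> s \<epsilon> Str Two \<and> s \<sqsubseteq> x \<and> good C u s t" if "q \<epsilon> H" for q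
    using H(1)[OF that] Q by blast
  define T where "T = Sep (Str Two) (\<lambda>t. \<exists>q. q \<epsilon> H \<and> t = fst' q)"
  have T: "t \<epsilon> T \<longleftrightarrow> t \<epsilon> Str Two \<and> (\<exists>q. q \<epsilon> H \<and> t = fst' q)" for t
    unfolding T_def by (rule mem_Sep) (intro D_intros)
  define U where "U = Sep (Str W) (\<lambda>t. \<exists>q. q \<epsilon> H \<and> t = snd' q)"
  have U: "t \<epsilon> U \<longleftrightarrow> t \<epsilon> Str W \<and> (\<exists>q. q \<epsilon> H \<and> t = snd' q)" for t
    unfolding U_def by (rule mem_Sep) (intro D_intros)
  have HTU: "fst' q \<epsilon> T" "snd' q \<epsilon> U" if "q \<epsilon> H" for q
    using HQ[OF that] that T U by auto
  \<comment> \<open>An element of \<open>c\<close> is required as an index to force length;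
    \<open>x\<close> is one.\<close>
  have long: "\<exists>q. q \<epsilon> H \<and> n \<epsilon> dm (fst' q) \<and> n \<epsilon> dm (snd' q)" if "n \<epsilon> W" for n
    using H(3)[of "pr x n"] c(2) that unfolding \<gamma>_def by auto
  define y where "y = Uni T"
  define z where "z = Uni U"
  have y: "Fun y W Two" unfolding y_def
  proof (rule chain_Fun)
    show "t \<sqsubseteq> t' \<or> t' \<sqsubseteq> t" if "t \<epsilon> T" "t' \<epsilon> T" for t t' using that H(2) unfolding T by blast
    show "\<exists>t. t \<epsilon> T \<and> n \<epsilon> dm t" if "n \<epsilon> W" for n using long[OF that] HTU by blast
  qed (use T in auto)
  have z: "Fun z W W" unfolding z_def
  proof (rule chain_Fun)
    show "t \<sqsubseteq> t' \<or> t' \<sqsubseteq> t" if "t \<epsilon> U" "t' \<epsilon> U" for t t' using that H(2) unfolding U by blast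
    show "\<exists>t. t \<epsilon> U \<and> n \<epsilon> dm t" if "n \<epsilon> W" for n using long[OF that] HTU by blast
  qed (use U in auto)
  have "pr (pr x y) z \<epsilon> C"
  proof (rule closed3_closed[OF C x y z])
    fix n assume n: "n \<epsilon> W"
    obtain q where q: "q \<epsilon> H" "n \<epsilon> dm (fst' q)" "n \<epsilon> dm (snd' q)" using long n by blast
    then obtain t u s where tus: "q = pr t u" "t \<epsilon> Str Two" "u \<epsilon> Str W" "s \<epsilon> Str Two" "s \<sqsubseteq> x" "good C u s t"
      using HQ by blast
    obtain m where m: "m \<epsilon> W" "n \<epsilon> m" "dm s \<epsilon> m" using W_upper[OF n Str_dm(1)[OF tus(4)]] by blast
    note r = restr_Str[OF x m(1)]
    have "s \<sqsubseteq> restr x m" using Str_sub_restr[OF tus(4,5)] less_sub m by blast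
    then have "good C u (restr x m) t" using good_ext tus sub_refl by blast
    then have "\<not> small C u (restr x m) t" using good_not_small r tus by blast
    \<comment> \<open>The empty family covers a box only if no point of \<open>C\<close> lies above
      it. So good boxes contain points of \<open>C\<close>, and these converge to
      \<open>(x, y, z)\<close>.\<close>
    then have "\<not> covers C emp u (restr x m) t" unfolding small_def using countable_emp emp_sub by blast
    then obtain x' y' z' where xyz: "pr (pr x' y') z' \<epsilon> C" "restr x m \<sqsubseteq> x'" "t \<sqsubseteq> y'" "u \<sqsubseteq> z'"
      unfolding covers_def by blast
    note F = closed3_D[OF C xyz(1)]
    have "agree n x x'" using agree_sub[OF x F(1) restr_sub xyz(2)] r m less_sub by simp
    moreover have "agree n y y'"
      using agree_sub[OF y F(2) _ xyz(3)] q tus HTU[OF q(1)] sub_Uni less_sub Str_dm(1)[OF tus(2)]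
      unfolding y_def by simp
    moreover have "agree n z z'"
      using agree_sub[OF z F(3) _ xyz(4)] q tus HTU[OF q(1)] sub_Uni less_sub Str_dm(1)[OF tus(3)]
      unfolding z_def by simp
    ultimately show "\<exists>x' y' z'. pr (pr x' y') z' \<epsilon> C \<and> agree n x x' \<and> agree n y y' \<and> agree n z z'"
      using xyz by blast
  qed
  then have "y \<epsilon> c" using c by blast
  then obtain q where "q \<epsilon> H" "\<gamma> (pr y emp) q" using H(3)[of "pr y emp"] by auto
  then show False using HTU sub_Uni unfolding \<gamma>_def y_def by auto
qed

end

section \<open>Continuous images of Cantor space\<close>

context ZF_DC
begin

text \<open>Tarski's finiteness, which gives finite induction without any counting.\<close>

definition Fin :: "'a \<Rightarrow> bool" where
  "Fin A \<longleftrightarrow> (\<forall>K. emp \<epsilon> K \<and> (\<forall>F x. F \<epsilon> K \<and> x \<epsilon> A \<longrightarrow> adj F x \<epsilon> K) \<longrightarrow> A \<epsilon> K)"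

lemma D_Fin[D_intros]: "FT s \<Longrightarrow> D (\<lambda>v. Fin (s v))"
  by (rule D1[of Fin]) (unfold Fin_def, intro D_intros)

lemma Fin_induct[consumes 1, case_names dfn emp adj]:
  assumes "Fin A" "D (\<lambda>v. P (v 0))" "P emp"
    "\<And>F x. F \<sqsubseteq> A \<Longrightarrow> x \<epsilon> A \<Longrightarrow> P F \<Longrightarrow> P (adj F x)"
  shows "P A"
proof -
  have m: "F \<epsilon> Sep (Pw A) P \<longleftrightarrow> F \<sqsubseteq> A \<and> P F" for F
    by (subst mem_Sep[OF assms(2)]) simp
  have "A \<epsilon> Sep (Pw A) P"
    by (rule assms(1)[unfolded Fin_def, rule_format]) (use assms(3,4) m in \<open>auto simp: is_subset_def\<close>)
  then show ?thesis using m by blast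
qed

lemma Fin_emp[simp]: "Fin emp"
  by (simp add: Fin_def)

lemma Fin_adj: "Fin A \<Longrightarrow> Fin (adj A x)"
  unfolding Fin_def by (metis mem_adj)

lemma Fin_cup: "Fin A \<Longrightarrow> Fin B \<Longrightarrow> Fin (cup A B)"
proof -
  assume A: "Fin A" and B: "Fin B"
  show "Fin (cup A B)" using B
  proof (induction B rule: Fin_induct)
    case dfn
    show ?case by (intro D_intros)
  next
    case emp
    have "cup A emp = A" by (rule set_ext) simp
    then show ?case using A by simp
  next
    case (adj F x)
    have "cup A (adj F x) = adj (cup A F) x" by (rule set_ext) auto
    then show ?case using adj Fin_adj by simp
  qed
qed

lemma Fin_cart:
  assumes "Fin A" "Fin B" shows "Fin (cart A B)"
proof -
  have 1: "Fin (cart (upr x x) B)" for x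
    using assms(2)
  proof (induction B rule: Fin_induct)
    case dfn
    show ?case by (intro D_intros)
  next
    case emp
    have "cart (upr x x) emp = emp" by (rule set_ext) (simp add: mem_cart)
    then show ?case by simp
  next
    case (adj F y)
    have "cart (upr x x) (adj F y) = adj (cart (upr x x) F) (pr x y)" by (rule set_ext) (auto simp: mem_cart)
    then show ?case using adj Fin_adj by simp
  qed
  show ?thesis using assms(1)
  proof (induction A rule: Fin_induct)
    case dfn
    show ?case by (intro D_intros)
  next
    case emp
    have "cart emp B = emp" by (rule set_ext) (simp add: mem_cart)
    then show ?case by simp
  next
    case (adj F y)
    have "cart (adj F y) B = cup (cart F B) (cart (upr y y) B)" by (rule set_ext) (auto simp: mem_cart)
    then show ?case using adj Fin_cup 1 by simp
  qed
qed

definition Lev :: "'a \<Rightarrow> 'a" where "Lev n = Sep (Str Two) (\<lambda>s. Fun s n Two)"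

lemma FT_Lev[D_intros]: "FT s \<Longrightarrow> FT (\<lambda>v. Lev (s v))"
  by (rule FT1[of Lev]) (unfold Lev_def, intro D_intros)

lemma mem_Lev: "n \<epsilon> W \<Longrightarrow> s \<epsilon> Lev n \<longleftrightarrow> Fun s n Two"
proof -
  assume "n \<epsilon> W"
  moreover have "s \<epsilon> Lev n \<longleftrightarrow> s \<epsilon> Str Two \<and> Fun s n Two"
    unfolding Lev_def by (rule mem_Sep) (intro D_intros)
  ultimately show ?thesis using mem_Str by blast
qed

lemma Fin_Lev: "n \<epsilon> W \<Longrightarrow> Fin (Lev n)"
proof (induction n rule: W_induct)
  case dfn
  show ?case by (intro D_intros)
next
  case zero
  have "Lev emp = adj emp emp"
    by (rule set_ext) (use Fun_eqI[of _ emp Two emp Two] Fun_emp in \<open>auto simp: mem_Lev\<close>)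
  then show ?case using Fin_adj by simp
next
  case (suc n)
  \<comment> \<open>\<open>N F\<close> consists of the one-digit extensions of strings in
    \<open>F\<close>. Adding one string to \<open>F\<close> adds just two extensions.\<close>
  define N where "N F = Sep (Lev (suc n)) (\<lambda>s. restr s n \<epsilon> F)" for F
  have N: "s \<epsilon> N F \<longleftrightarrow> s \<epsilon> Lev (suc n) \<and> restr s n \<epsilon> F" for s F
    unfolding N_def by (rule mem_Sep) (intro D_intros)
  have [D_intros]: "FT (\<lambda>v. N (a v))" if "FT a" for a
    by (rule FT1[of N, OF _ that]) (unfold N_def, intro D_intros)
  have "Fin (N (Lev n))"
  proof (rule Fin_induct[of "Lev n" "\<lambda>F. Fin (N F)", OF suc(2)])
    show "D (\<lambda>v. Fin (N (v 0)))" by (intro D_intros)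
    have "N emp = emp" by (rule set_ext) (simp add: N)
    then show "Fin (N emp)" by simp
    fix F x assume adj: "x \<epsilon> Lev n" "Fin (N F)"
    have x: "Fun x n Two" using adj(1) mem_Lev suc(1) by blast
    then have xs: "x \<epsilon> Str Two" "dm x = n" using mem_Str suc(1) dm_Fun by auto
    have sn: "snoc x b \<epsilon> Lev (suc n) \<and> restr (snoc x b) n = x" if "b \<epsilon> Two" for b
      using snoc_Str[OF xs(1) that] mem_Lev[OF suc_W[OF suc(1)]] Str_dm[of "snoc x b" Two]
        Str_restr_eq[OF xs(1), of "snoc x b"] xs by metis
    have "N (adj F x) = cup (N F) (adj (adj emp (snoc x emp)) (snoc x (suc emp)))"
    proof (rule set_ext)
      fix s
      show "s \<epsilon> N (adj F x) \<longleftrightarrow> s \<epsilon> cup (N F) (adj (adj emp (snoc x emp)) (snoc x (suc emp)))"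
      proof
        assume "s \<epsilon> N (adj F x)"
        then consider "s \<epsilon> N F" | "s \<epsilon> Lev (suc n)" "restr s n = x" unfolding N by auto
        then show "s \<epsilon> cup (N F) (adj (adj emp (snoc x emp)) (snoc x (suc emp)))"
        proof cases
          case 2
          then have "Fun s (suc n) Two" using mem_Lev suc_W suc(1) by blast
          from Str_suc_cases[OF this suc(1)] have "s = snoc x (app s n)" "app s n \<epsilon> Two"
            unfolding snoc_def 2(2) xs(2) by blast+
          then show ?thesis unfolding mem_Two by auto
        qed simp
      next
        assume "s \<epsilon> cup (N F) (adj (adj emp (snoc x emp)) (snoc x (suc emp)))"
        then show "s \<epsilon> N (adj F x)" using sn[of emp] sn[of "suc emp"] by (auto simp: N mem_Two)
      qed
    qed
    then show "Fin (N (adj F x))" using adj(2) Fin_cup Fin_adj Fin_emp by simp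
  qed
  moreover have "N (Lev n) = Lev (suc n)"
    by (rule set_ext) (use N suc(1) Str_suc_cases(1)[OF _ suc(1)] in \<open>auto simp: mem_Lev simp del: mem_suc\<close>)
  ultimately show ?case by simp
qed

lemma Fun_upd:
  assumes "Fun f A B" "x \<epsilon> A" "y \<epsilon> B"
  obtains g where "Fun g A B" "app g x = y" "\<And>z. z \<epsilon> A \<Longrightarrow> z \<noteq> x \<Longrightarrow> app g z = app f z"
proof -
  define F where "F z = The0 (\<lambda>w. z = x \<and> w = y \<or> z \<noteq> x \<and> w = app f z)" for z
  have FT: "FT (\<lambda>v. F (v 0))" unfolding F_def by (intro D_intros)
  have F: "F x = y" "z \<noteq> x \<Longrightarrow> F z = app f z" for z
    unfolding F_def by (auto intro: The0_eq)
  have FB: "F z \<epsilon> B" if "z \<epsilon> A" for z using F(1) F(2)[of z] assms(3) app_mem[OF assms(1) that] by (cases "z = x") auto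
  obtain g where g: "Fun g A B" "\<And>z. z \<epsilon> A \<Longrightarrow> app g z = F z" using lam_ex[OF FT FB] by blast
  show ?thesis by (rule that[of g]) (use g F assms in auto)
qed

text \<open>Each of the finitely many pairs is treated in turn; openness of \<open>w\<close> preserves the earlier ones.\<close>

lemma finite_refine:
  assumes le: "D (\<lambda>v. le (v 0) (v (Suc 0)))" and w: "D (\<lambda>v. w (v 0) (v (Suc 0)))"
    and refl: "\<And>p. p \<epsilon> Q \<Longrightarrow> le p p"
    and trans: "\<And>p q r. p \<epsilon> Q \<Longrightarrow> q \<epsilon> Q \<Longrightarrow> r \<epsilon> Q \<Longrightarrow> le p q \<Longrightarrow> le q r \<Longrightarrow> le p r"
    and dense: "\<And>p q. p \<epsilon> Q \<Longrightarrow> q \<epsilon> Q \<Longrightarrow> \<exists>p' q'. p' \<epsilon> Q \<and> q' \<epsilon> Q \<and> le p p' \<and> le q q' \<and> w p' q'"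
    and opn: "\<And>p q p' q'. p \<epsilon> Q \<Longrightarrow> q \<epsilon> Q \<Longrightarrow> p' \<epsilon> Q \<Longrightarrow> q' \<epsilon> Q \<Longrightarrow> w p q \<Longrightarrow> le p p' \<Longrightarrow> le q q' \<Longrightarrow> w p' q'"
    and "Fin I" and \<phi>: "Fun \<phi> I Q"
  shows "\<exists>\<psi>. Fun \<psi> I Q \<and> (\<forall>i. i \<epsilon> I \<longrightarrow> le (app \<phi> i) (app \<psi> i)) \<and>
    (\<forall>i j. i \<epsilon> I \<and> j \<epsilon> I \<and> i \<noteq> j \<longrightarrow> w (app \<psi> i) (app \<psi> j))"
proof -
  note [D_intros] = D2[of le, OF le] D2[of w, OF w]
  let ?R = "\<lambda>K. \<exists>\<psi>. Fun \<psi> I Q \<and> (\<forall>i. i \<epsilon> I \<longrightarrow> le (app \<phi> i) (app \<psi> i)) \<and>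
    (\<forall>i j. i \<epsilon> I \<and> j \<epsilon> I \<and> i \<noteq> j \<and> pr i j \<epsilon> K \<longrightarrow> w (app \<psi> i) (app \<psi> j))"
  have "?R (cart I I)"
  proof (rule Fin_induct[of "cart I I" ?R])
    show "Fin (cart I I)" using Fin_cart \<open>Fin I\<close> by blast
    show "D (\<lambda>v. ?R (v 0))" by (intro D_intros)
    show "?R emp" using \<phi> refl app_mem[OF \<phi>] by auto
    fix K p assume adj: "p \<epsilon> cart I I" "?R K"
    obtain \<psi> where \<psi>: "Fun \<psi> I Q" "\<And>i. i \<epsilon> I \<Longrightarrow> le (app \<phi> i) (app \<psi> i)"
      "\<And>i j. i \<epsilon> I \<Longrightarrow> j \<epsilon> I \<Longrightarrow> i \<noteq> j \<Longrightarrow> pr i j \<epsilon> K \<Longrightarrow> w (app \<psi> i) (app \<psi> j)" using adj(2) by blast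
    obtain i j where ij: "p = pr i j" "i \<epsilon> I" "j \<epsilon> I" using adj(1) by (auto simp: mem_cart)
    show "?R (adj K p)"
    proof (cases "i = j")
      case True
      then show ?thesis using \<psi> ij by (intro exI[of _ \<psi>]) auto
    next
      case False
      note m = app_mem[OF \<psi>(1)]
      obtain q r where qr: "q \<epsilon> Q" "r \<epsilon> Q" "le (app \<psi> i) q" "le (app \<psi> j) r" "w q r"
        using dense[OF m[OF ij(2)] m[OF ij(3)]] by blast
      obtain \<psi>1 where 1: "Fun \<psi>1 I Q" "app \<psi>1 i = q" "\<And>z. z \<epsilon> I \<Longrightarrow> z \<noteq> i \<Longrightarrow> app \<psi>1 z = app \<psi> z"
        using Fun_upd[OF \<psi>(1) ij(2) qr(1)] by blast
      obtain \<psi>2 where 2: "Fun \<psi>2 I Q" "app \<psi>2 j = r" "\<And>z. z \<epsilon> I \<Longrightarrow> z \<noteq> j \<Longrightarrow> app \<psi>2 z = app \<psi>1 z"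
        using Fun_upd[OF 1(1) ij(3) qr(2)] by blast
      have set_ext: "le (app \<psi> k) (app \<psi>2 k)" if "k \<epsilon> I" for k
      proof -
        consider "k = j" | "k = i" "k \<noteq> j" | "k \<noteq> i" "k \<noteq> j" by blast
        then show ?thesis using 1 2 qr ij that refl[OF m[OF that]] by cases auto
      qed
      have "le (app \<phi> k) (app \<psi>2 k)" if "k \<epsilon> I" for k
        using trans[OF app_mem[OF \<phi> that] m[OF that] app_mem[OF 2(1) that] \<psi>(2)[OF that] set_ext[OF that]] .
      moreover have "w (app \<psi>2 k) (app \<psi>2 l)" if kl: "k \<epsilon> I" "l \<epsilon> I" "k \<noteq> l" "pr k l \<epsilon> adj K p" for k l
      proof (cases "pr k l \<epsilon> K")
        case True
        show ?thesis
          by (rule opn[OF m[OF kl(1)] m[OF kl(2)] app_mem[OF 2(1) kl(1)] app_mem[OF 2(1) kl(2)]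
                \<psi>(3)[OF kl(1-3) True] set_ext[OF kl(1)] set_ext[OF kl(2)]])
      next
        case neq: False
        then have "k = i" "l = j" using kl ij by auto
        then show ?thesis using 1 2 qr ij False by simp
      qed
      ultimately show ?thesis using 2(1) by blast
    qed
  qed
  then show ?thesis unfolding pr_mem_cart by meson
qed

section \<open>Points of Cantor space\<close>

definition Cantor :: 'a where "Cantor = Sep (Pw (cart W Two)) is_real"

lemma mem_Cantor: "x \<epsilon> Cantor \<longleftrightarrow> Fun x W Two"
proof -
  have "x \<epsilon> Cantor \<longleftrightarrow> x \<epsilon> Pw (cart W Two) \<and> is_real x"
    unfolding Cantor_def by (rule mem_Sep) (intro D_intros)
  then show ?thesis using Fun_sub_cart is_real_iff by auto
qed

lemma Str_real:
  assumes "t \<epsilon> Str Two" shows "\<exists>x. x \<epsilon> Cantor \<and> t \<sqsubseteq> x"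
proof -
  note t = Str_dm(2)[OF assms]
  \<comment> \<open>The digits of \<open>t\<close>, followed by zeros.\<close>
  define F where "F k = The0 (\<lambda>v. pr k v \<epsilon> t \<or> \<not> k \<epsilon> dm t \<and> v = emp)" for k
  have FT: "FT (\<lambda>v. F (v 0))" unfolding F_def by (intro D_intros)
  have F: "F k = app t k" if "k \<epsilon> dm t" for k
    unfolding F_def using that by (intro The0_eq) (auto simp: Fun_app[OF t])
  have F': "F k = emp" if "\<not> k \<epsilon> dm t" for k
    unfolding F_def using that by (intro The0_eq) (auto simp: Fun_app[OF t])
  have F2: "F k \<epsilon> Two" for k
    using F[of k] F'[of k] app_mem[OF t] by (cases "k \<epsilon> dm t") (auto simp: mem_Two)
  obtain x where "Fun x W Two" "\<And>k. k \<epsilon> W \<Longrightarrow> app x k = F k" using lam_ex[OF FT F2] by blast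
  moreover then have "t \<sqsubseteq> x"
    using F Fun_sub_app[OF t] less_W[OF _ Str_dm(1)[OF assms]] by auto
  ultimately show ?thesis using mem_Cantor by blast
qed

text \<open>The string of the first \<open>m\<close> digits of \<open>a\<close> is extended by a
  digit that leaves \<open>a\<close>, and then to a full sequence.\<close>

lemma other_near:
  assumes "a \<epsilon> Cantor" "m \<epsilon> W" shows "\<exists>b. b \<epsilon> Cantor \<and> b \<noteq> a \<and> agree m a b"
proof -
  have a: "Fun a W Two" using assms mem_Cantor by blast
  obtain t where t: "t \<epsilon> Str Two" "restr a m \<sqsubseteq> t" "\<not> t \<sqsubseteq> a"
    using two_extensions[OF restr_Str(1)[OF a assms(2)] a] by blast
  obtain b where b: "b \<epsilon> Cantor" "t \<sqsubseteq> b" using Str_real[OF t(1)] by blast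
  have "agree m a b"
    using agree_sub[OF a _ restr_sub sub_trans[OF t(2) b(2)]] b mem_Cantor restr_Str[OF a assms(2)] by simp
  then show ?thesis using b t by blast
qed

text \<open>An approximation of level \<open>n\<close> attaches a condition to each binary string of
  length \<open>n\<close>. A level has finitely many pairs, so \<open>finite_refine\<close> can
  enforce \<open>w i\<close> on all of them. \<open>\<Phi>\<close> relates \<open>a\<close> to the
  conditions along its branch; each depends on finitely many digits of \<open>a\<close>, which is
  the last conclusion and the source of continuity.\<close>

lemma fusion:
  assumes cI: "is_countable I" and le: "D (\<lambda>v. le (v 0) (v (Suc 0)))"
    and w: "D (\<lambda>v. w (v 0) (v (Suc 0)) (v (Suc (Suc 0))))"
    and refl: "\<And>p. p \<epsilon> Q \<Longrightarrow> le p p"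
    and trans: "\<And>p q r. p \<epsilon> Q \<Longrightarrow> q \<epsilon> Q \<Longrightarrow> r \<epsilon> Q \<Longrightarrow> le p q \<Longrightarrow> le q r \<Longrightarrow> le p r"
    and p0: "p0 \<epsilon> Q"
    and dense: "\<And>i p q. i \<epsilon> I \<Longrightarrow> p \<epsilon> Q \<Longrightarrow> q \<epsilon> Q \<Longrightarrow>
      \<exists>p' q'. p' \<epsilon> Q \<and> q' \<epsilon> Q \<and> le p p' \<and> le q q' \<and> w i p' q'"
    and opn: "\<And>i p q p' q'. i \<epsilon> I \<Longrightarrow> p \<epsilon> Q \<Longrightarrow> q \<epsilon> Q \<Longrightarrow> p' \<epsilon> Q \<Longrightarrow> q' \<epsilon> Q \<Longrightarrow> w i p q \<Longrightarrow>
      le p p' \<Longrightarrow> le q q' \<Longrightarrow> w i p' q'"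
  obtains \<Phi> where "\<And>a p. pr a p \<epsilon> \<Phi> \<Longrightarrow> a \<epsilon> Cantor \<and> p \<epsilon> Q"
    "\<And>a p q. pr a p \<epsilon> \<Phi> \<Longrightarrow> pr a q \<epsilon> \<Phi> \<Longrightarrow> le p q \<or> le q p"
    "\<And>a b i. a \<epsilon> Cantor \<Longrightarrow> b \<epsilon> Cantor \<Longrightarrow> a \<noteq> b \<Longrightarrow> i \<epsilon> I \<Longrightarrow> \<exists>p q. pr a p \<epsilon> \<Phi> \<and> pr b q \<epsilon> \<Phi> \<and> w i p q"
    "\<And>a p. pr a p \<epsilon> \<Phi> \<Longrightarrow> \<exists>n. n \<epsilon> W \<and> (\<forall>b. b \<epsilon> Cantor \<and> agree n a b \<longrightarrow> pr b p \<epsilon> \<Phi>)"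
proof -
  note [D_intros] = D2[of le, OF le] D3[of w, OF w]
  define \<C> where "\<C> = Sep (cart W (Pw (cart (Str Two) Q))) (\<lambda>c. Fun (snd' c) (Lev (fst' c)) Q)"
  have C0: "c \<epsilon> \<C> \<longleftrightarrow> c \<epsilon> cart W (Pw (cart (Str Two) Q)) \<and> Fun (snd' c) (Lev (fst' c)) Q" for c
    unfolding \<C>_def by (rule mem_Sep) (intro D_intros)
  have LevStr: "Lev n \<sqsubseteq> Str Two" if "n \<epsilon> W" for n
    using that by (auto simp: is_subset_def mem_Lev mem_Str)
  have C: "pr n \<phi> \<epsilon> \<C> \<longleftrightarrow> n \<epsilon> W \<and> Fun \<phi> (Lev n) Q" for n \<phi>
    using C0[of "pr n \<phi>"] Fun_sub_cart[of \<phi> "Lev n" Q "Str Two"] LevStr[of n] by auto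
  have C_E: "\<exists>n \<phi>. c = pr n \<phi> \<and> n \<epsilon> W \<and> Fun \<phi> (Lev n) Q" if "c \<epsilon> \<C>" for c
    using that C0[of c] by (auto simp: mem_cart)
  define le' where "le' c d \<longleftrightarrow> fst' c \<sqsubseteq> fst' d \<and>
    (\<forall>\<tau>. \<tau> \<epsilon> Lev (fst' d) \<longrightarrow> le (app (snd' c) (restr \<tau> (fst' c))) (app (snd' d) \<tau>))" for c d
  \<comment> \<open>The number in the index forces arbitrarily high levels, because two points can
    be told apart only above their first difference.\<close>
  define \<delta> where "\<delta> x c \<longleftrightarrow> snd' x \<epsilon> fst' c \<and>
    (\<forall>\<sigma> \<tau>. \<sigma> \<epsilon> Lev (fst' c) \<and> \<tau> \<epsilon> Lev (fst' c) \<and> \<sigma> \<noteq> \<tau> \<longrightarrow> w (fst' x) (app (snd' c) \<sigma>) (app (snd' c) \<tau>))" for x c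
  have rL: "restr \<tau> n \<epsilon> Lev n" if "n \<epsilon> W" "m \<epsilon> W" "n \<sqsubseteq> m" "\<tau> \<epsilon> Lev m" for n m \<tau>
    using that mem_Lev Fun_restr(1) by blast
  have rr: "restr (restr x m) n = restr x n" if "n \<sqsubseteq> m" for n m x
    by (rule set_ext) (use subD[OF that] in \<open>auto simp: mem_restr\<close>)
  have rid: "restr \<tau> n = \<tau>" if "\<tau> \<epsilon> Lev n" "n \<epsilon> W" for \<tau> n
    using that(1) Str_restr_eq[of \<tau> Two \<tau> n Two] subD[OF LevStr[OF that(2)]] mem_Lev[OF that(2)] dm_Fun
    by (metis sub_refl)
  obtain G where G: "\<And>c. c \<epsilon> G \<Longrightarrow> c \<epsilon> \<C>" "\<And>c d. c \<epsilon> G \<Longrightarrow> d \<epsilon> G \<Longrightarrow> le' c d \<or> le' d c"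
    "\<And>x. x \<epsilon> cart I W \<Longrightarrow> \<exists>c. c \<epsilon> G \<and> \<delta> x c"
  proof (rule rasiowa_sikorski[OF countable_cart[OF cI countable_W], of le' \<delta> \<C> "pr emp (cart (Lev emp) (upr p0 p0))"])
    show "D (\<lambda>v. le' (v 0) (v (Suc 0)))" unfolding le'_def by (intro D_intros)
    show "D (\<lambda>v. \<delta> (v 0) (v (Suc 0)))" unfolding \<delta>_def by (intro D_intros)
    \<comment> \<open>The initial approximation is constant with value \<open>p0\<close> on level 0,
      whose only string is empty.\<close>
    have "Fun (cart (Lev emp) (upr p0 p0)) (Lev emp) Q"
      by (rule FunI) (use p0 in \<open>auto simp: mem_cart\<close>)
    then show "pr emp (cart (Lev emp) (upr p0 p0)) \<epsilon> \<C>" using C by simp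
    show "le' c c" if c: "c \<epsilon> \<C>" for c
    proof -
      obtain n \<phi> where n: "c = pr n \<phi>" "n \<epsilon> W" "Fun \<phi> (Lev n) Q" using C_E[OF c] by blast
      then show ?thesis unfolding le'_def using rid[OF _ n(2)] refl app_mem[OF n(3)] by simp
    qed
    show "le' c e" if cde: "c \<epsilon> \<C>" "d \<epsilon> \<C>" "e \<epsilon> \<C>" "le' c d" "le' d e" for c d e
    proof -
      obtain n \<phi> where n: "c = pr n \<phi>" "n \<epsilon> W" "Fun \<phi> (Lev n) Q" using C_E[OF cde(1)] by blast
      obtain m \<psi> where m: "d = pr m \<psi>" "m \<epsilon> W" "Fun \<psi> (Lev m) Q" using C_E[OF cde(2)] by blast
      obtain l \<chi> where l: "e = pr l \<chi>" "l \<epsilon> W" "Fun \<chi> (Lev l) Q" using C_E[OF cde(3)] by blast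
      have nm: "n \<sqsubseteq> m" "\<And>\<tau>. \<tau> \<epsilon> Lev m \<Longrightarrow> le (app \<phi> (restr \<tau> n)) (app \<psi> \<tau>)"
        using cde(4) unfolding le'_def n(1) m(1) by auto
      have ml: "m \<sqsubseteq> l" "\<And>\<tau>. \<tau> \<epsilon> Lev l \<Longrightarrow> le (app \<psi> (restr \<tau> m)) (app \<chi> \<tau>)"
        using cde(5) unfolding le'_def l(1) m(1) by auto
      have nl: "n \<sqsubseteq> l" using nm ml sub_trans by blast
      have "le (app \<phi> (restr \<tau> n)) (app \<chi> \<tau>)" if t: "\<tau> \<epsilon> Lev l" for \<tau>
      proof -
        have tm: "restr \<tau> m \<epsilon> Lev m" by (rule rL[OF m(2) l(2) ml(1) t])
        have tn: "restr \<tau> n \<epsilon> Lev n" by (rule rL[OF n(2) l(2) nl t])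
        show ?thesis
          using trans[OF app_mem[OF n(3) tn] app_mem[OF m(3) tm] app_mem[OF l(3) t]]
            nm(2)[OF tm] ml(2)[OF t] rr[OF nm(1)] by simp
      qed
      then show ?thesis unfolding le'_def n(1) l(1) using nl by simp
    qed
    fix x c assume x: "x \<epsilon> cart I W" and c: "c \<epsilon> \<C>"
    obtain i n where i: "x = pr i n" "i \<epsilon> I" "n \<epsilon> W" using x by (auto simp: mem_cart)
    obtain k \<phi> where k: "c = pr k \<phi>" "k \<epsilon> W" "Fun \<phi> (Lev k) Q" using C_E[OF c] by blast
    obtain m where m: "m \<epsilon> W" "k \<epsilon> m" "n \<epsilon> m" using W_upper[OF k(2) i(3)] by blast
    have km: "k \<sqsubseteq> m" using less_sub m by blast
    \<comment> \<open>The conditions are first copied unchanged from level \<open>k\<close> up to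
      level \<open>m\<close>; only then are the pairs on level \<open>m\<close> refined.\<close>
    have "FT (\<lambda>v. app \<phi> (restr (v 0) k))" by (intro D_intros)
    then obtain \<phi>1 where 1: "Fun \<phi>1 (Lev m) Q" "\<And>\<tau>. \<tau> \<epsilon> Lev m \<Longrightarrow> app \<phi>1 \<tau> = app \<phi> (restr \<tau> k)"
      using lam_ex[of "\<lambda>\<tau>. app \<phi> (restr \<tau> k)" "Lev m" Q] app_mem[OF k(3)] rL[OF k(2) m(1) km] by blast
    have Dw: "D (\<lambda>v. w i (v 0) (v (Suc 0)))" by (intro D_intros)
    have "\<exists>\<psi>. Fun \<psi> (Lev m) Q \<and> (\<forall>i. i \<epsilon> Lev m \<longrightarrow> le (app \<phi>1 i) (app \<psi> i)) \<and>
      (\<forall>j k. j \<epsilon> Lev m \<and> k \<epsilon> Lev m \<and> j \<noteq> k \<longrightarrow> w i (app \<psi> j) (app \<psi> k))"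
      by (rule finite_refine[where le = le and w = "w i" and Q = Q])
        (fact le Dw refl trans dense[OF i(2)] opn[OF i(2)] Fin_Lev[OF m(1)] 1(1))+
    then obtain \<psi> where \<psi>: "Fun \<psi> (Lev m) Q" "\<And>\<tau>. \<tau> \<epsilon> Lev m \<Longrightarrow> le (app \<phi>1 \<tau>) (app \<psi> \<tau>)"
      "\<And>\<sigma> \<tau>. \<sigma> \<epsilon> Lev m \<Longrightarrow> \<tau> \<epsilon> Lev m \<Longrightarrow> \<sigma> \<noteq> \<tau> \<Longrightarrow> w i (app \<psi> \<sigma>) (app \<psi> \<tau>)" by blast
    have "le' c (pr m \<psi>)" unfolding le'_def k(1) using km \<psi>(2) 1(2) by simp
    moreover have "\<delta> x (pr m \<psi>)" unfolding \<delta>_def i(1) using m(3) \<psi>(3) by simp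
    moreover have "pr m \<psi> \<epsilon> \<C>" using C m \<psi> by simp
    ultimately show "\<exists>d. d \<epsilon> \<C> \<and> le' c d \<and> \<delta> x d" by blast
  qed blast
  define \<Phi> where "\<Phi> = Sep (cart Cantor Q) (\<lambda>x. \<exists>c. c \<epsilon> G \<and> snd' x = app (snd' c) (restr (fst' x) (fst' c)))"
  have P0: "x \<epsilon> \<Phi> \<longleftrightarrow> x \<epsilon> cart Cantor Q \<and> (\<exists>c. c \<epsilon> G \<and> snd' x = app (snd' c) (restr (fst' x) (fst' c)))" for x
    unfolding \<Phi>_def by (rule mem_Sep) (intro D_intros)
  have GE: "\<exists>n \<phi>. c = pr n \<phi> \<and> n \<epsilon> W \<and> Fun \<phi> (Lev n) Q" if "c \<epsilon> G" for c
    using C_E G(1) that by blast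
  have RL: "restr a n \<epsilon> Lev n" if "a \<epsilon> Cantor" "n \<epsilon> W" for a n
    using that restr_Str(3) mem_Lev mem_Cantor by blast
  have P: "pr a p \<epsilon> \<Phi> \<longleftrightarrow> a \<epsilon> Cantor \<and> (\<exists>n \<phi>. pr n \<phi> \<epsilon> G \<and> p = app \<phi> (restr a n))" for a p
  proof
    assume "pr a p \<epsilon> \<Phi>"
    then obtain c where "a \<epsilon> Cantor" "c \<epsilon> G" "p = app (snd' c) (restr a (fst' c))" using P0 by auto
    moreover then obtain n \<phi> where "c = pr n \<phi>" using GE[of c] by blast
    ultimately show "a \<epsilon> Cantor \<and> (\<exists>n \<phi>. pr n \<phi> \<epsilon> G \<and> p = app \<phi> (restr a n))"
      unfolding fst'_pr snd'_pr by (metis fst'_pr snd'_pr)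
  next
    assume "a \<epsilon> Cantor \<and> (\<exists>n \<phi>. pr n \<phi> \<epsilon> G \<and> p = app \<phi> (restr a n))"
    then obtain n \<phi> where *: "a \<epsilon> Cantor" "pr n \<phi> \<epsilon> G" "p = app \<phi> (restr a n)" by blast
    then have "n \<epsilon> W" "Fun \<phi> (Lev n) Q" using GE[of "pr n \<phi>"] by auto
    then have "p \<epsilon> Q" using app_mem RL * by blast
    then show "pr a p \<epsilon> \<Phi>" using P0 * by (auto intro!: exI[of _ "pr n \<phi>"])
  qed
  show ?thesis
  proof (rule that[of \<Phi>])
    show "a \<epsilon> Cantor \<and> p \<epsilon> Q" if "pr a p \<epsilon> \<Phi>" for a p using that P0[of "pr a p"] by simp
    show "le p q \<or> le q p" if pq: "pr a p \<epsilon> \<Phi>" "pr a q \<epsilon> \<Phi>" for a p q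
    proof -
      obtain n \<phi> where n: "a \<epsilon> Cantor" "pr n \<phi> \<epsilon> G" "p = app \<phi> (restr a n)" using pq P by blast
      obtain m \<psi> where m: "pr m \<psi> \<epsilon> G" "q = app \<psi> (restr a m)" using pq P by blast
      have nm: "n \<epsilon> W" "m \<epsilon> W" using GE n m by (metis pr_inj)+
      from G(2)[OF n(2) m(1)] show ?thesis
      proof
        assume "le' (pr n \<phi>) (pr m \<psi>)"
        then show ?thesis using RL[OF n(1) nm(2)] rr n m unfolding le'_def by auto
      next
        assume "le' (pr m \<psi>) (pr n \<phi>)"
        then show ?thesis using RL[OF n(1) nm(1)] rr n m unfolding le'_def by auto
      qed
    qed
    show "\<exists>p q. pr a p \<epsilon> \<Phi> \<and> pr b q \<epsilon> \<Phi> \<and> w i p q"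
      if ab: "a \<epsilon> Cantor" "b \<epsilon> Cantor" "a \<noteq> b" "i \<epsilon> I" for a b i
    proof -
      obtain n where n: "n \<epsilon> W" "\<not> agree n a b" using not_agree ab mem_Cantor by blast
      obtain c where c: "c \<epsilon> G" "\<delta> (pr i n) c" using G(3)[of "pr i n"] n ab by auto
      obtain m \<phi> where m: "c = pr m \<phi>" "m \<epsilon> W" "Fun \<phi> (Lev m) Q" using GE[OF c(1)] by blast
      \<comment> \<open>The level is beyond a place where \<open>a\<close> and \<open>b\<close>
        differ, so the two branches pass through different strings there.\<close>
      have "n \<sqsubseteq> m" using c(2) m less_sub unfolding \<delta>_def by simp
      then have "restr a m \<noteq> restr b m" using n agree_mono agree_iff by blast
      then have "w i (app \<phi> (restr a m)) (app \<phi> (restr b m))"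
        using c(2) RL m ab unfolding \<delta>_def by simp
      then show ?thesis using P ab c m by blast
    qed
    show "\<exists>n. n \<epsilon> W \<and> (\<forall>b. b \<epsilon> Cantor \<and> agree n a b \<longrightarrow> pr b p \<epsilon> \<Phi>)" if ap: "pr a p \<epsilon> \<Phi>" for a p
    proof -
      obtain n \<phi> where n: "pr n \<phi> \<epsilon> G" "p = app \<phi> (restr a n)" using ap P by blast
      moreover have "n \<epsilon> W" using GE[OF n(1)] by auto
      ultimately show ?thesis using P unfolding agree_iff by metis
    qed
  qed
qed

definition continuous_fun :: "'a \<Rightarrow> bool" where
  "continuous_fun f \<longleftrightarrow> Fun f Cantor Cantor \<and> (\<forall>a n. a \<epsilon> Cantor \<and> n \<epsilon> W \<longrightarrow>
     (\<exists>m. m \<epsilon> W \<and> (\<forall>b. b \<epsilon> Cantor \<and> agree m a b \<longrightarrow> agree n (app f a) (app f b))))"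

text \<open>\<open>\<pi>\<close> reads off the part of the image point that a condition has already
  decided; \<open>f\<close> sends \<open>a\<close> to the union of these strings along its
  branch.\<close>

lemma fusion_fun:
  assumes cI: "is_countable I" and le: "D (\<lambda>v. le (v 0) (v (Suc 0)))"
    and w: "D (\<lambda>v. w (v 0) (v (Suc 0)) (v (Suc (Suc 0))))"
    and refl: "\<And>p. p \<epsilon> Q \<Longrightarrow> le p p"
    and trans: "\<And>p q r. p \<epsilon> Q \<Longrightarrow> q \<epsilon> Q \<Longrightarrow> r \<epsilon> Q \<Longrightarrow> le p q \<Longrightarrow> le q r \<Longrightarrow> le p r"
    and p0: "p0 \<epsilon> Q"
    and dense: "\<And>i p q. i \<epsilon> I \<Longrightarrow> p \<epsilon> Q \<Longrightarrow> q \<epsilon> Q \<Longrightarrow>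
      \<exists>p' q'. p' \<epsilon> Q \<and> q' \<epsilon> Q \<and> le p p' \<and> le q q' \<and> w i p' q'"
    and opn: "\<And>i p q p' q'. i \<epsilon> I \<Longrightarrow> p \<epsilon> Q \<Longrightarrow> q \<epsilon> Q \<Longrightarrow> p' \<epsilon> Q \<Longrightarrow> q' \<epsilon> Q \<Longrightarrow> w i p q \<Longrightarrow>
      le p p' \<Longrightarrow> le q q' \<Longrightarrow> w i p' q'"
    and \<pi>: "FT (\<lambda>v. \<pi> (v 0))" "\<And>p. p \<epsilon> Q \<Longrightarrow> \<pi> p \<epsilon> Str Two"
      "\<And>p q. p \<epsilon> Q \<Longrightarrow> q \<epsilon> Q \<Longrightarrow> le p q \<Longrightarrow> \<pi> p \<sqsubseteq> \<pi> q"
    and long: "\<And>n. n \<epsilon> W \<Longrightarrow> \<exists>i. i \<epsilon> I \<and> (\<forall>p q. p \<epsilon> Q \<and> q \<epsilon> Q \<and> w i p q \<longrightarrow> n \<epsilon> dm (\<pi> p))"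
  obtains \<Phi> f where "continuous_fun f"
    "\<And>a p. pr a p \<epsilon> \<Phi> \<Longrightarrow> a \<epsilon> Cantor \<and> p \<epsilon> Q"
    "\<And>a p q. pr a p \<epsilon> \<Phi> \<Longrightarrow> pr a q \<epsilon> \<Phi> \<Longrightarrow> le p q \<or> le q p"
    "\<And>a b i. a \<epsilon> Cantor \<Longrightarrow> b \<epsilon> Cantor \<Longrightarrow> a \<noteq> b \<Longrightarrow> i \<epsilon> I \<Longrightarrow> \<exists>p q. pr a p \<epsilon> \<Phi> \<and> pr b q \<epsilon> \<Phi> \<and> w i p q"
    "\<And>a p. pr a p \<epsilon> \<Phi> \<Longrightarrow> \<pi> p \<sqsubseteq> app f a"
proof -
  note [D_intros] = FT1[of \<pi>, OF \<pi>(1)]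
  obtain \<Phi> where \<Phi>: "\<And>a p. pr a p \<epsilon> \<Phi> \<Longrightarrow> a \<epsilon> Cantor \<and> p \<epsilon> Q"
    "\<And>a p q. pr a p \<epsilon> \<Phi> \<Longrightarrow> pr a q \<epsilon> \<Phi> \<Longrightarrow> le p q \<or> le q p"
    "\<And>a b i. a \<epsilon> Cantor \<Longrightarrow> b \<epsilon> Cantor \<Longrightarrow> a \<noteq> b \<Longrightarrow> i \<epsilon> I \<Longrightarrow> \<exists>p q. pr a p \<epsilon> \<Phi> \<and> pr b q \<epsilon> \<Phi> \<and> w i p q"
    "\<And>a p. pr a p \<epsilon> \<Phi> \<Longrightarrow> \<exists>n. n \<epsilon> W \<and> (\<forall>b. b \<epsilon> Cantor \<and> agree n a b \<longrightarrow> pr b p \<epsilon> \<Phi>)"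
    by (rule fusion[where le = le and w = w, OF cI le w refl trans p0 dense opn]) blast+
  define S where "S a = Sep (Str Two) (\<lambda>s. \<exists>p. pr a p \<epsilon> \<Phi> \<and> s = \<pi> p)" for a
  have S: "s \<epsilon> S a \<longleftrightarrow> (\<exists>p. pr a p \<epsilon> \<Phi> \<and> s = \<pi> p)" for s a
  proof -
    have "s \<epsilon> S a \<longleftrightarrow> s \<epsilon> Str Two \<and> (\<exists>p. pr a p \<epsilon> \<Phi> \<and> s = \<pi> p)"
      unfolding S_def by (rule mem_Sep) (intro D_intros)
    then show ?thesis using \<Phi>(1) \<pi>(2) by auto
  qed
  have lng: "\<exists>p. pr a p \<epsilon> \<Phi> \<and> n \<epsilon> dm (\<pi> p)" if a: "a \<epsilon> Cantor" and n: "n \<epsilon> W" for a n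
  proof -
    \<comment> \<open>Since \<open>w\<close> compares the conditions of two points, a second point
      is brought in merely to trigger the length requirement.\<close>
    obtain b where b: "b \<epsilon> Cantor" "b \<noteq> a" using other_near[OF a zero_W] by blast
    obtain i where i: "i \<epsilon> I" "\<And>p q. p \<epsilon> Q \<Longrightarrow> q \<epsilon> Q \<Longrightarrow> w i p q \<Longrightarrow> n \<epsilon> dm (\<pi> p)" using long[OF n] by blast
    obtain p q where "pr a p \<epsilon> \<Phi>" "pr b q \<epsilon> \<Phi>" "w i p q" using \<Phi>(3)[OF a b(1) _ i(1)] b by blast
    then show ?thesis using i(2) \<Phi>(1) by blast
  qed
  have real: "Uni (S a) \<epsilon> Cantor" if a: "a \<epsilon> Cantor" for a
    unfolding mem_Cantor
  proof (rule chain_Fun)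
    show "s \<epsilon> Str Two" if "s \<epsilon> S a" for s using that \<Phi>(1) \<pi>(2) unfolding S by auto
    show "s \<sqsubseteq> t \<or> t \<sqsubseteq> s" if st: "s \<epsilon> S a" "t \<epsilon> S a" for s t
    proof -
      obtain p q where pq: "pr a p \<epsilon> \<Phi>" "s = \<pi> p" "pr a q \<epsilon> \<Phi>" "t = \<pi> q" using st unfolding S by blast
      then show ?thesis using \<Phi>(2)[OF pq(1,3)] \<Phi>(1)[OF pq(1)] \<Phi>(1)[OF pq(3)] \<pi>(3) by blast
    qed
    show "\<exists>s. s \<epsilon> S a \<and> n \<epsilon> dm s" if "n \<epsilon> W" for n using lng[OF a that] S by blast
  qed
  have "FT (\<lambda>v. Uni (S (v 0)))" unfolding S_def by (intro D_intros)
  then obtain f where f: "Fun f Cantor Cantor" "\<And>a. a \<epsilon> Cantor \<Longrightarrow> app f a = Uni (S a)"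
    using lam_ex[of "\<lambda>a. Uni (S a)" Cantor Cantor] real by blast
  have sub: "\<pi> p \<sqsubseteq> app f a" if ap: "pr a p \<epsilon> \<Phi>" for a p
  proof -
    have "\<pi> p \<epsilon> S a" using ap S by blast
    then show ?thesis using sub_Uni f(2) \<Phi>(1)[OF ap] by simp
  qed
  have "continuous_fun f"
    unfolding continuous_fun_def
  proof (intro conjI allI impI, fact f(1), elim conjE)
    fix a n assume a: "a \<epsilon> Cantor" and n: "n \<epsilon> W"
    obtain p where p: "pr a p \<epsilon> \<Phi>" "n \<epsilon> dm (\<pi> p)" using lng[OF a n] by blast
    obtain m where m: "m \<epsilon> W" "\<And>b. b \<epsilon> Cantor \<Longrightarrow> agree m a b \<Longrightarrow> pr b p \<epsilon> \<Phi>" using \<Phi>(4)[OF p(1)] by blast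
    have np: "n \<sqsubseteq> dm (\<pi> p)" using less_sub p(2) Str_dm(1) \<pi>(2) \<Phi>(1)[OF p(1)] by blast
    have "agree n (app f a) (app f b)" if b: "b \<epsilon> Cantor" "agree m a b" for b
      using agree_sub[of "app f a" Two "app f b" Two "\<pi> p" n]
        app_mem[OF f(1)] mem_Cantor a b sub[OF p(1)] sub[OF m(2)[OF b]] np by blast
    then show "\<exists>m. m \<epsilon> W \<and> (\<forall>b. b \<epsilon> Cantor \<and> agree m a b \<longrightarrow> agree n (app f a) (app f b))" using m by blast
  qed
  then show ?thesis using that \<Phi> sub by blast
qed

lemma perfect_range:
  assumes f: "continuous_fun f"
    and inj: "\<And>a b. a \<epsilon> Cantor \<Longrightarrow> b \<epsilon> Cantor \<Longrightarrow> app f a = app f b \<Longrightarrow> a = b"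
  obtains P where "is_perfect P" "\<And>y. y \<epsilon> P \<longleftrightarrow> (\<exists>a. a \<epsilon> Cantor \<and> y = app f a)"
proof -
  have F: "Fun f Cantor Cantor" using f unfolding continuous_fun_def by blast
  note fm = app_mem[OF F]
  define P where "P = Sep Cantor (\<lambda>y. \<exists>a. a \<epsilon> Cantor \<and> y = app f a)"
  have P: "y \<epsilon> P \<longleftrightarrow> (\<exists>a. a \<epsilon> Cantor \<and> y = app f a)" for y
  proof -
    have "y \<epsilon> P \<longleftrightarrow> y \<epsilon> Cantor \<and> (\<exists>a. a \<epsilon> Cantor \<and> y = app f a)"
      unfolding P_def by (rule mem_Sep) (intro D_intros)
    then show ?thesis using fm by auto
  qed
  have "limit_point y P" if y: "y \<epsilon> P" for y
    unfolding limit_point_def is_nat_iff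
  proof (intro allI impI)
    fix n assume n: "n \<epsilon> W"
    obtain a where a: "a \<epsilon> Cantor" "y = app f a" using y P by blast
    obtain m where m: "m \<epsilon> W" "\<And>b. b \<epsilon> Cantor \<Longrightarrow> agree m a b \<Longrightarrow> agree n (app f a) (app f b)"
      using f a n unfolding continuous_fun_def by meson
    obtain b where b: "b \<epsilon> Cantor" "b \<noteq> a" "agree m a b" using other_near[OF a(1) m(1)] by blast
    have "app f b \<noteq> y" using inj[OF b(1) a(1)] a b by blast
    moreover have "agree n y (app f b)" using m(2)[OF b(1,3)] a by simp
    moreover have "app f b \<epsilon> P" using P b by blast
    ultimately show "\<exists>z. z \<epsilon> P \<and> z \<noteq> y \<and> agree n y z" by blast
  qed
  moreover have "y \<epsilon> P" if yR: "y \<epsilon> Cantor" and lim: "limit_point y P" for y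
  proof -
    \<comment> \<open>The strings above which some points are mapped arbitrarily close to
      \<open>y\<close>.\<close>
    define Q where "Q = Sep (Str Two) (\<lambda>s. \<forall>n. n \<epsilon> W \<longrightarrow> (\<exists>a. a \<epsilon> Cantor \<and> s \<sqsubseteq> a \<and> agree n y (app f a)))"
    have Q: "s \<epsilon> Q \<longleftrightarrow> s \<epsilon> Str Two \<and> (\<forall>n. n \<epsilon> W \<longrightarrow> (\<exists>a. a \<epsilon> Cantor \<and> s \<sqsubseteq> a \<and> agree n y (app f a)))" for s
      unfolding Q_def by (rule mem_Sep) (intro D_intros)
    \<comment> \<open>If both extensions of \<open>s\<close> failed, with precisions
      \<open>n0\<close> and \<open>n1\<close>, then a precision beyond both would already fail for
      \<open>s\<close>.\<close>
    have step: "\<exists>b. b \<epsilon> Two \<and> snoc s b \<epsilon> Q" if s: "s \<epsilon> Q" for s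
    proof (rule ccontr)
      assume neg: "\<not> ?thesis"
      have s': "s \<epsilon> Str Two" using s Q by blast
      have e: "emp \<epsilon> Two" "suc emp \<epsilon> Two" by (auto simp: mem_Two)
      have ex: "\<exists>n. n \<epsilon> W \<and> (\<forall>a. a \<epsilon> Cantor \<and> snoc s b \<sqsubseteq> a \<longrightarrow> \<not> agree n y (app f a))" if b: "b \<epsilon> Two" for b
        using neg b Q snoc_Str[OF s' b] by blast
      obtain n0 where n0: "n0 \<epsilon> W" "\<And>a. a \<epsilon> Cantor \<Longrightarrow> snoc s emp \<sqsubseteq> a \<Longrightarrow> \<not> agree n0 y (app f a)"
        using ex[OF e(1)] by blast
      obtain n1 where n1: "n1 \<epsilon> W" "\<And>a. a \<epsilon> Cantor \<Longrightarrow> snoc s (suc emp) \<sqsubseteq> a \<Longrightarrow> \<not> agree n1 y (app f a)"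
        using ex[OF e(2)] by blast
      obtain n where n: "n \<epsilon> W" "n0 \<epsilon> n" "n1 \<epsilon> n" using W_upper[OF n0(1) n1(1)] by blast
      obtain a where a: "a \<epsilon> Cantor" "s \<sqsubseteq> a" "agree n y (app f a)" using s Q n by blast
      have aF: "Fun a W Two" using a mem_Cantor by blast
      have "snoc s (app a (dm s)) \<sqsubseteq> a" by (rule snoc_sub[OF s' aF a(2)])
      moreover have "app a (dm s) \<epsilon> Two" using app_mem[OF aF] Str_dm(1)[OF s'] by blast
      moreover have "agree n0 y (app f a)" "agree n1 y (app f a)"
        using agree_mono[OF a(3)] less_sub n by blast+
      ultimately show False using n0(2)[OF a(1)] n1(2)[OF a(1)] by (auto simp: mem_Two)
    qed
    have len: "\<exists>t. t \<epsilon> Q \<and> s \<sqsubseteq> t \<and> n \<epsilon> dm t" if s: "s \<epsilon> Q" and n: "n \<epsilon> W" for s n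
      using n
    proof (induction n rule: W_induct)
      case dfn
      show ?case by (intro D_intros)
    next
      case zero
      obtain b where b: "b \<epsilon> Two" "snoc s b \<epsilon> Q" using step[OF s] by blast
      have s': "s \<epsilon> Str Two" using s Q by blast
      show ?case using b snoc_Str[OF s' b(1)] zero_less_suc Str_dm(1)[OF s'] by metis
    next
      case (suc n)
      then obtain t where t: "t \<epsilon> Q" "s \<sqsubseteq> t" "n \<epsilon> dm t" by blast
      have t': "t \<epsilon> Str Two" using t Q by blast
      obtain b where b: "b \<epsilon> Two" "snoc t b \<epsilon> Q" using step[OF t(1)] by blast
      have "suc n \<epsilon> suc (dm t)" using less_suc_iff[OF Str_dm(1)[OF t'] t(3)] .
      then show ?case using b snoc_Str[OF t' b(1)] sub_trans t by metis
    qed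
    obtain G where G: "\<And>s. s \<epsilon> G \<Longrightarrow> s \<epsilon> Q" "\<And>s t. s \<epsilon> G \<Longrightarrow> t \<epsilon> G \<Longrightarrow> s \<sqsubseteq> t \<or> t \<sqsubseteq> s"
      "\<And>n. n \<epsilon> W \<Longrightarrow> \<exists>s. s \<epsilon> G \<and> n \<epsilon> dm s"
    proof (rule rasiowa_sikorski[OF countable_W, of is_subset "\<lambda>n s. n \<epsilon> dm s" Q emp])
      show "D (\<lambda>v. v 0 \<sqsubseteq> v (Suc 0))" by (intro D_intros)
      show "D (\<lambda>v. v 0 \<epsilon> dm (v (Suc 0)))" by (intro D_intros)
      show "emp \<epsilon> Q"
      proof -
        have "\<exists>a. a \<epsilon> Cantor \<and> agree n y (app f a)" if n: "n \<epsilon> W" for n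
        proof -
          obtain z where "z \<epsilon> P" "agree n y z" using lim n unfolding limit_point_def is_nat_iff by blast
          then show ?thesis unfolding P by auto
        qed
        then show ?thesis unfolding Q by simp
      qed
      show "\<exists>t. t \<epsilon> Q \<and> s \<sqsubseteq> t \<and> n \<epsilon> dm t" if "n \<epsilon> W" "s \<epsilon> Q" for n s using len that by blast
    qed (auto intro: sub_trans)
    define a where "a = Uni G"
    have aF: "Fun a W Two" unfolding a_def by (rule chain_Fun) (use G Q in auto)
    then have a: "a \<epsilon> Cantor" using mem_Cantor by blast
    have "y = app f a"
    proof (rule ccontr)
      assume "y \<noteq> app f a"
      then obtain n where n: "n \<epsilon> W" "\<not> agree n y (app f a)" using not_agree mem_Cantor yR fm[OF a] by blast
      obtain m where m: "m \<epsilon> W" "\<And>b. b \<epsilon> Cantor \<Longrightarrow> agree m a b \<Longrightarrow> agree n (app f a) (app f b)"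
        using f a n unfolding continuous_fun_def by meson
      obtain s where s: "s \<epsilon> G" "m \<epsilon> dm s" using G(3) m by blast
      have s': "s \<epsilon> Str Two" using G Q s by blast
      obtain b where b: "b \<epsilon> Cantor" "s \<sqsubseteq> b" "agree n y (app f b)" using G(1)[OF s(1)] Q n by blast
      have "agree m a b"
        using agree_sub[OF aF _ sub_Uni[OF s(1), folded a_def] b(2)] b mem_Cantor less_sub[OF s(2) Str_dm(1)[OF s']] by blast
      then have "agree n (app f a) (app f b)" using m b by blast
      then show False using n b agree_sym agree_trans by blast
    qed
    then show ?thesis using P a by blast
  qed
  moreover have "set_of_reals P" unfolding set_of_reals_def is_real_iff using P fm mem_Cantor by auto
  ultimately have "is_perfect P" unfolding is_perfect_def is_real_iff mem_Cantor by blast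
  then show ?thesis using that P by blast
qed

text \<open>Smallness puts every pair in the projection of \<open>C\<close> outside one of countably
  many dense open sets; the fusion puts the pair of values at any two distinct points inside all of
  them.\<close>

lemma inequivalent_continuous_fun:
  assumes C: "closed3 C" and sm: "small C emp emp emp"
  obtains f where "continuous_fun f"
    "\<And>a b z. a \<epsilon> Cantor \<Longrightarrow> b \<epsilon> Cantor \<Longrightarrow> a \<noteq> b \<Longrightarrow> \<not> pr (pr (app f a) (app f b)) z \<epsilon> C"
proof -
  let ?P = "cart (Str Two) (Str Two)"
  obtain F where F: "is_countable F" "covers C F emp emp emp" using sm unfolding small_def by blast
  \<comment> \<open>Members that are not dense could not be met and are dropped. The set of all
    boxes is added so that an index for forcing length exists even if nothing else is left.\<close>
  define F' where "F' = Sep (adj F ?P) densep"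
  have F': "d \<epsilon> F' \<longleftrightarrow> (d \<epsilon> F \<or> d = ?P) \<and> densep d" for d
    unfolding F'_def by (subst mem_Sep) (intro D_intros, simp)
  have "is_countable (cup F (upr ?P ?P))" using countable_cup F countable_upr by blast
  then have cF': "is_countable F'" by (rule countable_sub) (auto simp: is_subset_def F')
  have "densep ?P" unfolding densep_def pr_mem_cart using sub_refl by blast
  then have dP: "?P \<epsilon> F'" unfolding F' by blast
  define w where "w i p q \<longleftrightarrow> (\<exists>s t. pr s t \<epsilon> fst' i \<and> s \<sqsubseteq> p \<and> t \<sqsubseteq> q) \<and> snd' i \<epsilon> dm p" for i p q
  have e2: "emp \<epsilon> Two" by (simp add: mem_Two)
  obtain \<Phi> f where f: "continuous_fun f"
    and \<Phi>: "\<And>a p. pr a p \<epsilon> \<Phi> \<Longrightarrow> a \<epsilon> Cantor \<and> p \<epsilon> Str Two"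
    "\<And>a b i. a \<epsilon> Cantor \<Longrightarrow> b \<epsilon> Cantor \<Longrightarrow> a \<noteq> b \<Longrightarrow> i \<epsilon> cart F' W \<Longrightarrow> \<exists>p q. pr a p \<epsilon> \<Phi> \<and> pr b q \<epsilon> \<Phi> \<and> w i p q"
    "\<And>a p. pr a p \<epsilon> \<Phi> \<Longrightarrow> p \<sqsubseteq> app f a"
  proof (rule fusion_fun[OF countable_cart[OF cF' countable_W], of is_subset w "Str Two" emp "\<lambda>p. p"])
    show "D (\<lambda>v. v 0 \<sqsubseteq> v (Suc 0))" by (intro D_intros)
    show "D (\<lambda>v. w (v 0) (v (Suc 0)) (v (Suc (Suc 0))))" unfolding w_def by (intro D_intros)
    show "FT (\<lambda>v. v 0)" by (intro D_intros)
    fix i p q assume i: "i \<epsilon> cart F' W" and pq: "p \<epsilon> Str Two" "q \<epsilon> Str Two"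
    obtain d n where dn: "i = pr d n" "d \<epsilon> F'" "n \<epsilon> W" using i by (auto simp: mem_cart)
    obtain s t where st: "s \<epsilon> Str Two" "t \<epsilon> Str Two" "p \<sqsubseteq> s" "q \<sqsubseteq> t" "pr s t \<epsilon> d"
      using dn(2) pq unfolding F' densep_def by blast
    obtain s' where s': "s' \<epsilon> Str Two" "s \<sqsubseteq> s'" "n \<epsilon> dm s'" using Str_lengthen[OF st(1) e2 dn(3)] by blast
    have "w i s' t" unfolding w_def dn(1) fst'_pr snd'_pr using st s' sub_refl by blast
    then show "\<exists>p' q'. p' \<epsilon> Str Two \<and> q' \<epsilon> Str Two \<and> p \<sqsubseteq> p' \<and> q \<sqsubseteq> q' \<and> w i p' q'"
      using st s' sub_trans by blast
  next
    fix i p q p' q' assume "w i p q" "p \<sqsubseteq> p'" "q \<sqsubseteq> q'"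
    then show "w i p' q'" unfolding w_def using sub_trans sub_dm subD by meson
  next
    fix n assume "n \<epsilon> W"
    then show "\<exists>i. i \<epsilon> cart F' W \<and> (\<forall>p q. p \<epsilon> Str Two \<and> q \<epsilon> Str Two \<and> w i p q \<longrightarrow> n \<epsilon> dm p)"
      using dP by (intro exI[of _ "pr ?P n"]) (simp add: w_def)
  qed (auto intro: sub_trans)
  have "\<not> pr (pr (app f a) (app f b)) z \<epsilon> C" if ab: "a \<epsilon> Cantor" "b \<epsilon> Cantor" "a \<noteq> b" for a b z
  proof
    assume "pr (pr (app f a) (app f b)) z \<epsilon> C"
    then obtain d where d: "d \<epsilon> F" "densep d" "avoids d (app f a) (app f b)"
      using F(2) unfolding covers_def by (meson emp_sub)
    then have "pr d emp \<epsilon> cart F' W" unfolding pr_mem_cart F' by simp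
    from \<Phi>(2)[OF ab this] obtain p q where "pr a p \<epsilon> \<Phi>" "pr b q \<epsilon> \<Phi>" "w (pr d emp) p q" by blast
    then show False using d(3) \<Phi>(3) sub_trans unfolding w_def avoids_def fst'_pr by meson
  qed
  then show ?thesis using that f by blast
qed

end

section \<open>The perfect set property\<close>

context ZF_DC
begin

text \<open>The perfect set theorem for analytic sets by condensation: only codes of boxes with
  uncountable projection are kept, and a fusion through them separates first coordinates while the
  witnesses converge along with them.\<close>

lemma projection_perfect_subset:
  assumes K: "closed3 K" and A: "\<And>a. a \<epsilon> A \<longleftrightarrow> (\<exists>x z. pr (pr a x) z \<epsilon> K)" and unc: "\<not> is_countable A"
  shows "\<exists>P. is_perfect P \<and> \<not> is_empty P \<and> P \<sqsubseteq> A"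
proof -
  \<comment> \<open>Codes of basic boxes in the product of two Cantor spaces and Baire space; there
    are countably many.\<close>
  define Cd where "Cd = cart (Str Two) (cart (Str Two) (Str W))"
  have cCd: "is_countable Cd" unfolding Cd_def by (intro countable_cart countable_Str2 countable_StrW)
  have Cd: "pr r (pr s u) \<epsilon> Cd \<longleftrightarrow> r \<epsilon> Str Two \<and> s \<epsilon> Str Two \<and> u \<epsilon> Str W" for r s u
    by (simp add: Cd_def)
  have Cd_E: "\<exists>r s u. p = pr r (pr s u) \<and> r \<epsilon> Str Two \<and> s \<epsilon> Str Two \<and> u \<epsilon> Str W" if "p \<epsilon> Cd" for p
    using that by (auto simp: Cd_def mem_cart)
  define inb where "inb p a x z \<longleftrightarrow> fst' p \<sqsubseteq> a \<and> fst' (snd' p) \<sqsubseteq> x \<and> snd' (snd' p) \<sqsubseteq> z" for p a x z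
  define le where "le p q \<longleftrightarrow> inb p (fst' q) (fst' (snd' q)) (snd' (snd' q))" for p q
  define AA where "AA p = Sep A (\<lambda>a. \<exists>x z. pr (pr a x) z \<epsilon> K \<and> inb p a x z)" for p
  have AA: "a \<epsilon> AA p \<longleftrightarrow> (\<exists>x z. pr (pr a x) z \<epsilon> K \<and> inb p a x z)" for a p
  proof -
    have "a \<epsilon> AA p \<longleftrightarrow> a \<epsilon> A \<and> (\<exists>x z. pr (pr a x) z \<epsilon> K \<and> inb p a x z)"
      unfolding AA_def by (rule mem_Sep) (unfold inb_def, intro D_intros)
    then show ?thesis using A by blast
  qed
  have FT_AA[D_intros]: "FT (\<lambda>v. AA (s v))" if "FT s" for s
    by (rule FT1[of AA, OF _ that]) (unfold AA_def inb_def, intro D_intros)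
  define Q where "Q = Sep Cd (\<lambda>p. \<not> is_countable (AA p))"
  have Q: "p \<epsilon> Q \<longleftrightarrow> p \<epsilon> Cd \<and> \<not> is_countable (AA p)" for p
    unfolding Q_def by (rule mem_Sep) (intro D_intros)
  have D_le[D_intros]: "D (\<lambda>v. le (s v) (t v))" if "FT s" "FT t" for s t
    by (rule D2[of le, OF _ that]) (unfold le_def inb_def, intro D_intros)
  have KD: "Fun a W Two" "Fun x W Two" "Fun z W W" if "pr (pr a x) z \<epsilon> K" for a x z
    using closed3_D[OF K that] .
  define box where "box a x z m = pr (restr a m) (pr (restr x m) (restr z m))" for a x z m
  have box: "box a x z m \<epsilon> Cd" "inb (box a x z m) a x z" if "pr (pr a x) z \<epsilon> K" "m \<epsilon> W" for a x z m
    unfolding box_def Cd inb_def using KD[OF that(1)] restr_Str(1)[OF _ that(2)] restr_sub by auto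
  \<comment> \<open>Otherwise every point of \<open>AA p\<close> except possibly \<open>e\<close>
    lies in one of countably many countable sets \<open>AA q\<close>. Excluding a prescribed
    \<open>e\<close> later allows two different points to be chosen.\<close>
  have kernel: "\<exists>a x z. a \<noteq> e \<and> pr (pr a x) z \<epsilon> K \<and> inb p a x z \<and>
    (\<forall>q. q \<epsilon> Cd \<and> inb q a x z \<longrightarrow> q \<epsilon> Q)" if p: "p \<epsilon> Q" for p e
  proof (rule ccontr)
    assume neg: "\<not> ?thesis"
    define N where "N = Sep Cd (\<lambda>q. is_countable (AA q))"
    have N: "q \<epsilon> N \<longleftrightarrow> q \<epsilon> Cd \<and> is_countable (AA q)" for q
      unfolding N_def by (rule mem_Sep) (intro D_intros)
    define A' where "A' = Sep (AA p) (\<lambda>a. a \<noteq> e)"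
    have A': "a \<epsilon> A' \<longleftrightarrow> a \<epsilon> AA p \<and> a \<noteq> e" for a
      unfolding A'_def by (rule mem_Sep) (intro D_intros)
    have "is_countable A'"
    proof (rule countable_UN[of N "\<lambda>q a. a \<epsilon> AA q"])
      show "is_countable N" by (rule countable_sub[OF cCd]) (auto simp: is_subset_def N)
      show "D (\<lambda>v. v (Suc 0) \<epsilon> AA (v 0))" by (intro D_intros)
      show "\<exists>q. q \<epsilon> N \<and> a \<epsilon> AA q" if a: "a \<epsilon> A'" for a
      proof -
        obtain x z where xz: "pr (pr a x) z \<epsilon> K" "inb p a x z" "a \<noteq> e" using a A' AA by blast
        then obtain q where "q \<epsilon> Cd" "inb q a x z" "\<not> q \<epsilon> Q" using neg by blast
        then show ?thesis using N Q AA xz by blast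
      qed
      show "\<exists>Y. is_countable Y \<and> (\<forall>a. a \<epsilon> A' \<and> a \<epsilon> AA q \<longrightarrow> a \<epsilon> Y)" if "q \<epsilon> N" for q
        using that unfolding N by (intro exI[of _ "AA q"]) simp
    qed
    from countable_cup[OF this countable_upr] have "is_countable (cup A' (upr e e))" .
    then have "is_countable (AA p)" by (rule countable_sub) (auto simp: is_subset_def A')
    then show False using p Q by blast
  qed
  have box_le: "le p (box a x z m)"
    if p: "p \<epsilon> Cd" and "inb p a x z" "dm (fst' p) \<sqsubseteq> m" "dm (fst' (snd' p)) \<sqsubseteq> m" "dm (snd' (snd' p)) \<sqsubseteq> m"
    for p a x z m
  proof -
    obtain r s u where "p = pr r (pr s u)" "r \<epsilon> Str Two" "s \<epsilon> Str Two" "u \<epsilon> Str W" using Cd_E[OF p] by blast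
    then show ?thesis using that Str_sub_restr unfolding le_def box_def inb_def by auto
  qed
  \<comment> \<open>Incomparable first coordinates will make \<open>f\<close> injective; the length
    conditions make all three coordinates converge.\<close>
  define w where "w n p q \<longleftrightarrow> \<not> fst' p \<sqsubseteq> fst' q \<and> \<not> fst' q \<sqsubseteq> fst' p \<and>
    n \<epsilon> dm (fst' p) \<and> n \<epsilon> dm (fst' (snd' p)) \<and> n \<epsilon> dm (snd' (snd' p))" for n p q
  have leD: "fst' p \<sqsubseteq> fst' q" "fst' (snd' p) \<sqsubseteq> fst' (snd' q)" "snd' (snd' p) \<sqsubseteq> snd' (snd' q)"
    if "le p q" for p q
    using that unfolding le_def inb_def by auto
  have large: "\<exists>m. m \<epsilon> W \<and> n \<epsilon> m \<and> dm (fst' p) \<sqsubseteq> m \<and> dm (fst' (snd' p)) \<sqsubseteq> m \<and> dm (snd' (snd' p)) \<sqsubseteq> m"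
    if p: "p \<epsilon> Cd" and n: "n \<epsilon> W" for p n
  proof -
    obtain r s u where rsu: "p = pr r (pr s u)" "r \<epsilon> Str Two" "s \<epsilon> Str Two" "u \<epsilon> Str W" using Cd_E p by blast
    obtain m1 where m1: "m1 \<epsilon> W" "n \<epsilon> m1" "dm r \<epsilon> m1" using W_upper[OF n Str_dm(1)[OF rsu(2)]] by blast
    obtain m2 where m2: "m2 \<epsilon> W" "m1 \<epsilon> m2" "dm s \<epsilon> m2" using W_upper[OF m1(1) Str_dm(1)[OF rsu(3)]] by blast
    obtain m3 where m3: "m3 \<epsilon> W" "m2 \<epsilon> m3" "dm u \<epsilon> m3" using W_upper[OF m2(1) Str_dm(1)[OF rsu(4)]] by blast
    have "m1 \<epsilon> m3" using less_trans[OF m2(2) m3(2,1)] .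
    then have "n \<epsilon> m3" "dm r \<epsilon> m3" "dm s \<epsilon> m3"
      using less_trans[OF _ _ m3(1)] m1 m2 m3 by blast+
    then show ?thesis using less_sub[OF _ m3(1)] m3 unfolding rsu(1) by auto
  qed
  obtain \<Phi> f where f: "continuous_fun f"
    and \<Phi>: "\<And>a p. pr a p \<epsilon> \<Phi> \<Longrightarrow> a \<epsilon> Cantor \<and> p \<epsilon> Q"
    "\<And>a p q. pr a p \<epsilon> \<Phi> \<Longrightarrow> pr a q \<epsilon> \<Phi> \<Longrightarrow> le p q \<or> le q p"
    "\<And>a b n. a \<epsilon> Cantor \<Longrightarrow> b \<epsilon> Cantor \<Longrightarrow> a \<noteq> b \<Longrightarrow> n \<epsilon> W \<Longrightarrow> \<exists>p q. pr a p \<epsilon> \<Phi> \<and> pr b q \<epsilon> \<Phi> \<and> w n p q"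
    "\<And>a p. pr a p \<epsilon> \<Phi> \<Longrightarrow> fst' p \<sqsubseteq> app f a"
  proof (rule fusion_fun[OF countable_W, of le w Q "pr emp (pr emp emp)" fst'])
    show "D (\<lambda>v. le (v 0) (v (Suc 0)))" by (intro D_intros)
    show "D (\<lambda>v. w (v 0) (v (Suc 0)) (v (Suc (Suc 0))))" unfolding w_def by (intro D_intros)
    show "FT (\<lambda>v. fst' (v 0))" by (intro D_intros)
    show "le p p" for p unfolding le_def inb_def by simp
    show "le p r" if "le p q" "le q r" for p q r
      using leD[OF that(1)] leD[OF that(2)] sub_trans unfolding le_def inb_def by blast
    have "AA (pr emp (pr emp emp)) = A" by (rule set_ext) (simp add: AA A inb_def)
    then show "pr emp (pr emp emp) \<epsilon> Q" using unc Q Cd by simp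
    show "fst' p \<epsilon> Str Two" if "p \<epsilon> Q" for p using that Q Cd_E by fastforce
    show "fst' p \<sqsubseteq> fst' q" if "le p q" for p q using leD(1)[OF that] .
    show "\<exists>i. i \<epsilon> W \<and> (\<forall>p q. p \<epsilon> Q \<and> q \<epsilon> Q \<and> w i p q \<longrightarrow> n \<epsilon> dm (fst' p))" if "n \<epsilon> W" for n
      using that unfolding w_def by blast
  next
    fix n p q assume n: "n \<epsilon> W" and p: "p \<epsilon> Q" and q: "q \<epsilon> Q"
    \<comment> \<open>Here \<open>emp\<close> is a dummy. The point for \<open>q\<close> is taken
      next, and it is required to differ from \<open>a\<close>.\<close>
    obtain a x z where axz: "pr (pr a x) z \<epsilon> K" "inb p a x z" "\<And>q. q \<epsilon> Cd \<Longrightarrow> inb q a x z \<Longrightarrow> q \<epsilon> Q"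
      using kernel[OF p, of emp] by blast
    obtain b x' z' where b: "b \<noteq> a" "pr (pr b x') z' \<epsilon> K" "inb q b x' z'"
      "\<And>q. q \<epsilon> Cd \<Longrightarrow> inb q b x' z' \<Longrightarrow> q \<epsilon> Q"
      using kernel[OF q, of a] by blast
    note Fa = KD[OF axz(1)] and Fb = KD[OF b(2)]
    obtain k where k: "k \<epsilon> W" "\<not> agree k a b" using not_agree[OF Fa(1) Fb(1)] b(1) by blast
    have pC: "p \<epsilon> Cd" and qC: "q \<epsilon> Cd" using p q Q by auto
    obtain m1 where m1: "m1 \<epsilon> W" "n \<epsilon> m1" "dm (fst' p) \<sqsubseteq> m1" "dm (fst' (snd' p)) \<sqsubseteq> m1" "dm (snd' (snd' p)) \<sqsubseteq> m1"
      using large[OF pC n] by blast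
    obtain m2 where m2: "m2 \<epsilon> W" "k \<epsilon> m2" "dm (fst' q) \<sqsubseteq> m2" "dm (fst' (snd' q)) \<sqsubseteq> m2" "dm (snd' (snd' q)) \<sqsubseteq> m2"
      using large[OF qC k(1)] by blast
    obtain m where m: "m \<epsilon> W" "m1 \<epsilon> m" "m2 \<epsilon> m" using W_upper m1 m2 by blast
    have sub: "m1 \<sqsubseteq> m" "m2 \<sqsubseteq> m" using less_sub m by auto
    have km: "k \<sqsubseteq> m" using less_sub[OF m2(2,1)] sub sub_trans by blast
    have nm: "n \<epsilon> m" using subD sub m1 by blast
    have dmr: "dm (restr y m) = m" if "Fun y W B" for y B using restr_Str(2)[OF that m(1)] .
    have nagr: "\<not> agree m a b" using k km agree_mono by blast
    have 1: "\<not> restr a m \<sqsubseteq> restr b m"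
      using agree_sub[OF Fa(1) Fb(1) restr_sub, of m m] sub_trans[OF _ restr_sub] dmr[OF Fa(1)] nagr by auto
    have 2: "\<not> restr b m \<sqsubseteq> restr a m"
      using agree_sub[OF Fb(1) Fa(1) restr_sub, of m m] sub_trans[OF _ restr_sub] dmr[OF Fb(1)] nagr agree_sym by auto
    have "w n (box a x z m) (box b x' z' m)" unfolding w_def box_def
      using 1 2 nm dmr[OF Fa(1)] dmr[OF Fa(2)] dmr[OF Fa(3)] by simp
    moreover have "le p (box a x z m)" using box_le[OF pC axz(2)] m1 sub sub_trans by blast
    moreover have "le q (box b x' z' m)" using box_le[OF qC b(3)] m2 sub sub_trans by blast
    moreover have "box a x z m \<epsilon> Q" using axz(3) box[OF axz(1) m(1)] by blast
    moreover have "box b x' z' m \<epsilon> Q" using b(4) box[OF b(2) m(1)] by blast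
    ultimately show "\<exists>p' q'. p' \<epsilon> Q \<and> q' \<epsilon> Q \<and> le p p' \<and> le q q' \<and> w n p' q'" by blast
  next
    fix n p q p' q'
    assume pq: "p \<epsilon> Q" "q \<epsilon> Q" "p' \<epsilon> Q" "q' \<epsilon> Q" and w: "w n p q" and le: "le p p'" "le q q'"
    have str: "fst' r \<epsilon> Str Two" if "r \<epsilon> Q" for r using that Q Cd_E by fastforce
    have cmp: "fst' p \<sqsubseteq> fst' q \<or> fst' q \<sqsubseteq> fst' p" if "fst' p \<sqsubseteq> y" "fst' q \<sqsubseteq> y" "y \<epsilon> Str Two" for y
      by (rule Str_comparable[OF str[OF pq(1)] str[OF pq(2)] Str_dm(2)[OF that(3)] that(1,2)])
    have "\<not> fst' p' \<sqsubseteq> fst' q'" "\<not> fst' q' \<sqsubseteq> fst' p'"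
      using cmp[OF _ _ str[OF pq(3)]] cmp[OF _ _ str[OF pq(4)]] w leD(1)[OF le(1)] leD(1)[OF le(2)] sub_trans
      unfolding w_def by blast+
    then show "w n p' q'" using w leD[OF le(1)] sub_dm subD unfolding w_def by meson
  qed blast
  have F: "Fun f Cantor Cantor" using f unfolding continuous_fun_def by blast
  have inj: "a = b" if ab: "a \<epsilon> Cantor" "b \<epsilon> Cantor" "app f a = app f b" for a b
  proof (rule ccontr)
    assume "a \<noteq> b"
    then obtain p q where pq: "pr a p \<epsilon> \<Phi>" "pr b q \<epsilon> \<Phi>" "w emp p q" using \<Phi>(3) ab by (meson zero_W)
    have "fst' p \<epsilon> Str Two" "fst' q \<epsilon> Str Two" using \<Phi>(1)[OF pq(1)] \<Phi>(1)[OF pq(2)] Q Cd_E by fastforce+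
    then have "fst' p \<sqsubseteq> fst' q \<or> fst' q \<sqsubseteq> fst' p"
      using Str_comparable[of "fst' p" Two "fst' q" "app f a" W Two] \<Phi>(4)[OF pq(1)] \<Phi>(4)[OF pq(2)]
        app_mem[OF F ab(1)] mem_Cantor ab(3) by simp
    then show False using pq(3) unfolding w_def by blast
  qed
  obtain P where P: "is_perfect P" "\<And>y. y \<epsilon> P \<longleftrightarrow> (\<exists>a. a \<epsilon> Cantor \<and> y = app f a)"
    using perfect_range[OF f inj] by blast
  obtain a0 where a0: "a0 \<epsilon> Cantor" using Str_real[OF emp_Str] by blast
  have "P \<noteq> emp" using P(2)[of "app f a0"] a0 mem_emp by blast
  moreover have "P \<sqsubseteq> A"
  proof (rule subI)
    fix y assume "y \<epsilon> P"
    then obtain a where a: "a \<epsilon> Cantor" "y = app f a" unfolding P(2) by blast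
    have y: "Fun y W Two" using app_mem[OF F a(1)] a mem_Cantor by simp
    obtain b where b: "b \<epsilon> Cantor" "b \<noteq> a" using other_near[OF a(1) zero_W] by blast
    have lng: "\<exists>p. pr a p \<epsilon> \<Phi> \<and> n \<epsilon> dm (fst' p) \<and> n \<epsilon> dm (fst' (snd' p)) \<and> n \<epsilon> dm (snd' (snd' p))"
      if "n \<epsilon> W" for n using \<Phi>(3)[OF a(1) b(1) _ that] b unfolding w_def by blast
    have str: "\<exists>r s u. p = pr r (pr s u) \<and> r \<epsilon> Str Two \<and> s \<epsilon> Str Two \<and> u \<epsilon> Str W \<and> p \<epsilon> Q"
      if "pr a p \<epsilon> \<Phi>" for p using \<Phi>(1)[OF that] Q Cd_E by blast
    define S where "S = Sep (Str Two) (\<lambda>s. \<exists>p. pr a p \<epsilon> \<Phi> \<and> s = fst' (snd' p))"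
    have S: "s \<epsilon> S \<longleftrightarrow> s \<epsilon> Str Two \<and> (\<exists>p. pr a p \<epsilon> \<Phi> \<and> s = fst' (snd' p))" for s
      unfolding S_def by (rule mem_Sep) (intro D_intros)
    define U where "U = Sep (Str W) (\<lambda>s. \<exists>p. pr a p \<epsilon> \<Phi> \<and> s = snd' (snd' p))"
    have U: "s \<epsilon> U \<longleftrightarrow> s \<epsilon> Str W \<and> (\<exists>p. pr a p \<epsilon> \<Phi> \<and> s = snd' (snd' p))" for s
      unfolding U_def by (rule mem_Sep) (intro D_intros)
    have SU: "fst' (snd' p) \<epsilon> S" "snd' (snd' p) \<epsilon> U" if "pr a p \<epsilon> \<Phi>" for p
      using str[OF that] that S U by auto
    have x: "Fun (Uni S) W Two"
    proof (rule chain_Fun)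
      show "s \<sqsubseteq> t \<or> t \<sqsubseteq> s" if "s \<epsilon> S" "t \<epsilon> S" for s t using that \<Phi>(2) leD(2) unfolding S by blast
      show "\<exists>s. s \<epsilon> S \<and> n \<epsilon> dm s" if "n \<epsilon> W" for n using lng[OF that] SU by blast
    qed (use S in auto)
    have z: "Fun (Uni U) W W"
    proof (rule chain_Fun)
      show "s \<sqsubseteq> t \<or> t \<sqsubseteq> s" if "s \<epsilon> U" "t \<epsilon> U" for s t using that \<Phi>(2) leD(3) unfolding U by blast
      show "\<exists>s. s \<epsilon> U \<and> n \<epsilon> dm s" if "n \<epsilon> W" for n using lng[OF that] SU by blast
    qed (use U in auto)
    have "pr (pr y (Uni S)) (Uni U) \<epsilon> K"
    proof (rule closed3_closed[OF K y x z])
      fix n assume n: "n \<epsilon> W"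
      obtain p where p: "pr a p \<epsilon> \<Phi>" "n \<epsilon> dm (fst' p)" "n \<epsilon> dm (fst' (snd' p))" "n \<epsilon> dm (snd' (snd' p))"
        using lng[OF n] by blast
      obtain r s u where rsu: "p = pr r (pr s u)" "r \<epsilon> Str Two" "s \<epsilon> Str Two" "u \<epsilon> Str W" "p \<epsilon> Q"
        using str[OF p(1)] by blast
      \<comment> \<open>An uncountable set is nonempty, so the box of \<open>p\<close> contains a
        point of \<open>K\<close> that is close to the limit.\<close>
      have "\<exists>a'. a' \<epsilon> AA p"
      proof (rule ccontr)
        assume "\<not> ?thesis"
        then have "AA p = emp" by (intro set_ext) auto
        then show False using rsu(5) Q countable_emp by simp
      qed
      then obtain a' x' z' where K': "pr (pr a' x') z' \<epsilon> K" "inb p a' x' z'" using AA by blast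
      have "agree n y a'"
        using agree_sub[OF y KD(1)[OF K'(1)], of r n] \<Phi>(4)[OF p(1)] K'(2) a p rsu less_sub Str_dm(1)
        unfolding inb_def by simp
      moreover have "agree n (Uni S) x'"
        using agree_sub[OF x KD(2)[OF K'(1)], of s n] sub_Uni[OF SU(1)[OF p(1)]] K'(2) p rsu less_sub Str_dm(1)
        unfolding inb_def by simp
      moreover have "agree n (Uni U) z'"
        using agree_sub[OF z KD(3)[OF K'(1)], of u n] sub_Uni[OF SU(2)[OF p(1)]] K'(2) p rsu less_sub Str_dm(1)
        unfolding inb_def by simp
      ultimately show "\<exists>a' x' z'. pr (pr a' x') z' \<epsilon> K \<and> agree n y a' \<and> agree n (Uni S) x' \<and> agree n (Uni U) z'"
        using K'(1) by blast
    qed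
    then show "y \<epsilon> A" using A by blast
  qed
  ultimately show ?thesis using P by auto
qed

text \<open>Limits are preserved because \<open>P\<close> is closed and \<open>f\<close> is
  continuous. The coordinate \<open>a\<close> comes first so that
  \<open>projection_perfect_subset\<close> projects onto it.\<close>

lemma closed3_pullback:
  assumes C: "closed3 C" and P: "is_perfect P" and f: "continuous_fun f"
    and K: "\<And>q. q \<epsilon> K \<longleftrightarrow> (\<exists>a x z. q = pr (pr a x) z \<and> a \<epsilon> Cantor \<and> x \<epsilon> P \<and> pr (pr x (app f a)) z \<epsilon> C)"
  shows "closed3 K"
proof -
  have KI: "pr (pr a x) z \<epsilon> K \<longleftrightarrow> a \<epsilon> Cantor \<and> x \<epsilon> P \<and> pr (pr x (app f a)) z \<epsilon> C" for a x z
    using K by auto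
  have F: "Fun f Cantor Cantor" using f unfolding continuous_fun_def by blast
  have cl: "pr (pr a x) z \<epsilon> K" if a: "Fun a W Two" and x: "Fun x W Two" and z: "Fun z W W"
    and lim: "\<And>n. n \<epsilon> W \<Longrightarrow> \<exists>a' x' z'. pr (pr a' x') z' \<epsilon> K \<and> agree n a a' \<and> agree n x x' \<and> agree n z z'"
    for a x z
    unfolding KI
  proof (intro conjI)
    show aR: "a \<epsilon> Cantor" using a mem_Cantor by blast
    show "x \<epsilon> P" using perfect_closed[OF P x] lim unfolding KI by blast
    have fa: "Fun (app f a) W Two" using app_mem[OF F aR] mem_Cantor by blast
    show "pr (pr x (app f a)) z \<epsilon> C"
    proof (rule closed3_closed[OF C x fa z])
      fix n assume n: "n \<epsilon> W"
      obtain m where m: "m \<epsilon> W" "\<And>b. b \<epsilon> Cantor \<Longrightarrow> agree m a b \<Longrightarrow> agree n (app f a) (app f b)"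
        using f aR n unfolding continuous_fun_def by meson
      obtain k where k: "k \<epsilon> W" "m \<epsilon> k" "n \<epsilon> k" using W_upper[OF m(1) n] by blast
      obtain a' x' z' where *: "pr (pr a' x') z' \<epsilon> K" "agree k a a'" "agree k x x'" "agree k z z'"
        using lim[OF k(1)] by blast
      have sub: "m \<sqsubseteq> k" "n \<sqsubseteq> k" using less_sub k by auto
      have "agree n (app f a) (app f a')" using m(2) *(1) agree_mono[OF *(2) sub(1)] unfolding KI by blast
      then show "\<exists>x' y' z'. pr (pr x' y') z' \<epsilon> C \<and> agree n x x' \<and> agree n (app f a) y' \<and> agree n z z'"
        using * agree_mono[OF _ sub(2)] unfolding KI by blast
    qed
  qed
  have sh: "\<exists>x y z p. Fun x W Two \<and> Fun y W Two \<and> Fun z W W \<and> p = pr x y \<and> q = pr p z" if q: "q \<epsilon> K" for q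
  proof -
    obtain a x z where *: "q = pr (pr a x) z" "a \<epsilon> Cantor" "pr (pr x (app f a)) z \<epsilon> C" using q K by blast
    then show ?thesis using closed3_D(1,3)[OF C *(3)] mem_Cantor by blast
  qed
  show ?thesis
    unfolding closed3_def is_real_iff is_baire_iff is_nat_iff rel3_iff is_pair_iff
    using sh cl by blast
qed

text \<open>\<open>f\<close> meets every class at most once, so \<open>A\<close> can be recovered
  from the saturation of its image. This is how an invariant set encodes an arbitrary one.\<close>

lemma perfect_set_property_of_invariant:
  assumes eqv: "is_equivalence E" and ana: "is_analytic E" and cls: "countable_classes E"
    and inv: "\<forall>A. set_of_reals A \<and> invariant E A \<longrightarrow> perfect_set_property A"
    and A: "set_of_reals A"
  shows "perfect_set_property A"
proof -
  have E_real: "Fun x W Two" "Fun y W Two" if "pr x y \<epsilon> E" for x y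
    using eqv that unfolding is_equivalence_def is_real_iff is_pair_iff by (metis pr_inj)+
  have E_refl: "pr x x \<epsilon> E" if "Fun x W Two" for x
    using eqv that unfolding is_equivalence_def is_real_iff rel_iff by blast
  have E_sym: "pr y x \<epsilon> E" if "pr x y \<epsilon> E" for x y
    using eqv that unfolding is_equivalence_def rel_iff by blast
  have E_trans: "pr x z \<epsilon> E" if "pr x y \<epsilon> E" "pr y z \<epsilon> E" for x y z
    using eqv that unfolding is_equivalence_def rel_iff by blast
  have E_cls: "\<exists>c. (\<forall>y. y \<epsilon> c \<longleftrightarrow> pr x y \<epsilon> E) \<and> is_countable c" if "Fun x W Two" for x
    using cls that unfolding countable_classes_def is_real_iff rel_iff by blast
  obtain C where C: "closed3 C" and EC': "\<And>p. p \<epsilon> E \<longleftrightarrow> (\<exists>x y z. p = pr x y \<and> pr (pr x y) z \<epsilon> C)"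
    using ana unfolding is_analytic_def is_pair_iff rel3_iff by blast
  have EC: "pr x y \<epsilon> E \<longleftrightarrow> (\<exists>z. pr (pr x y) z \<epsilon> C)" for x y unfolding EC' by simp
  have "small C emp emp emp"
  proof (rule meager_of_countable_sections[OF C])
    fix x assume x: "Fun x W Two"
    then obtain c where "\<And>y. y \<epsilon> c \<longleftrightarrow> pr x y \<epsilon> E" "is_countable c" using E_cls by blast
    then show "\<exists>c. is_countable c \<and> x \<epsilon> c \<and> (\<forall>y z. pr (pr x y) z \<epsilon> C \<longrightarrow> y \<epsilon> c) \<and> (\<forall>y. y \<epsilon> c \<longrightarrow> Fun y W Two)"
      using E_refl[OF x] EC E_real by (intro exI[of _ c]) auto
  qed
  then obtain f where f: "continuous_fun f"
    and fC: "\<And>a b z. a \<epsilon> Cantor \<Longrightarrow> b \<epsilon> Cantor \<Longrightarrow> a \<noteq> b \<Longrightarrow> \<not> pr (pr (app f a) (app f b)) z \<epsilon> C"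
    using inequivalent_continuous_fun[OF C] by blast
  have fE: "a = b" if "a \<epsilon> Cantor" "b \<epsilon> Cantor" "pr (app f a) (app f b) \<epsilon> E" for a b
    using fC[OF that(1,2)] that(3) EC by blast
  have F: "Fun f Cantor Cantor" using f unfolding continuous_fun_def by blast
  have fr: "Fun (app f a) W Two" if "a \<epsilon> Cantor" for a using app_mem[OF F that] mem_Cantor by blast
  have AR: "a \<epsilon> Cantor" if "a \<epsilon> A" for a using A that unfolding set_of_reals_def is_real_iff mem_Cantor by blast
  define B where "B = Sep Cantor (\<lambda>y. \<exists>a. a \<epsilon> A \<and> pr (app f a) y \<epsilon> E)"
  have "y \<epsilon> B \<longleftrightarrow> y \<epsilon> Cantor \<and> (\<exists>a. a \<epsilon> A \<and> pr (app f a) y \<epsilon> E)" for y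
    unfolding B_def by (rule mem_Sep) (intro D_intros)
  then have B: "y \<epsilon> B \<longleftrightarrow> (\<exists>a. a \<epsilon> A \<and> pr (app f a) y \<epsilon> E)" for y using E_real(2) mem_Cantor by blast
  have "set_of_reals B" unfolding set_of_reals_def is_real_iff using B E_real by blast
  moreover have "invariant E B" unfolding invariant_def rel_iff using B E_trans by blast
  ultimately have "perfect_set_property B" using inv by blast
  then consider "is_countable B" | P where "is_perfect P" "P \<noteq> emp" "P \<sqsubseteq> B"
    unfolding perfect_set_property_def is_empty_iff by blast
  then show ?thesis
  proof cases
    case 1
    have "is_countable A"
    proof (rule countable_surj[OF 1, of "\<lambda>a y. y = app f a"])
      show "D (\<lambda>v. v (Suc 0) = app f (v 0))" by (intro D_intros)
      show "\<exists>b. b \<epsilon> B \<and> b = app f a" if "a \<epsilon> A" for a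
        using B that E_refl[OF fr[OF AR[OF that]]] by blast
      fix a a' b assume "a \<epsilon> A" "a' \<epsilon> A" "b = app f a" "b = app f a'"
      moreover then have "pr (app f a) (app f a') \<epsilon> E" using E_refl fr AR by simp
      ultimately show "a = a'" using fE AR by blast
    qed
    then show ?thesis unfolding perfect_set_property_def by blast
  next
    case (2 P)
    \<comment> \<open>\<open>Pw (cart W W)\<close> contains every element of Baire space and serves
      as the bound that separation requires.\<close>
    define K where "K = Sep (cart (cart Cantor Cantor) (Pw (cart W W)))
      (\<lambda>q. snd' (fst' q) \<epsilon> P \<and> pr (pr (snd' (fst' q)) (app f (fst' (fst' q)))) (snd' q) \<epsilon> C)"
    have K0: "q \<epsilon> K \<longleftrightarrow> q \<epsilon> cart (cart Cantor Cantor) (Pw (cart W W)) \<and> snd' (fst' q) \<epsilon> P \<and>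
      pr (pr (snd' (fst' q)) (app f (fst' (fst' q)))) (snd' q) \<epsilon> C" for q
      unfolding K_def by (rule mem_Sep) (intro D_intros)
    have K: "q \<epsilon> K \<longleftrightarrow> (\<exists>a x z. q = pr (pr a x) z \<and> a \<epsilon> Cantor \<and> x \<epsilon> P \<and> pr (pr x (app f a)) z \<epsilon> C)" for q
    proof
      assume "q \<epsilon> K"
      then have q: "q \<epsilon> cart (cart Cantor Cantor) (Pw (cart W W))" "snd' (fst' q) \<epsilon> P"
        "pr (pr (snd' (fst' q)) (app f (fst' (fst' q)))) (snd' q) \<epsilon> C" using K0 by blast+
      then obtain a x z where "q = pr (pr a x) z" "a \<epsilon> Cantor" by (auto simp: mem_cart)
      then show "\<exists>a x z. q = pr (pr a x) z \<and> a \<epsilon> Cantor \<and> x \<epsilon> P \<and> pr (pr x (app f a)) z \<epsilon> C" using q by auto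
    next
      assume "\<exists>a x z. q = pr (pr a x) z \<and> a \<epsilon> Cantor \<and> x \<epsilon> P \<and> pr (pr x (app f a)) z \<epsilon> C"
      then obtain a x z where *: "q = pr (pr a x) z" "a \<epsilon> Cantor" "x \<epsilon> P" "pr (pr x (app f a)) z \<epsilon> C" by blast
      have "x \<epsilon> Cantor" "z \<sqsubseteq> cart W W"
        using closed3_D(1)[OF C *(4)] Fun_sub_cart[OF closed3_D(3)[OF C *(4)] sub_refl]
        unfolding mem_Cantor by auto
      then show "q \<epsilon> K" unfolding K0 using * by simp
    qed
    have clK: "closed3 K" by (rule closed3_pullback[OF C 2(1) f K])
    define A' where "A' = Sep Cantor (\<lambda>a. \<exists>x. x \<epsilon> P \<and> pr x (app f a) \<epsilon> E)"
    have A': "a \<epsilon> A' \<longleftrightarrow> a \<epsilon> Cantor \<and> (\<exists>x. x \<epsilon> P \<and> pr x (app f a) \<epsilon> E)" for a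
      unfolding A'_def by (rule mem_Sep) (intro D_intros)
    have A'K: "a \<epsilon> A' \<longleftrightarrow> (\<exists>x z. pr (pr a x) z \<epsilon> K)" for a
      unfolding A' K EC by auto
    have sub: "A' \<sqsubseteq> A"
    proof (rule subI)
      fix a assume "a \<epsilon> A'"
      then obtain x where x: "a \<epsilon> Cantor" "x \<epsilon> P" "pr x (app f a) \<epsilon> E" using A' by blast
      then obtain b where b: "b \<epsilon> A" "pr (app f b) x \<epsilon> E" using 2(3) subD B by blast
      then have "b = a" using fE[OF AR[OF b(1)] x(1)] E_trans x by blast
      then show "a \<epsilon> A" using b by simp
    qed
    have "\<not> is_countable A'"
    proof
      assume cA': "is_countable A'"
      have "is_countable P"
      proof (rule countable_UN[OF cA', of "\<lambda>a x. pr (app f a) x \<epsilon> E"])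
        show "D (\<lambda>v. pr (app f (v 0)) (v (Suc 0)) \<epsilon> E)" by (intro D_intros)
        show "\<exists>a. a \<epsilon> A' \<and> pr (app f a) x \<epsilon> E" if x: "x \<epsilon> P" for x
        proof -
          obtain a where "a \<epsilon> A" "pr (app f a) x \<epsilon> E" using 2(3) subD x B by blast
          then show ?thesis using A' AR E_sym x by blast
        qed
        show "\<exists>Y. is_countable Y \<and> (\<forall>x. x \<epsilon> P \<and> pr (app f a) x \<epsilon> E \<longrightarrow> x \<epsilon> Y)" if "a \<epsilon> A'" for a
          using E_cls[OF fr] that A' by blast
      qed
      moreover obtain e where "e \<epsilon> P" using 2(2) set_ext[of P emp] mem_emp by blast
      ultimately show False using perfect_uncountable 2(1) by blast
    qed
    then obtain P' where "is_perfect P'" "\<not> is_empty P'" "P' \<sqsubseteq> A'"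
      using projection_perfect_subset[OF clK A'K] by blast
    then show ?thesis unfolding perfect_set_property_def using sub sub_trans by blast
  qed
qed

end

theorem theorem3p1:
  fixes mem :: "'a \<Rightarrow> 'a \<Rightarrow> bool" and E :: 'a
  assumes "ZF_DC mem"
    and "set_structure.is_equivalence mem E"
    and "set_structure.is_analytic mem E"
    and "set_structure.countable_classes mem E"
    and "\<forall>A. set_structure.set_of_reals mem A \<and> set_structure.invariant mem E A \<longrightarrow>
           set_structure.perfect_set_property mem A"
  shows "\<forall>A. set_structure.set_of_reals mem A \<longrightarrow> set_structure.perfect_set_property mem A"
  using ZF_DC.perfect_set_property_of_invariant[OF assms] by blast

end
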